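(* Let $f:\mathbb R^n\to\mathbb R$ be convex with locally Lipschitz continuous gradient, $g:\mathbb R^n\to\mathbb R\cup\{\infty\}$ and $h:\mathbb R^m\to\mathbb R\cup\{\infty\}$ be proper, convex and lsc, and $A:\mathbb R^n\to\mathbb R^m$ be linear. Suppose that $\varphi(x):=f(x)+g(x)+h(Ax)$ has a minimizer, and that there exists $x\in\operatorname{relint}\operatorname{dom}g$ with $Ax\in\operatorname{relint}\operatorname{dom}h$. Let $(x^k,y^k)$, with stepsizes $\gamma_k$ and norm estimates $\eta_k$, be generated by either one of the algorithms adaPDM or adaPDM$^+$ described in the context, with parameters $t>0$, $\epsilon>0$, $\nu>1+\epsilon$ (and $r>1$ for adaPDM$^+$). Set $\rho_k:=\gamma_k/\gamma_{k-1}$, $\xi_k:=t^2\eta_k^2\gamma_k^2$, $\delta_k:=\gamma_k\ell_k(\gamma_kc_k-1)$, and $\eta_{\max}:=\|A\|$ for adaPDM, $\eta_{\max}:=\max\{\eta_0,r\|A\|\}$ for adaPDM$^+$. Then, for any primal-dual solution $(x^\star,y^\star)$, with $P_k,Q_k$ as in the context and $$\mathcal U_k:=\tfrac12\|x^k-x^\star\|^2+\tfrac{1-4\xi_k(1+\epsilon)}4\|x^k-x^{k-1}\|^2+\tfrac1{2t^2}\|y^k-y^\star\|^2+\gamma_k(1+\rho_k)P_{k-1},$$ the following hold. (i) For all $k\ge1$, $$\mathcal U_{k+1}\le\mathcal U_k-\tfrac{\epsilon}{2t^2(1+\epsilon)}\|y^k-y^{k-1}\|^2-\tfrac{1-4\xi_k-4\rho_{k+1}^2(\delta_k+\xi_{k+1})}4\|x^k-x^{k+1}\|^2-\gamma_k(1+\rho_k-\rho_{k+1}^2)P_{k-1}-\gamma_{k+1}Q_{k+1},$$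 where $\tfrac{1-4\xi_k-4\rho_{k+1}^2(\delta_k+\xi_{k+1})}4\ge\tfrac{\epsilon}{4(1+\epsilon)}$ and $1+\rho_k-\rho_{k+1}^2\ge0$. (ii) The sequence $(x^k,y^k)$ is bounded, and $\gamma_k\ge\hat\gamma>0$ for all $k\ge1$, where, with $\bar\nu:=\frac{\nu^2-(1+\epsilon)^2}{\nu^2}$, $\mathcal V$ a compact convex set containing the sequence $(x^k)$, $\overline{\mathcal V}:=\mathcal V+\{x:\|x\|\le\operatorname{diam}\mathcal V\}$ and $L_{f,\overline{\mathcal V}}>0$ a Lipschitz modulus of $\nabla f$ on $\overline{\mathcal V}$, $$\hat\gamma:=\min\left\{\gamma_0,\ \tfrac{\bar\nu^{1/4}}{\sqrt{2(1+\epsilon)t\eta_{\max}L_{f,\overline{\mathcal V}}}},\ \tfrac{\sqrt{\bar\nu}}{2\sqrt{1+\epsilon}\,L_{f,\overline{\mathcal V}}},\ \tfrac1{2\nu t\eta_{\max}},\ \tfrac{\sqrt{\bar\nu}}{2(1+\epsilon)t\eta_{\max}}\right\}.$$ (iii) $\liminf_{k\to\infty}P_k=\lim_{k\to\infty}Q_k=0$. (iv) The sequence $(x^k,y^k)$ converges to a primal-dual solution.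
   Context: Norms and inner products are Euclidean, $\|A\|$ is the operator norm, $h^*$ is the convex conjugate of $h$, and $\operatorname{prox}_{\tau g}(x):=\operatorname{argmin}_{w}\{g(w)+\frac1{2\tau}\|w-x\|^2\}$ for $\tau>0$. A differentiable $f$ has locally Lipschitz continuous gradient if for every convex compact $\mathcal V\subset\mathbb R^n$ there is $L_{f,\mathcal V}>0$ (a Lipschitz modulus) with $\|\nabla f(x)-\nabla f(x')\|\le L_{f,\mathcal V}\|x-x'\|$ on $\mathcal V$. $\operatorname{diam}\mathcal V:=\sup_{x,y\in\mathcal V}\|x-y\|$. A pair $(x^\star,y^\star)$ is a primal-dual solution if $0\in-Ax^\star+\partial h^*(y^\star)$ and $0\in A^\top y^\star+\nabla f(x^\star)+\partial g(x^\star)$. Given such a pair, $$P_k:=(f+g)(x^k)-(f+g)(x^\star)+\langle x^k-x^\star,A^\top y^\star\rangle,\qquad Q_k:=h^*(y^k)-h^*(y^\star)+\langle Ax^\star,y^\star-y^k\rangle.$$ Local estimates: $$\ell_k:=\frac{\langle\nabla f(x^{k-1})-\nabla f(x^k),x^{k-1}-x^k\rangle}{\|x^{k-1}-x^k\|^2},\qquad c_k:=\frac{\|\nabla f(x^{k-1})-\nabla f(x^k)\|^2}{\langle\nabla f(x^{k-1})-\nabla f(x^k),x^{k-1}-x^k\rangle}.$$ Throughout, the conventions $\frac00=0$ and $\frac10=\infty$ are used. For $k\ge0$ and a number $\eta\ge0$ (candidate for $\eta_{k+1}$), define the stepsize $$\Gamma_k(\eta):=\min\left\{\gamma_k\sqrt{1+\tfrac{\gamma_k}{\gamma_{k-1}}},\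 \frac1{2\nu t\eta},\ \gamma_k\sqrt{\frac{1-4\xi_k(1+\epsilon)^2}{2(1+\epsilon)\Bigl(\sqrt{\delta_k^2+(t\eta\gamma_k)^2(1-4\xi_k(1+\epsilon)^2)}+\delta_k\Bigr)}}\right\}$$ with $\xi_k=t^2\gamma_k^2\eta_k^2$, $\delta_k=\gamma_k\ell_k(\gamma_kc_k-1)$, and, for $\gamma>0$, the dual update $$Y_k(\gamma):=\operatorname{prox}_{t^2\gamma h^*}\Bigl(y^k+t^2\gamma\bigl((1+\tfrac{\gamma}{\gamma_k})Ax^k-\tfrac{\gamma}{\gamma_k}Ax^{k-1}\bigr)\Bigr).$$ Algorithm adaPDM. Input: $(x^{-1},y^0)\in\mathbb R^n\times\mathbb R^m$, stepsizes $0<\gamma_{-1}\le\gamma_0\le\frac1{2\nu t\|A\|}$. Put $\eta_k:=\|A\|$ for all $k$. Set $x^0=\operatorname{prox}_{\gamma_0g}(x^{-1}-\gamma_0\nabla f(x^{-1})-\gamma_0A^\top y^0)$. For $k=0,1,\dots$: $\gamma_{k+1}=\Gamma_k(\|A\|)$, $\sigma_{k+1}=t^2\gamma_{k+1}$, $y^{k+1}=Y_k(\gamma_{k+1})$, $x^{k+1}=\operatorname{prox}_{\gamma_{k+1}g}(x^k-\gamma_{k+1}\nabla f(x^k)-\gamma_{k+1}A^\top y^{k+1})$. Algorithm adaPDM$^+$. Input: $(x^{-1},y^0)\in\mathbb R^n\times\mathbb R^m$, $\eta_0>0$, stepsizes $0<\gamma_{-1}\le\gamma_0\le\frac1{2\nu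 t\eta_0}$, backtracking parameter $r>1$. Set $x^0$ as in adaPDM. For $k=0,1,\dots$: choose any $\eta_{k+1}$ with $0<\eta_{k+1}\le\eta_k$; then repeat: set $\gamma_{k+1}=\Gamma_k(\eta_{k+1})$, $\sigma_{k+1}=t^2\gamma_{k+1}$, $y^{k+1}=Y_k(\gamma_{k+1})$; if $\eta_{k+1}\ge\frac{\|A^\top(y^{k+1}-y^k)\|}{\|y^{k+1}-y^k\|}$ stop repeating, otherwise replace $\eta_{k+1}$ by $r\eta_{k+1}$ and repeat. Finally set $x^{k+1}=\operatorname{prox}_{\gamma_{k+1}g}(x^k-\gamma_{k+1}\nabla f(x^k)-\gamma_{k+1}A^\top y^{k+1})$. Here $\eta_{k+1},\gamma_{k+1},y^{k+1}$ denote the finally accepted values.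
   Formalization: The inequality in (i) is false as printed (f=g=h=0, A=0, y^0≠0, k=1); proved with y^{k+1}-y^k for y^k-y^{k-1}, x^k-x^{k-1} for x^k-x^{k+1}, and ξ_k, ξ_{k+1} multiplied by 1+ε in the coefficient. In (ii), V also contains x^{-1}. *)

theory Defs
  imports "HOL-Analysis.Analysis"
begin

text \<open>
  Extended-real-valued functions have type \<open>'a \<Rightarrow> ereal\<close>.  Division in \<open>ereal\<close> satisfies
  \<open>0 / 0 = 0\<close> and \<open>c / 0 = \<infinity>\<close> for \<open>c > 0\<close>; it is used wherever the convention
  \<open>1 / 0 = \<infinity>\<close> can matter.  Real division gives \<open>0 / 0 = 0\<close>.
\<close>

definition proper_fun :: "('a \<Rightarrow> ereal) \<Rightarrow> bool" where
  "proper_fun g \<longleftrightarrow> (\<forall>x. g x \<noteq> -\<infinity>) \<and> (\<exists>x. g x \<noteq> \<infinity>)"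

definition convex_fun :: "('a::real_vector \<Rightarrow> ereal) \<Rightarrow> bool" where
  "convex_fun g \<longleftrightarrow> convex {(x, r::real). g x \<le> ereal r}"

definition lsc_fun :: "('a::topological_space \<Rightarrow> ereal) \<Rightarrow> bool" where
  "lsc_fun g \<longleftrightarrow> (\<forall>x. g x \<le> Liminf (at x) g)"

definition edom :: "('a \<Rightarrow> ereal) \<Rightarrow> 'a set" where
  "edom g = {x. g x < \<infinity>}"

definition conjugate :: "('a::real_inner \<Rightarrow> ereal) \<Rightarrow> 'a \<Rightarrow> ereal" where
  "conjugate h y = (SUP x. ereal (x \<bullet> y) - h x)"

definition subdifferential :: "('a::real_inner \<Rightarrow> ereal) \<Rightarrow> 'a \<Rightarrow> 'a set" where
  "subdifferential g x = {v. \<forall>z. g x + ereal (v \<bullet> (z - x)) \<le> g z}"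

definition prox :: "real \<Rightarrow> ('a::real_normed_vector \<Rightarrow> ereal) \<Rightarrow> 'a \<Rightarrow> 'a" where
  "prox \<tau> g x = arg_min (\<lambda>w. g w + ereal (1 / (2 * \<tau>) * (norm (w - x))\<^sup>2)) (\<lambda>_. True)"

definition gradient :: "('a::real_inner \<Rightarrow> real) \<Rightarrow> 'a \<Rightarrow> 'a" where
  "gradient f x = (THE D. GDERIV f x :> D)"

definition loc_lipschitz_gradient :: "('a::euclidean_space \<Rightarrow> real) \<Rightarrow> bool" where
  "loc_lipschitz_gradient f \<longleftrightarrow>
     (\<forall>x. f differentiable (at x)) \<and>
     (\<forall>V. convex V \<and> compact V \<longrightarrow> (\<exists>L>0. L-lipschitz_on V (gradient f)))"

definition primal_dual_solution ::
  "('a::euclidean_space \<Rightarrow> real) \<Rightarrow> ('a \<Rightarrow> ereal) \<Rightarrow> ('b::euclidean_space \<Rightarrow> ereal) \<Rightarrow> ('a \<Rightarrow> 'b)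
    \<Rightarrow> 'a \<Rightarrow> 'b \<Rightarrow> bool" where
  "primal_dual_solution f g h A xs ys \<longleftrightarrow>
     0 \<in> (\<lambda>v. - A xs + v) ` subdifferential (conjugate h) ys \<and>
     0 \<in> (\<lambda>v. adjoint A ys + gradient f xs + v) ` subdifferential g xs"

definition ereal_sqrt :: "ereal \<Rightarrow> ereal" where
  "ereal_sqrt a = (if a = \<infinity> then \<infinity> else ereal (sqrt (real_of_ereal a)))"


text \<open>
  Sequences are indexed by \<open>int\<close>: \<open>x k\<close> and \<open>\<gamma> k\<close> are meaningful for \<open>k \<ge> -1\<close>,
  \<open>y k\<close> and \<open>\<eta> k\<close> for \<open>k \<ge> 0\<close>; values at smaller indices are never used.
\<close>

definition ell :: "('a::real_inner \<Rightarrow> real) \<Rightarrow> (int \<Rightarrow> 'a) \<Rightarrow> int \<Rightarrow> real" where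
  "ell f x k = ((gradient f (x (k - 1)) - gradient f (x k)) \<bullet> (x (k - 1) - x k))
                 / (norm (x (k - 1) - x k))\<^sup>2"

text \<open>
  Real division suffices in \<open>cc\<close>: for convex differentiable \<open>f\<close> a vanishing denominator forces
  the two gradients to coincide, so only \<open>0 / 0\<close> can occur.
\<close>

definition cc :: "('a::real_inner \<Rightarrow> real) \<Rightarrow> (int \<Rightarrow> 'a) \<Rightarrow> int \<Rightarrow> real" where
  "cc f x k = (norm (gradient f (x (k - 1)) - gradient f (x k)))\<^sup>2
                / ((gradient f (x (k - 1)) - gradient f (x k)) \<bullet> (x (k - 1) - x k))"

definition delta :: "('a::real_inner \<Rightarrow> real) \<Rightarrow> (int \<Rightarrow> 'a) \<Rightarrow> (int \<Rightarrow> real) \<Rightarrow> int \<Rightarrow> real" where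
  "delta f x \<gamma> k = \<gamma> k * ell f x k * (\<gamma> k * cc f x k - 1)"

definition xi :: "real \<Rightarrow> (int \<Rightarrow> real) \<Rightarrow> (int \<Rightarrow> real) \<Rightarrow> int \<Rightarrow> real" where
  "xi t \<gamma> \<eta> k = t\<^sup>2 * (\<gamma> k)\<^sup>2 * (\<eta> k)\<^sup>2"

text \<open>
  The candidate stepsize \<open>\<Gamma>\<^sub>k(e)\<close>.  The minimum is real because its first entry is
  and the other two are never \<open>-\<infinity>\<close>.
\<close>

definition stepsize ::
  "('a::real_inner \<Rightarrow> real) \<Rightarrow> real \<Rightarrow> real \<Rightarrow> real \<Rightarrow> (int \<Rightarrow> 'a) \<Rightarrow> (int \<Rightarrow> real) \<Rightarrow> (int \<Rightarrow> real)
    \<Rightarrow> int \<Rightarrow> real \<Rightarrow> real" where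
  "stepsize f t \<epsilon> \<nu> x \<gamma> \<eta> k e =
     real_of_ereal
      (min (ereal (\<gamma> k * sqrt (1 + \<gamma> k / \<gamma> (k - 1))))
      (min (1 / ereal (2 * \<nu> * t * e))
           (ereal (\<gamma> k) *
            ereal_sqrt
             (ereal (1 - 4 * xi t \<gamma> \<eta> k * (1 + \<epsilon>)\<^sup>2) /
              ereal (2 * (1 + \<epsilon>) *
                (sqrt ((delta f x \<gamma> k)\<^sup>2
                       + (t * e * \<gamma> k)\<^sup>2 * (1 - 4 * xi t \<gamma> \<eta> k * (1 + \<epsilon>)\<^sup>2))
                 + delta f x \<gamma> k))))))"

definition dual_update ::
  "('b::real_inner \<Rightarrow> ereal) \<Rightarrow> ('a \<Rightarrow> 'b) \<Rightarrow> real \<Rightarrow> (int \<Rightarrow> 'a) \<Rightarrow> (int \<Rightarrow> 'b) \<Rightarrow> (int \<Rightarrow> real)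
    \<Rightarrow> int \<Rightarrow> real \<Rightarrow> 'b" where
  "dual_update h A t x y \<gamma> k s =
     prox (t\<^sup>2 * s) (conjugate h)
       (y k + (t\<^sup>2 * s) *\<^sub>R ((1 + s / \<gamma> k) *\<^sub>R A (x k) - (s / \<gamma> k) *\<^sub>R A (x (k - 1))))"

definition adaPDM ::
  "('a::euclidean_space \<Rightarrow> real) \<Rightarrow> ('a \<Rightarrow> ereal) \<Rightarrow> ('b::euclidean_space \<Rightarrow> ereal) \<Rightarrow> ('a \<Rightarrow> 'b)
    \<Rightarrow> real \<Rightarrow> real \<Rightarrow> real
    \<Rightarrow> (int \<Rightarrow> 'a) \<Rightarrow> (int \<Rightarrow> 'b) \<Rightarrow> (int \<Rightarrow> real) \<Rightarrow> (int \<Rightarrow> real) \<Rightarrow> bool" where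
  "adaPDM f g h A t \<epsilon> \<nu> x y \<gamma> \<eta> \<longleftrightarrow>
     0 < \<gamma> (-1) \<and> \<gamma> (-1) \<le> \<gamma> 0 \<and> ereal (\<gamma> 0) \<le> 1 / ereal (2 * \<nu> * t * onorm A) \<and>
     (\<forall>k\<ge>0. \<eta> k = onorm A) \<and>
     x 0 = prox (\<gamma> 0) g (x (-1) - \<gamma> 0 *\<^sub>R gradient f (x (-1)) - \<gamma> 0 *\<^sub>R adjoint A (y 0)) \<and>
     (\<forall>k\<ge>0.
        \<gamma> (k + 1) = stepsize f t \<epsilon> \<nu> x \<gamma> \<eta> k (onorm A) \<and>
        y (k + 1) = dual_update h A t x y \<gamma> k (\<gamma> (k + 1)) \<and>
        x (k + 1) = prox (\<gamma> (k + 1)) g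
          (x k - \<gamma> (k + 1) *\<^sub>R gradient f (x k) - \<gamma> (k + 1) *\<^sub>R adjoint A (y (k + 1))))"

text \<open>The acceptance test of the backtracking loop for a candidate value \<open>e\<close> of \<open>\<eta> (k + 1)\<close>.\<close>

definition backtrack_ok ::
  "('a::euclidean_space \<Rightarrow> real) \<Rightarrow> ('b::euclidean_space \<Rightarrow> ereal) \<Rightarrow> ('a \<Rightarrow> 'b)
    \<Rightarrow> real \<Rightarrow> real \<Rightarrow> real
    \<Rightarrow> (int \<Rightarrow> 'a) \<Rightarrow> (int \<Rightarrow> 'b) \<Rightarrow> (int \<Rightarrow> real) \<Rightarrow> (int \<Rightarrow> real) \<Rightarrow> int \<Rightarrow> real \<Rightarrow> bool" where
  "backtrack_ok f h A t \<epsilon> \<nu> x y \<gamma> \<eta> k e \<longleftrightarrow>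
     (let y' = dual_update h A t x y \<gamma> k (stepsize f t \<epsilon> \<nu> x \<gamma> \<eta> k e)
      in e \<ge> norm (adjoint A (y' - y k)) / norm (y' - y k))"

text \<open>
  In each iteration \<open>e\<close> is the freely chosen initial candidate and \<open>j\<close> the number of rejections,
  so that \<open>\<eta> (k + 1)\<close> is the first of \<open>e, r * e, r\<^sup>2 * e, \<dots>\<close> passing the test.
\<close>

definition adaPDM_plus ::
  "real \<Rightarrow> ('a::euclidean_space \<Rightarrow> real) \<Rightarrow> ('a \<Rightarrow> ereal) \<Rightarrow> ('b::euclidean_space \<Rightarrow> ereal) \<Rightarrow> ('a \<Rightarrow> 'b)
    \<Rightarrow> real \<Rightarrow> real \<Rightarrow> real
    \<Rightarrow> (int \<Rightarrow> 'a) \<Rightarrow> (int \<Rightarrow> 'b) \<Rightarrow> (int \<Rightarrow> real) \<Rightarrow> (int \<Rightarrow> real) \<Rightarrow> bool" where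
  "adaPDM_plus r f g h A t \<epsilon> \<nu> x y \<gamma> \<eta> \<longleftrightarrow>
     0 < \<eta> 0 \<and>
     0 < \<gamma> (-1) \<and> \<gamma> (-1) \<le> \<gamma> 0 \<and> ereal (\<gamma> 0) \<le> 1 / ereal (2 * \<nu> * t * \<eta> 0) \<and>
     x 0 = prox (\<gamma> 0) g (x (-1) - \<gamma> 0 *\<^sub>R gradient f (x (-1)) - \<gamma> 0 *\<^sub>R adjoint A (y 0)) \<and>
     (\<forall>k\<ge>0.
        (\<exists>e j. 0 < e \<and> e \<le> \<eta> k \<and> \<eta> (k + 1) = r ^ j * e \<and>
           (\<forall>i<j. \<not> backtrack_ok f h A t \<epsilon> \<nu> x y \<gamma> \<eta> k (r ^ i * e)) \<and>
           backtrack_ok f h A t \<epsilon> \<nu> x y \<gamma> \<eta> k (\<eta> (k + 1))) \<and>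
        \<gamma> (k + 1) = stepsize f t \<epsilon> \<nu> x \<gamma> \<eta> k (\<eta> (k + 1)) \<and>
        y (k + 1) = dual_update h A t x y \<gamma> k (\<gamma> (k + 1)) \<and>
        x (k + 1) = prox (\<gamma> (k + 1)) g
          (x k - \<gamma> (k + 1) *\<^sub>R gradient f (x k) - \<gamma> (k + 1) *\<^sub>R adjoint A (y (k + 1))))"


definition primal_gap ::
  "('a::euclidean_space \<Rightarrow> real) \<Rightarrow> ('a \<Rightarrow> ereal) \<Rightarrow> ('a \<Rightarrow> 'b::euclidean_space)
    \<Rightarrow> (int \<Rightarrow> 'a) \<Rightarrow> 'a \<Rightarrow> 'b \<Rightarrow> int \<Rightarrow> ereal" where
  "primal_gap f g A x xs ys k =
     (ereal (f (x k)) + g (x k)) - (ereal (f xs) + g xs) + ereal ((x k - xs) \<bullet> adjoint A ys)"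

definition dual_gap ::
  "('b::euclidean_space \<Rightarrow> ereal) \<Rightarrow> ('a \<Rightarrow> 'b) \<Rightarrow> (int \<Rightarrow> 'b) \<Rightarrow> 'a \<Rightarrow> 'b \<Rightarrow> int \<Rightarrow> ereal" where
  "dual_gap h A y xs ys k =
     conjugate h (y k) - conjugate h ys + ereal (A xs \<bullet> (ys - y k))"

definition lyapunov ::
  "('a::euclidean_space \<Rightarrow> real) \<Rightarrow> ('a \<Rightarrow> ereal) \<Rightarrow> ('a \<Rightarrow> 'b::euclidean_space) \<Rightarrow> real \<Rightarrow> real
    \<Rightarrow> (int \<Rightarrow> 'a) \<Rightarrow> (int \<Rightarrow> 'b) \<Rightarrow> (int \<Rightarrow> real) \<Rightarrow> (int \<Rightarrow> real) \<Rightarrow> 'a \<Rightarrow> 'b \<Rightarrow> int \<Rightarrow> ereal" where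
  "lyapunov f g A t \<epsilon> x y \<gamma> \<eta> xs ys k =
     ereal (1/2 * (norm (x k - xs))\<^sup>2
            + (1 - 4 * xi t \<gamma> \<eta> k * (1 + \<epsilon>)) / 4 * (norm (x k - x (k - 1)))\<^sup>2
            + 1 / (2 * t\<^sup>2) * (norm (y k - ys))\<^sup>2)
     + ereal (\<gamma> k * (1 + \<gamma> k / \<gamma> (k - 1))) * primal_gap f g A x xs ys (k - 1)"

text \<open>
  The factor of \<open>(norm (x k - x (k - 1)))\<^sup>2\<close> in the decrease of \<open>lyapunov\<close> from \<open>k\<close> to \<open>k + 1\<close>.
  That decrease pairs this factor with the primal increment \<open>x k - x (k - 1)\<close> and involves the
  dual increment \<open>y (k + 1) - y k\<close>.  With \<open>y k - y (k - 1)\<close> in place of the latter the estimate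
  fails already for \<open>f = g = h = 0\<close>, \<open>A = 0\<close>, \<open>y 0 \<noteq> 0\<close>, \<open>k = 1\<close>.  The factors \<open>1 + \<epsilon>\<close> here
  correspond to the one multiplying \<open>xi\<close> in \<open>lyapunov\<close>.
\<close>

definition decrease_coeff ::
  "('a::euclidean_space \<Rightarrow> real) \<Rightarrow> real \<Rightarrow> real
    \<Rightarrow> (int \<Rightarrow> 'a) \<Rightarrow> (int \<Rightarrow> real) \<Rightarrow> (int \<Rightarrow> real) \<Rightarrow> int \<Rightarrow> real" where
  "decrease_coeff f t \<epsilon> x \<gamma> \<eta> k =
     (1 - 4 * xi t \<gamma> \<eta> k * (1 + \<epsilon>)
        - 4 * (\<gamma> (k + 1) / \<gamma> k)\<^sup>2 * (delta f x \<gamma> k + xi t \<gamma> \<eta> (k + 1) * (1 + \<epsilon>))) / 4"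

text \<open>The lower bound for the stepsizes, with \<open>L\<close> a Lipschitz modulus of the gradient of \<open>f\<close>.\<close>

definition gamma_hat :: "real \<Rightarrow> real \<Rightarrow> real \<Rightarrow> real \<Rightarrow> real \<Rightarrow> real \<Rightarrow> ereal" where
  "gamma_hat t \<epsilon> \<nu> \<gamma>0 \<eta>max L =
     (let \<nu>b = (\<nu>\<^sup>2 - (1 + \<epsilon>)\<^sup>2) / \<nu>\<^sup>2 in
      Min {ereal \<gamma>0,
           ereal (root 4 \<nu>b) / ereal (sqrt (2 * (1 + \<epsilon>) * t * \<eta>max * L)),
           ereal (sqrt \<nu>b) / ereal (2 * sqrt (1 + \<epsilon>) * L),
           1 / ereal (2 * \<nu> * t * \<eta>max),
           ereal (sqrt \<nu>b) / ereal (2 * (1 + \<epsilon>) * t * \<eta>max)})"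

end

theory Submission
  imports Defs
begin

text \<open>
  Adding the proximal subgradient inequalities at \<open>x (k + 1)\<close>, \<open>x k\<close> and \<open>y (k + 1)\<close> and
  absorbing the coupling terms by Young's inequality gives the descent of the Lyapunov function; the
  third entry of the stepsize is the positive root of the quadratic that makes the coefficient of
  \<open>(norm (x k - x (k - 1)))\<^sup>2\<close> nonnegative.  Cocoercivity of the gradient on an enlarged set bounds
  the stepsizes from below, so limit points of the iterates are primal-dual solutions.

  Convergence of the whole sequence needs care because the stepsizes may be unbounded.  Let the slack
  be the relative defect in \<open>\<rho>\<^sup>2 \<le> 1 + \<rho>\<close> between consecutive step ratios.  If the slacks are
  not summable, the weighted primal gap, and hence the Lyapunov function, tends to zero along a
  subsequence.  If they are summable, the stepsizes grow geometrically, the norm estimates are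
  summable, \<open>adjoint A (y k)\<close> converges, and the usual Opial argument applies because the unbounded
  terms of the Lyapunov functions of two limit points cancel.
\<close>

section \<open>Extended-real convex functions and proximal maps\<close>

text \<open>The obstacle is the product \<open>\<gamma> k * (1 + rho k) * P xs ys (k - 1)\<close>
  inside the Lyapunov function: with unbounded stepsizes it need not vanish where the gap does, so
  convergence of the Lyapunov values alone says little about the distance to a limit point. Among
  the losses of a descent step is \<open>slack\<close> times this weighted gap, which is why
  summability of the slacks separates the two cases. In the summable case the cap
  \<open>2 * \<nu> * t * \<eta> k * \<gamma> k \<le> 1\<close> converts growth of the stepsizes into
  decay of the norm estimates. For adaPDM, whose estimates are constant, this case can occur only if
  A = 0; adaPDM+ may let them shrink. In the other case the gap is small for a fixed reference pair
  and has to be carried over to the limit pair, which depends on the subsequence. Infinite values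
  and divisions by 0 are disposed of before the locale \<open>adaptive_primal_dual\<close> is
  entered; inside it, the algorithms are present only through real inequalities.\<close>

lemma closed_epigraph_lsc:
  fixes g :: "'a::euclidean_space \<Rightarrow> ereal"
  assumes "lsc_fun g"
  shows "closed {(x, r::real). g x \<le> ereal r}"
proof (unfold closed_sequential_limits, intro allI impI, elim conjE)
  fix s :: "nat \<Rightarrow> 'a \<times> real" and l
  assume s: "\<forall>n. s n \<in> {(x, r). g x \<le> ereal r}" and lim: "s \<longlonglongrightarrow> l"
  obtain x r where l: "l = (x, r)" by (cases l)
  have lx: "(\<lambda>n. fst (s n)) \<longlonglongrightarrow> x" and lr: "(\<lambda>n. snd (s n)) \<longlonglongrightarrow> r"
    using tendsto_fst[OF lim] tendsto_snd[OF lim] by (auto simp: l)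
  have "g x \<le> ereal r"
  proof (rule ccontr)
    assume "\<not> g x \<le> ereal r"
    then obtain q where q: "r < q" "ereal q < g x"
      using ereal_dense2[of "ereal r" "g x"] by (force simp: not_le)
    have "ereal q < Liminf (at x) g"
      using q assms unfolding lsc_fun_def by (meson less_le_trans)
    then have "\<forall>\<^sub>F w in at x. ereal q < g w" by (rule less_LiminfD)
    \<comment> \<open>\<open>lsc_fun\<close> controls the punctured neighbourhood; the centre is
      covered by \<open>ereal q < g x\<close>, so the bound also reaches sequences that hit
      \<open>x\<close>.\<close>
    then have "\<forall>\<^sub>F w in nhds x. ereal q < g w"
      using q by (auto simp: eventually_at_filter elim!: eventually_mono)
    then have "\<forall>\<^sub>F n in sequentially. ereal q < g (fst (s n))"
      using lx unfolding filterlim_iff by blast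
    moreover have "\<forall>\<^sub>F n in sequentially. snd (s n) < q"
      using lr q by (auto intro: order_tendstoD)
    ultimately have "\<forall>\<^sub>F n in sequentially. False"
    proof eventually_elim
      case (elim n)
      have "g (fst (s n)) \<le> ereal (snd (s n))" using s[rule_format, of n] by (auto split: prod.splits)
      then have "ereal q < ereal (snd (s n))" using elim(1) by (rule less_le_trans[rotated])
      with elim(2) show False by simp
    qed
    then show False by simp
  qed
  then show "l \<in> {(x, r). g x \<le> ereal r}" by (simp add: l)
qed

section \<open>Finite values and affine minorants of proper convex functions\<close>

lemma proper_fun_real:
  assumes "proper_fun g" "x \<in> edom g"
  shows "g x = ereal (real_of_ereal (g x))"
  using assms by (cases "g x") (auto simp: proper_fun_def edom_def)

lemma proper_fun_edomE:
  assumes "proper_fun g" "x \<in> edom g"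
  obtains c where "g x = ereal c"
  using proper_fun_real[OF assms] ..

lemma proper_fun_edom_nonempty: "proper_fun g \<Longrightarrow> edom g \<noteq> {}"
  by (auto simp: proper_fun_def edom_def)

lemma proper_convex_real:
  assumes "proper_fun g" "convex_fun g" "x \<in> edom g" "z \<in> edom g" "0 \<le> s" "s \<le> 1"
  shows "(1 - s) *\<^sub>R x + s *\<^sub>R z \<in> edom g"
    and "real_of_ereal (g ((1 - s) *\<^sub>R x + s *\<^sub>R z))
           \<le> (1 - s) * real_of_ereal (g x) + s * real_of_ereal (g z)"
proof -
  let ?S = "{(x, r::real). g x \<le> ereal r}"
  have "(x, real_of_ereal (g x)) \<in> ?S" "(z, real_of_ereal (g z)) \<in> ?S"
    using proper_fun_real[OF assms(1)] assms by auto
  then have "(1 - s) *\<^sub>R (x, real_of_ereal (g x)) + s *\<^sub>R (z, real_of_ereal (g z)) \<in> ?S"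
    using assms(2,5,6) by (intro convexD) (auto simp: convex_fun_def)
  then have *: "g ((1 - s) *\<^sub>R x + s *\<^sub>R z)
      \<le> ereal ((1 - s) * real_of_ereal (g x) + s * real_of_ereal (g z))" by simp
  then show e: "(1 - s) *\<^sub>R x + s *\<^sub>R z \<in> edom g"
    unfolding edom_def by (auto intro: le_less_trans)
  show "real_of_ereal (g ((1 - s) *\<^sub>R x + s *\<^sub>R z))
           \<le> (1 - s) * real_of_ereal (g x) + s * real_of_ereal (g z)"
    using * proper_fun_real[OF assms(1) e] by (metis ereal_less_eq(3))
qed

lemma proper_convex_on:
  assumes "proper_fun g" "convex_fun g"
  shows "convex_on (edom g) (\<lambda>x. real_of_ereal (g x))"
proof (rule convex_onI)
  show "convex (edom g)"
    unfolding convex_alt using proper_convex_real(1)[OF assms] by auto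
qed (use proper_convex_real(2)[OF assms] in auto)

text \<open>The epigraph is separated from the point one unit below a point of the graph. These two
  points differ only vertically, which makes the last component \<open>b\<close> of the normal
  positive; hence the hyperplane is the graph of an affine function. The minorant makes the proximal
  objective coercive and the conjugate finite somewhere.\<close>

lemma affine_minorant:
  fixes g :: "'a::euclidean_space \<Rightarrow> ereal"
  assumes "proper_fun g" "convex_fun g" "closed {(x, r::real). g x \<le> ereal r}"
  obtains a b where "\<And>x. ereal (a \<bullet> x + b) \<le> g x"
proof -
  let ?S = "{(x, r::real). g x \<le> ereal r}"
  obtain x0 where x0: "x0 \<in> edom g" using proper_fun_edom_nonempty assms(1) by blast
  define c0 where "c0 = real_of_ereal (g x0)"
  have c0: "g x0 = ereal c0" using proper_fun_real[OF assms(1) x0] by (simp add: c0_def)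
  have "(x0, c0 - 1) \<notin> ?S" by (simp add: c0)
  then obtain p \<beta> where sep: "p \<bullet> (x0, c0 - 1) < \<beta>" "\<And>z. z \<in> ?S \<Longrightarrow> p \<bullet> z > \<beta>"
    using separating_hyperplane_closed_point[of ?S "(x0, c0 - 1)"] assms(2,3)
    by (auto simp: convex_fun_def)
  obtain a b where p: "p = (a, b)" by (cases p)
  have "a \<bullet> x0 + b * (c0 - 1) < \<beta>" using sep(1) by (simp add: p)
  moreover have "\<beta> < a \<bullet> x0 + b * c0" using sep(2)[of "(x0, c0)"] by (simp add: p c0)
  moreover have "b * (c0 - 1) = b * c0 - b" by algebra
  ultimately have "b > 0" by linarith
  show thesis
  proof (rule that[of "- (1 / b) *\<^sub>R a" "\<beta> / b"])
    fix x
    show "ereal (- (1 / b) *\<^sub>R a \<bullet> x + \<beta> / b) \<le> g x"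
    proof (cases "x \<in> edom g")
      case True
      obtain c where c: "g x = ereal c" by (rule proper_fun_edomE[OF assms(1) True])
      have "a \<bullet> x + b * c > \<beta>"
        using sep(2)[of "(x, c)"] by (simp add: p c)
      then have "- (a \<bullet> x) / b + \<beta> / b \<le> c"
        using \<open>b > 0\<close> by (simp add: field_simps)
      then show ?thesis by (simp add: c)
    qed (auto simp: edom_def)
  qed
qed

section \<open>Closedness, convexity and properness of the conjugate\<close>

lemma epigraph_conjugate:
  "{(y, r::real). conjugate h y \<le> ereal r} = (\<Inter>x. {(y, r). ereal (x \<bullet> y) - h x \<le> ereal r})"
  by (auto simp: conjugate_def SUP_le_iff)

text \<open>Each \<open>x\<close> contributes to the intersection a half-space if \<open>h x\<close>
  is finite, the whole space if it is infinity, and the empty set if it is minus infinity.\<close>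

lemma closed_epigraph_conjugate:
  fixes h :: "'a::euclidean_space \<Rightarrow> ereal"
  shows "closed {(y, r::real). conjugate h y \<le> ereal r}"
  unfolding epigraph_conjugate
proof (intro closed_INT ballI)
  fix x
  show "closed {(y, r::real). ereal (x \<bullet> y) - h x \<le> ereal r}"
  proof (cases "h x")
    case (real c)
    have "{(y, r::real). ereal (x \<bullet> y) - h x \<le> ereal r} = {z. (x, -1) \<bullet> z \<le> c}"
      by (auto simp: real inner_prod_def)
    then show ?thesis using closed_halfspace_le by metis
  qed auto
qed

lemma convex_fun_conjugate:
  fixes h :: "'a::euclidean_space \<Rightarrow> ereal"
  shows "convex_fun (conjugate h)"
  unfolding convex_fun_def epigraph_conjugate
proof (intro convex_INT ballI)
  fix x
  show "convex {(y, r::real). ereal (x \<bullet> y) - h x \<le> ereal r}"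
  proof (cases "h x")
    case (real c)
    have "{(y, r::real). ereal (x \<bullet> y) - h x \<le> ereal r} = {z. (x, -1) \<bullet> z \<le> c}"
      by (auto simp: real inner_prod_def)
    then show ?thesis using convex_halfspace_le by metis
  qed (auto simp: convex_def)
qed

text \<open>The slope of an affine minorant of \<open>h\<close> is a point where the conjugate is
  finite, and a single point of \<open>edom h\<close> keeps the supremum away from minus
  infinity.\<close>

lemma proper_fun_conjugate:
  fixes h :: "'a::euclidean_space \<Rightarrow> ereal"
  assumes "proper_fun h" "convex_fun h" "closed {(x, r::real). h x \<le> ereal r}"
  shows "proper_fun (conjugate h)"
proof -
  obtain a b where ab: "\<And>x. ereal (a \<bullet> x + b) \<le> h x" using affine_minorant[OF assms] by blast
  have "ereal (x \<bullet> a) - h x \<le> ereal (- b)" for x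
    using ab[of x] by (cases "h x") (auto simp: inner_commute)
  then have "conjugate h a \<le> ereal (- b)" unfolding conjugate_def by (rule SUP_least)
  then have "conjugate h a \<noteq> \<infinity>" by auto
  moreover have "conjugate h y \<noteq> - \<infinity>" for y
  proof -
    obtain x where x: "x \<in> edom h" using proper_fun_edom_nonempty assms(1) by blast
    then have "ereal (x \<bullet> y - real_of_ereal (h x)) \<le> conjugate h y"
      unfolding conjugate_def using proper_fun_real[OF assms(1) x]
      by (intro SUP_upper2[of x]) (auto, metis ereal_minus(1) order_refl)
    then show ?thesis by auto
  qed
  ultimately show ?thesis by (auto simp: proper_fun_def)
qed

section \<open>Subgradients and proximal points\<close>

lemma subdifferential_proper:
  assumes "proper_fun g" "v \<in> subdifferential g p"
  shows "p \<in> edom g" and "z \<in> edom g \<Longrightarrow> real_of_ereal (g p) + v \<bullet> (z - p) \<le> real_of_ereal (g z)"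
proof -
  have sub: "g p + ereal (v \<bullet> (z - p)) \<le> g z" for z
    using assms(2) by (simp add: subdifferential_def)
  show p: "p \<in> edom g"
  proof -
    obtain z where z: "z \<in> edom g" using proper_fun_edom_nonempty assms(1) by blast
    show ?thesis using sub[of z] z by (cases "g p") (auto simp: edom_def)
  qed
  show "real_of_ereal (g p) + v \<bullet> (z - p) \<le> real_of_ereal (g z)" if z: "z \<in> edom g"
    using sub[of z] proper_fun_real[OF assms(1) p] proper_fun_real[OF assms(1) z]
    by (metis ereal_less_eq(3) plus_ereal.simps(1))
qed

lemma subdifferential_properI:
  assumes "proper_fun g" "p \<in> edom g"
    and "\<And>z. z \<in> edom g \<Longrightarrow> real_of_ereal (g p) + v \<bullet> (z - p) \<le> real_of_ereal (g z)"
  shows "v \<in> subdifferential g p"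
  unfolding subdifferential_def
proof (intro CollectI allI)
  fix z
  show "g p + ereal (v \<bullet> (z - p)) \<le> g z"
  proof (cases "z \<in> edom g")
    case True
    show ?thesis
      using assms(3)[OF True] proper_fun_real[OF assms(1) True] proper_fun_real[OF assms(1,2)]
      by (metis ereal_less_eq(3) plus_ereal.simps(1))
  qed (auto simp: edom_def)
qed

text \<open>\<open>prox\<close> is a Hilbert choice, so its properties rest on the existence of a
  minimizer. Minimizing over pairs in the epigraph replaces the semicontinuous objective by the
  continuous \<open>q\<close>, and the extreme value theorem applies on the compact sublevel set
  \<open>T\<close>.\<close>

lemma prox_minimizes:
  fixes g :: "'a::euclidean_space \<Rightarrow> ereal"
  assumes g: "proper_fun g" "convex_fun g" "closed {(x, r::real). g x \<le> ereal r}" and "\<tau> > 0"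
  shows "g (prox \<tau> g x) + ereal (1 / (2 * \<tau>) * (norm (prox \<tau> g x - x))\<^sup>2)
           \<le> g w + ereal (1 / (2 * \<tau>) * (norm (w - x))\<^sup>2)"
proof -
  let ?F = "\<lambda>w. g w + ereal (1 / (2 * \<tau>) * (norm (w - x))\<^sup>2)"
  let ?S = "{(x, r::real). g x \<le> ereal r}"
  define q :: "'a \<times> real \<Rightarrow> real"
    where "q z = snd z + 1 / (2 * \<tau>) * (norm (fst z - x))\<^sup>2" for z
  obtain a b where ab: "\<And>x. ereal (a \<bullet> x + b) \<le> g x" using affine_minorant[OF g] by blast
  obtain z0 where z0: "z0 \<in> edom g" using proper_fun_edom_nonempty g(1) by blast
  let ?p0 = "(z0, real_of_ereal (g z0))"
  have p0: "?p0 \<in> ?S" using proper_fun_real[OF g(1) z0] by auto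
  define T where "T = ?S \<inter> {z. q z \<le> q ?p0}"
  have cq: "continuous_on UNIV q" unfolding q_def by (intro continuous_intros)
  have "closed T" unfolding T_def
    by (intro closed_Int g(3) closed_Collect_le continuous_on_const cq)
  moreover have "bounded T"
  proof -
    \<comment> \<open>\<open>M\<close> and \<open>N\<close> come from inserting the affine minorant
      into the sublevel condition and completing the square in \<open>norm (w - x)\<close>.\<close>
    define M where "M = q ?p0 - a \<bullet> x - b"
    define N where "N = sqrt (2 * \<tau> * M + \<tau>\<^sup>2 * (norm a)\<^sup>2) + \<tau> * norm a"
    have *: "norm (w - x) \<le> N \<and> r \<in> {a \<bullet> x + b - norm a * N .. q ?p0}" if "(w, r) \<in> T" for w r
    proof -
      have "g w \<le> ereal r" using that by (simp add: T_def)
      with ab[of w] have "ereal (a \<bullet> w + b) \<le> ereal r" by (rule order_trans)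
      then have r: "a \<bullet> w + b \<le> r" by simp
      have q: "r + 1 / (2 * \<tau>) * (norm (w - x))\<^sup>2 \<le> q ?p0" using that by (auto simp: T_def q_def)
      have cs: "\<bar>a \<bullet> (w - x)\<bar> \<le> norm a * norm (w - x)" by (rule Cauchy_Schwarz_ineq2)
      have aw: "a \<bullet> w = a \<bullet> x + a \<bullet> (w - x)" by (simp add: inner_diff_right)
      have "1 / (2 * \<tau>) * (norm (w - x))\<^sup>2 - norm a * norm (w - x) \<le> M"
        using r q cs aw unfolding M_def by linarith
      then have "(norm (w - x))\<^sup>2 - 2 * \<tau> * (norm a * norm (w - x)) \<le> 2 * \<tau> * M"
        using \<open>\<tau> > 0\<close> by (simp add: field_simps)
      then have "(norm (w - x) - \<tau> * norm a)\<^sup>2 \<le> 2 * \<tau> * M + \<tau>\<^sup>2 * (norm a)\<^sup>2"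
        by (simp add: power2_eq_square algebra_simps)
      then have "norm (w - x) - \<tau> * norm a \<le> sqrt (2 * \<tau> * M + \<tau>\<^sup>2 * (norm a)\<^sup>2)"
        by (rule real_le_rsqrt)
      then have n: "norm (w - x) \<le> N" by (simp add: N_def)
      have "norm a * norm (w - x) \<le> norm a * N" using n by (simp add: mult_left_mono)
      moreover have "r \<le> q ?p0"
      proof -
        have "0 \<le> 1 / (2 * \<tau>) * (norm (w - x))\<^sup>2" using \<open>\<tau> > 0\<close> by simp
        with q show ?thesis by linarith
      qed
      ultimately show ?thesis using n r cs aw by auto
    qed
    have "T \<subseteq> cball x N \<times> {a \<bullet> x + b - norm a * N .. q ?p0}"
      using * by (auto simp: dist_norm norm_minus_commute)
    then show ?thesis by (rule bounded_subset[rotated]) (intro bounded_Times bounded_cball bounded_closed_interval)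
  qed
  ultimately have "compact T" by (simp add: compact_eq_bounded_closed)
  moreover have "?p0 \<in> T" using p0 by (simp add: T_def)
  ultimately obtain z where z: "z \<in> T" "\<And>z'. z' \<in> T \<Longrightarrow> q z \<le> q z'"
    using continuous_attains_inf[of T q] cq continuous_on_subset by blast
  have zS: "g (fst z) \<le> ereal (snd z)" using z(1) by (auto simp: T_def)
  have "?F (fst z) \<le> ?F w" for w
  proof (cases "w \<in> edom g")
    case True
    obtain c where c: "g w = ereal c" by (rule proper_fun_edomE[OF g(1) True])
    have "q z \<le> q (w, c)"
    proof (cases "q (w, c) \<le> q ?p0")
      case True
      then show ?thesis by (intro z(2)) (simp add: T_def c)
    next
      case False
      then show ?thesis using z(2)[OF \<open>?p0 \<in> T\<close>] by simp
    qed
    have "?F (fst z) \<le> ereal (snd z) + ereal (1 / (2 * \<tau>) * (norm (fst z - x))\<^sup>2)"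
      using zS by (rule add_right_mono)
    also have "\<dots> \<le> ?F w" using \<open>q z \<le> _\<close> by (simp add: q_def c)
    finally show ?thesis .
  qed (auto simp: edom_def)
  then have "is_arg_min ?F (\<lambda>_. True) (fst z)" by (simp add: is_arg_min_linorder)
  then have "is_arg_min ?F (\<lambda>_. True) (prox \<tau> g x)"
    unfolding prox_def arg_min_def by (rule someI)
  then show ?thesis by (simp add: is_arg_min_linorder)
qed

text \<open>First-order optimality: \<open>p\<close> is compared with points of the segment towards
  \<open>z\<close>, convexity of \<open>g\<close> is used, and after division by \<open>s\<close>
  the limit \<open>s = 0\<close> leaves only the linear part of the quadratic term.\<close>

lemma prox_subgradient:
  fixes g :: "'a::euclidean_space \<Rightarrow> ereal"
  assumes g: "proper_fun g" "convex_fun g" "closed {(x, r::real). g x \<le> ereal r}" and "\<tau> > 0"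
    and p: "p = prox \<tau> g x"
  shows "p \<in> edom g"
    and "z \<in> edom g \<Longrightarrow> real_of_ereal (g p) + ((1 / \<tau>) *\<^sub>R (x - p)) \<bullet> (z - p) \<le> real_of_ereal (g z)"
proof -
  note min = prox_minimizes[OF g \<open>\<tau> > 0\<close>, of x, folded p]
  show pe: "p \<in> edom g"
  proof -
    obtain z0 where z0: "z0 \<in> edom g" using proper_fun_edom_nonempty g(1) by blast
    show ?thesis using min[of z0] z0 by (cases "g p") (auto simp: edom_def)
  qed
  define G where "G w = real_of_ereal (g w)" for w
  assume ze: "z \<in> edom g"
  have G: "g w = ereal (G w)" if "w \<in> edom g" for w
    using proper_fun_real[OF g(1) that] by (simp add: G_def)
  define v where "v = (1 / \<tau>) *\<^sub>R (x - p)"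
  have key: "G p + v \<bullet> (z - p) \<le> G z + s / (2 * \<tau>) * (norm (z - p))\<^sup>2" if s: "0 < s" "s \<le> 1" for s
  proof -
    define w where "w = (1 - s) *\<^sub>R p + s *\<^sub>R z"
    have w: "w \<in> edom g" "G w \<le> (1 - s) * G p + s * G z"
      using proper_convex_real[OF g(1,2) pe ze, of s] s by (auto simp: w_def G_def)
    have "G p + 1 / (2 * \<tau>) * (norm (p - x))\<^sup>2 \<le> G w + 1 / (2 * \<tau>) * (norm (w - x))\<^sup>2"
      using min[of w] G[OF pe] G[OF w(1)] by simp
    moreover have wx: "w - x = (p - x) + s *\<^sub>R (z - p)" by (simp add: w_def algebra_simps)
    have "(norm (w - x))\<^sup>2 = (norm (p - x))\<^sup>2 + 2 * s * ((p - x) \<bullet> (z - p)) + s\<^sup>2 * (norm (z - p))\<^sup>2"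
      unfolding wx power2_norm_eq_inner inner_add_left inner_add_right inner_scaleR_left inner_scaleR_right
      by (simp only: inner_commute[of "z - p" "p - x"] power2_eq_square) algebra
    moreover have "(p - x) \<bullet> (z - p) = - \<tau> * (v \<bullet> (z - p))"
      using \<open>\<tau> > 0\<close> by (simp add: v_def inner_diff_left)
    moreover have "1 / (2 * \<tau>) * (c + 2 * s * (- \<tau> * i) + s\<^sup>2 * n)
        = 1 / (2 * \<tau>) * c + s * (s / (2 * \<tau>) * n - i)" for c i n :: real
      using \<open>\<tau> > 0\<close> by (simp add: field_simps power2_eq_square)
    ultimately have "G p \<le> G w + s * (s / (2 * \<tau>) * (norm (z - p))\<^sup>2 - v \<bullet> (z - p))"
      by simp
    also have "\<dots> \<le> G p + s * (G z - G p) + s * (s / (2 * \<tau>) * (norm (z - p))\<^sup>2 - v \<bullet> (z - p))"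
      using w(2) by (simp add: algebra_simps)
    finally have "0 \<le> s * ((G z - G p) + (s / (2 * \<tau>) * (norm (z - p))\<^sup>2 - v \<bullet> (z - p)))"
      by (simp only: distrib_left)
    then show ?thesis using s by (simp add: zero_le_mult_iff)
  qed
  have "((\<lambda>s. G z + s / (2 * \<tau>) * (norm (z - p))\<^sup>2) \<longlongrightarrow> G z + 0 / (2 * \<tau>) * (norm (z - p))\<^sup>2) (at_right 0)"
    by (intro tendsto_intros) (use \<open>\<tau> > 0\<close> in auto)
  moreover have "\<forall>\<^sub>F s in at_right 0. G p + v \<bullet> (z - p) \<le> G z + s / (2 * \<tau>) * (norm (z - p))\<^sup>2"
    unfolding eventually_at_right_field by (rule exI[of _ 1]) (use key in auto)
  ultimately have "G p + v \<bullet> (z - p) \<le> G z + 0 / (2 * \<tau>) * (norm (z - p))\<^sup>2"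
    by (intro tendsto_lowerbound) auto
  then show "real_of_ereal (g p) + ((1 / \<tau>) *\<^sub>R (x - p)) \<bullet> (z - p) \<le> real_of_ereal (g z)"
    by (simp add: G_def v_def)
qed

section \<open>Gradients of convex functions\<close>

text \<open>\<open>gradient\<close> is a definite description, so a representing vector must be
  shown to exist and to be unique. It is assembled from the partial derivatives; uniqueness follows
  by testing with the difference of two candidates.\<close>

lemma GDERIV_gradient:
  fixes f :: "'a::euclidean_space \<Rightarrow> real"
  assumes "f differentiable (at x)"
  shows "GDERIV f x :> gradient f x"
proof -
  obtain f' where f': "(f has_derivative f') (at x)"
    using assms unfolding differentiable_def by blast
  define D where "D = (\<Sum>b\<in>Basis. f' b *\<^sub>R b)"
  interpret bounded_linear f' using f' by (rule has_derivative_bounded_linear)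
  have "f' v = v \<bullet> D" for v
  proof -
    have "f' v = f' (\<Sum>b\<in>Basis. (v \<bullet> b) *\<^sub>R b)" by (simp add: euclidean_representation)
    also have "\<dots> = (\<Sum>b\<in>Basis. (v \<bullet> b) * f' b)" by (simp add: sum scaleR)
    finally show ?thesis by (simp add: D_def inner_sum_right mult.commute)
  qed
  then have "f' = (\<lambda>v. v \<bullet> D)" by (rule ext)
  then have D: "GDERIV f x :> D" using f' unfolding gderiv_def by simp
  moreover have "D' = D" if "GDERIV f x :> D'" for D'
  proof -
    have "(\<lambda>h. h \<bullet> D') = (\<lambda>h. h \<bullet> D)"
      using that D has_derivative_unique unfolding gderiv_def by blast
    then have "(D' - D) \<bullet> D' = (D' - D) \<bullet> D" by metis
    then have "(D' - D) \<bullet> (D' - D) = 0" by (simp add: inner_diff_right)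
    then show ?thesis by simp
  qed
  ultimately show ?thesis unfolding gradient_def by (rule theI)
qed

lemma has_real_derivative_along_line:
  fixes f :: "'a::euclidean_space \<Rightarrow> real"
  assumes "\<And>x. f differentiable (at x)"
  shows "((\<lambda>s. f (x + s *\<^sub>R d)) has_real_derivative gradient f (x + s *\<^sub>R d) \<bullet> d) (at s within S)"
proof -
  have "((\<lambda>s. x + s *\<^sub>R d) has_derivative (\<lambda>h. h *\<^sub>R d)) (at s within S)"
    by (auto intro!: derivative_eq_intros)
  moreover have "(f has_derivative (\<lambda>h. h \<bullet> gradient f (x + s *\<^sub>R d)))
      (at (x + s *\<^sub>R d) within (\<lambda>s. x + s *\<^sub>R d) ` S)"
    using GDERIV_gradient[OF assms] unfolding gderiv_def by (rule has_derivative_at_withinI)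
  ultimately have "((\<lambda>s. f (x + s *\<^sub>R d)) has_derivative
      (\<lambda>h. h *\<^sub>R d \<bullet> gradient f (x + s *\<^sub>R d))) (at s within S)"
    by (rule has_derivative_in_compose)
  then show ?thesis by (simp add: has_field_derivative_def inner_commute mult_commute_abs)
qed

lemma convex_gradient_inequality:
  fixes f :: "'a::euclidean_space \<Rightarrow> real"
  assumes "convex_on UNIV f" "\<And>x. f differentiable (at x)"
  shows "f x + gradient f x \<bullet> (z - x) \<le> f z"
proof -
  let ?p = "\<lambda>s. f (x + s *\<^sub>R (z - x))"
  have "convex_on UNIV ?p"
  proof (rule convex_onI)
    fix r a b :: real
    assume r: "0 < r" "r < 1"
    have "x + ((1 - r) *\<^sub>R a + r *\<^sub>R b) *\<^sub>R (z - x)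
        = (1 - r) *\<^sub>R (x + a *\<^sub>R (z - x)) + r *\<^sub>R (x + b *\<^sub>R (z - x))"
      by (simp add: algebra_simps)
    then show "?p ((1 - r) *\<^sub>R a + r *\<^sub>R b) \<le> (1 - r) * ?p a + r * ?p b"
      using convex_onD[OF assms(1), of r "x + a *\<^sub>R (z - x)" "x + b *\<^sub>R (z - x)"] r by simp
  qed simp
  from convex_on_imp_above_tangent[OF this, of 0 1 "gradient f x \<bullet> (z - x)"]
    has_real_derivative_along_line[OF assms(2), of x "z - x" 0 UNIV]
  show ?thesis by simp
qed

text \<open>Instead of integrating along the segment, an auxiliary function of \<open>s\<close>
  collects both sides of the estimate; the Lipschitz bound makes its derivative nonpositive.\<close>

lemma descent_inequality:
  fixes f :: "'a::euclidean_space \<Rightarrow> real"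
  assumes "\<And>x. f differentiable (at x)" "convex W" "L-lipschitz_on W (gradient f)" "x \<in> W" "z \<in> W"
  shows "f z \<le> f x + gradient f x \<bullet> (z - x) + L / 2 * (norm (z - x))\<^sup>2"
proof -
  define d where "d = z - x"
  let ?p = "\<lambda>s. f (x + s *\<^sub>R d) - s * (gradient f x \<bullet> d) - L / 2 * s\<^sup>2 * (norm d)\<^sup>2"
  have "?p 1 \<le> ?p 0"
  proof (rule DERIV_nonpos_imp_nonincreasing[of 0 1 ?p])
    fix s :: real
    assume s: "0 \<le> s" "s \<le> 1"
    have "x + s *\<^sub>R d = (1 - s) *\<^sub>R x + s *\<^sub>R z" by (simp add: d_def algebra_simps)
    then have "x + s *\<^sub>R d \<in> W" using assms(2,4,5) s by (simp add: convex_alt)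
    then have "norm (gradient f (x + s *\<^sub>R d) - gradient f x) \<le> L * norm (s *\<^sub>R d)"
      using lipschitz_onD[OF assms(3) _ assms(4), of "x + s *\<^sub>R d"] by (simp add: dist_norm)
    then have "norm (gradient f (x + s *\<^sub>R d) - gradient f x) * norm d \<le> (L * norm (s *\<^sub>R d)) * norm d"
      by (rule mult_right_mono) simp
    moreover have "(gradient f (x + s *\<^sub>R d) - gradient f x) \<bullet> d
        \<le> norm (gradient f (x + s *\<^sub>R d) - gradient f x) * norm d" by (rule norm_cauchy_schwarz)
    ultimately have "gradient f (x + s *\<^sub>R d) \<bullet> d - gradient f x \<bullet> d - L * s * (norm d)\<^sup>2 \<le> 0"
      using s by (simp add: inner_diff_left power2_eq_square)
    moreover have "(?p has_real_derivative
        gradient f (x + s *\<^sub>R d) \<bullet> d - gradient f x \<bullet> d - L * s * (norm d)\<^sup>2) (at s)"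
      by (auto intro!: derivative_eq_intros has_real_derivative_along_line[OF assms(1)])
    ultimately show "\<exists>y. (?p has_real_derivative y) (at s) \<and> y \<le> 0" by blast
  qed simp
  then show ?thesis by (simp add: d_def)
qed

text \<open>
  The gradient step from \<open>z\<close> used in the proof may leave \<open>V\<close>, but has length at most
  \<open>diameter V\<close>; this is why the modulus is needed on the enlarged set.
\<close>

lemma gradient_cocoercive:
  fixes f :: "'a::euclidean_space \<Rightarrow> real"
  assumes "convex_on UNIV f" "\<And>x. f differentiable (at x)"
    and "bounded V" "convex V" "L > 0"
    and lip: "L-lipschitz_on (V + {z. norm z \<le> diameter V}) (gradient f)"
    and "x \<in> V" "z \<in> V"
  shows "(norm (gradient f x - gradient f z))\<^sup>2 \<le> L * ((gradient f x - gradient f z) \<bullet> (x - z))"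
proof -
  let ?W = "V + {z. norm z \<le> diameter V}"
  have ball: "{z::'a. norm z \<le> diameter V} = cball 0 (diameter V)" by auto
  have W: "convex ?W" unfolding ball by (intro convex_set_plus assms convex_cball)
  have VW: "v \<in> ?W" if "v \<in> V" for v
    using set_plus_intro[OF that, of 0 "{z. norm z \<le> diameter V}"] diameter_ge_0[OF \<open>bounded V\<close>] by simp
  have half: "1 / (2 * L) * (norm (gradient f b - gradient f a))\<^sup>2 \<le> f b - f a - gradient f a \<bullet> (b - a)"
    if ab: "a \<in> V" "b \<in> V" for a b
  proof -
    define q where "q = gradient f b - gradient f a"
    \<comment> \<open>\<open>w\<close> minimizes the quadratic upper model at \<open>b\<close> of
      \<open>f\<close> minus its tangent at \<open>a\<close>. Comparing the model value there with
      the tangent bound at \<open>a\<close> leaves the squared gradient difference.\<close>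
    define w where "w = b - (1 / L) *\<^sub>R q"
    have "norm q \<le> L * norm (b - a)"
      using lipschitz_onD[OF lip VW VW, of b a] ab by (simp add: q_def dist_norm)
    then have "norm (- (1 / L) *\<^sub>R q) \<le> norm (b - a)"
      using \<open>L > 0\<close> by (simp add: field_simps)
    also have "\<dots> \<le> diameter V"
      using diameter_bounded_bound[OF \<open>bounded V\<close> ab(2,1)] by (simp add: dist_norm)
    finally have "b + (- (1 / L) *\<^sub>R q) \<in> ?W" using ab by (intro set_plus_intro) auto
    then have "w \<in> ?W" by (simp add: w_def)
    from descent_inequality[OF assms(2) W lip VW[OF ab(2)] this]
    have "f w \<le> f b + gradient f b \<bullet> (w - b) + L / 2 * (norm (w - b))\<^sup>2" .
    moreover have "f a + gradient f a \<bullet> (w - a) \<le> f w"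
      by (rule convex_gradient_inequality[OF assms(1,2)])
    moreover have "w - a = (b - a) + (w - b)" by simp
    then have "gradient f a \<bullet> (w - a) = gradient f a \<bullet> (b - a) + gradient f a \<bullet> (w - b)"
      by (simp only: inner_add_right)
    moreover have "gradient f b \<bullet> (w - b) - gradient f a \<bullet> (w - b) = - (1 / L) * (norm q)\<^sup>2"
      by (simp add: w_def q_def power2_norm_eq_inner inner_diff_left inner_diff_right inner_commute algebra_simps)
    moreover have "L / 2 * (norm (w - b))\<^sup>2 = 1 / (2 * L) * (norm q)\<^sup>2"
      using \<open>L > 0\<close> by (simp add: w_def power2_eq_square)
    ultimately have "1 / (2 * L) * (norm q)\<^sup>2 \<le> f b - f a - gradient f a \<bullet> (b - a)"
      by (simp add: field_simps)
    then show ?thesis by (simp add: q_def)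
  qed
  \<comment> \<open>Adding the estimate for both orders of the points cancels the function
    values.\<close>
  have "1 / (2 * L) * (norm (gradient f x - gradient f z))\<^sup>2 + 1 / (2 * L) * (norm (gradient f x - gradient f z))\<^sup>2
     \<le> - (gradient f x \<bullet> (z - x)) - gradient f z \<bullet> (x - z)"
    using half[of x z] half[of z x] assms(7,8) by (simp add: norm_minus_commute)
  also have "\<dots> = (gradient f x - gradient f z) \<bullet> (x - z)"
    by (simp add: inner_diff_left inner_diff_right)
  finally show ?thesis using \<open>L > 0\<close> by (simp add: field_simps)
qed

section \<open>The stepsize rule\<close>

text \<open>The multiplied-out inequality also covers \<open>d = 0\<close>, where the quotient is
  infinity.\<close>

lemma ereal_le_one_divide:
  assumes "0 \<le> d" "0 < c"
  shows "ereal c \<le> 1 / ereal d \<longleftrightarrow> d * c \<le> 1"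
proof (cases "d = 0")
  case True
  then show ?thesis by (simp add: one_ereal_def)
next
  case False
  then have "1 / ereal d = ereal (1 / d)" by (simp add: one_ereal_def)
  then show ?thesis using False assms by (simp add: field_simps)
qed

text \<open>Clearing denominators describes the minimum by real inequalities, uniformly in the
  degenerate cases: the second entry is infinite if \<open>\<nu> * t * e = 0\<close>, the third if
  \<open>D = 0\<close>, that is, if \<open>t * e = 0\<close> and \<open>delta\<close> is
  nonpositive. What is proved later about the stepsizes comes from this characterization and from
  positivity.\<close>

lemma stepsize_ge_iff:
  assumes "0 < \<gamma> k" "0 \<le> \<nu>" "0 \<le> t" "0 \<le> e" "0 \<le> \<epsilon>" "0 < c"
    and \<kappa>: "\<kappa> = 1 - 4 * xi t \<gamma> \<eta> k * (1 + \<epsilon>)\<^sup>2" "0 < \<kappa>"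
    and D: "D = sqrt ((delta f x \<gamma> k)\<^sup>2 + (t * e * \<gamma> k)\<^sup>2 * \<kappa>) + delta f x \<gamma> k"
  shows "c \<le> stepsize f t \<epsilon> \<nu> x \<gamma> \<eta> k e \<longleftrightarrow>
           c \<le> \<gamma> k * sqrt (1 + \<gamma> k / \<gamma> (k - 1)) \<and> 2 * \<nu> * t * e * c \<le> 1 \<and>
           c\<^sup>2 * (2 * (1 + \<epsilon>) * D) \<le> (\<gamma> k)\<^sup>2 * \<kappa>"
proof -
  let ?B = "1 / ereal (2 * \<nu> * t * e)"
  let ?C = "ereal (\<gamma> k) * ereal_sqrt (ereal \<kappa> / ereal (2 * (1 + \<epsilon>) * D))"
  have "\<bar>delta f x \<gamma> k\<bar> \<le> sqrt ((delta f x \<gamma> k)\<^sup>2 + (t * e * \<gamma> k)\<^sup>2 * \<kappa>)"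
    using \<kappa>(2) by (intro real_le_rsqrt) simp
  then have "0 \<le> D" unfolding D by linarith
  have s: "stepsize f t \<epsilon> \<nu> x \<gamma> \<eta> k e
      = real_of_ereal (min (ereal (\<gamma> k * sqrt (1 + \<gamma> k / \<gamma> (k - 1)))) (min ?B ?C))"
    unfolding stepsize_def \<kappa>(1) D ..
  have C: "(ereal c \<le> ?C \<longleftrightarrow> c\<^sup>2 * (2 * (1 + \<epsilon>) * D) \<le> (\<gamma> k)\<^sup>2 * \<kappa>) \<and> ?C \<noteq> -\<infinity>"
  proof (cases "D = 0")
    case True
    then have "?C = \<infinity>" using \<kappa>(2) assms(1) by (simp add: ereal_sqrt_def)
    then show ?thesis using True \<kappa>(2) by auto
  next
    case False
    define E where "E = 2 * (1 + \<epsilon>) * D"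
    have "0 < E" using False \<open>0 \<le> D\<close> \<open>0 \<le> \<epsilon>\<close> by (simp add: E_def)
    have Ce: "?C = ereal (\<gamma> k * sqrt (\<kappa> / E))"
      unfolding E_def[symmetric] using \<open>0 < E\<close> by (simp add: ereal_sqrt_def)
    have "c \<le> \<gamma> k * sqrt (\<kappa> / E) \<longleftrightarrow> c\<^sup>2 \<le> (\<gamma> k * sqrt (\<kappa> / E))\<^sup>2"
      using assms(1,6) \<kappa>(2) \<open>0 < E\<close> by (intro power2_le_iff_abs_le[symmetric, THEN trans[rotated]]) auto
    also have "\<dots> \<longleftrightarrow> c\<^sup>2 * E \<le> (\<gamma> k)\<^sup>2 * \<kappa>"
      using \<kappa>(2) \<open>0 < E\<close> by (simp add: power_mult_distrib field_simps)
    finally show ?thesis unfolding Ce by (simp add: E_def)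
  qed
  have B: "ereal c \<le> ?B \<longleftrightarrow> 2 * \<nu> * t * e * c \<le> 1" using assms by (intro ereal_le_one_divide) auto
  have B': "?B \<noteq> -\<infinity>"
    by (cases "2 * \<nu> * t * e = 0") (auto simp: one_ereal_def)
  have "c \<le> real_of_ereal (min (ereal a) X) \<longleftrightarrow> c \<le> a \<and> ereal c \<le> X" if "X \<noteq> -\<infinity>" for a X
    using that by (cases X) (auto simp: min_def)
  then show ?thesis unfolding s using B C B' by (auto simp: min_def)
qed

lemma stepsize_pos:
  assumes "0 < \<gamma> k" "0 < \<gamma> (k - 1)" "0 \<le> \<nu>" "0 \<le> t" "0 \<le> e" "0 \<le> \<epsilon>"
    and "0 < 1 - 4 * xi t \<gamma> \<eta> k * (1 + \<epsilon>)\<^sup>2"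
  shows "0 < stepsize f t \<epsilon> \<nu> x \<gamma> \<eta> k e"
proof -
  define \<kappa> where "\<kappa> = 1 - 4 * xi t \<gamma> \<eta> k * (1 + \<epsilon>)\<^sup>2"
  define D where "D = sqrt ((delta f x \<gamma> k)\<^sup>2 + (t * e * \<gamma> k)\<^sup>2 * \<kappa>) + delta f x \<gamma> k"
  \<comment> \<open>Adding 1 keeps \<open>E\<close> and \<open>M\<close> positive when the true
    denominators vanish, so that \<open>c\<close> is an explicit positive number below all three
    entries.\<close>
  define E where "E = \<bar>2 * (1 + \<epsilon>) * D\<bar> + 1"
  define M where "M = 2 * \<nu> * t * e + 1"
  define c where "c = min (\<gamma> k * sqrt (1 + \<gamma> k / \<gamma> (k - 1))) (min (1 / M) (\<gamma> k * sqrt (\<kappa> / E)))"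
  have pos: "0 < \<kappa>" "0 < E" "0 < M" using assms by (auto simp: \<kappa>_def E_def M_def intro: add_nonneg_pos)
  have "0 < 1 + \<gamma> k / \<gamma> (k - 1)" using assms(1,2) by (simp add: add_pos_pos)
  then have "0 < c" using pos assms by (simp add: c_def)
  moreover have "c \<le> stepsize f t \<epsilon> \<nu> x \<gamma> \<eta> k e"
  proof (subst stepsize_ge_iff[where \<kappa> = \<kappa> and D = D])
    have "c \<le> 1 / M" "c \<le> \<gamma> k * sqrt (\<kappa> / E)" by (simp_all add: c_def)
    have "2 * \<nu> * t * e * c \<le> M * c" using \<open>0 < c\<close> by (simp add: M_def)
    also have "\<dots> \<le> 1" using \<open>c \<le> 1 / M\<close> pos by (simp add: field_simps)
    finally have 1: "2 * \<nu> * t * e * c \<le> 1" .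
    have "c\<^sup>2 * (2 * (1 + \<epsilon>) * D) \<le> c\<^sup>2 * E" by (rule mult_left_mono) (auto simp: E_def)
    also have "\<dots> \<le> (\<gamma> k * sqrt (\<kappa> / E))\<^sup>2 * E"
      using \<open>c \<le> \<gamma> k * sqrt (\<kappa> / E)\<close> \<open>0 < c\<close> pos by (intro mult_right_mono power_mono) auto
    also have "\<dots> = (\<gamma> k)\<^sup>2 * \<kappa>" using pos by (simp add: power_mult_distrib)
    finally show "c \<le> \<gamma> k * sqrt (1 + \<gamma> k / \<gamma> (k - 1)) \<and> 2 * \<nu> * t * e * c \<le> 1 \<and>
           c\<^sup>2 * (2 * (1 + \<epsilon>) * D) \<le> (\<gamma> k)\<^sup>2 * \<kappa>"
      using 1 by (simp add: c_def)
  qed (use assms \<open>0 < c\<close> pos in \<open>auto simp: \<kappa>_def D_def\<close>)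
  ultimately show ?thesis by simp
qed

section \<open>The descent inequality\<close>

lemma differentiable_loc_lipschitz_gradient:
  "loc_lipschitz_gradient f \<Longrightarrow> f differentiable (at x)"
  by (simp add: loc_lipschitz_gradient_def)

lemma isCont_gradient:
  fixes f :: "'a::euclidean_space \<Rightarrow> real"
  assumes "loc_lipschitz_gradient f"
  shows "isCont (gradient f) z"
proof -
  have "convex (cball z 1) \<and> compact (cball z 1)" by simp
  then obtain L where "L-lipschitz_on (cball z 1) (gradient f)"
    using assms unfolding loc_lipschitz_gradient_def by blast
  then have "continuous_on (cball z 1) (gradient f)" by (rule lipschitz_on_continuous_on)
  then show ?thesis by (rule continuous_on_interior) (simp add: interior_cball)
qed

lemma compact_set_plus:
  fixes S T :: "'a::real_normed_vector set"
  assumes "compact S" "compact T"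
  shows "compact (S + T)"
proof -
  have "S + T = {x + y | x y. x \<in> S \<and> y \<in> T}" by (auto simp: set_plus_def)
  with compact_sums[OF assms] show ?thesis by simp
qed

text \<open>
  \<open>G\<close> and \<open>H\<close> are the finite parts of \<open>g\<close> and of the conjugate of \<open>h\<close>, with effective domains
  \<open>D\<close> and \<open>E\<close>.  The assumption \<open>gamma_ge_iff\<close> expresses \<open>\<gamma> (k + 1)\<close> as the minimum of three
  extended-real quantities without mentioning them.
\<close>

locale adaptive_primal_dual =
  fixes f :: "'a::euclidean_space \<Rightarrow> real" and D G and E H
    and A :: "'a \<Rightarrow> 'b::euclidean_space"
    and t \<epsilon> \<nu> \<eta>m :: real
    and x :: "int \<Rightarrow> 'a" and y :: "int \<Rightarrow> 'b" and \<gamma> \<eta> :: "int \<Rightarrow> real"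
  assumes f_convex: "convex_on UNIV f" and f_lip: "loc_lipschitz_gradient f"
    and G_closed: "closed {(z, r::real). z \<in> D \<and> G z \<le> r}"
    and H_closed: "closed {(z, r::real). z \<in> E \<and> H z \<le> r}"
    and H_convex: "convex_on E H"
    and A_linear: "linear A"
    and t_pos: "t > 0" and eps_pos: "\<epsilon> > 0" and nu_gt: "\<nu> > 1 + \<epsilon>"
    and x_in: "k \<ge> 0 \<Longrightarrow> x k \<in> D"
    and G_sub: "\<lbrakk>k \<ge> 0; z \<in> D\<rbrakk> \<Longrightarrow> G (x k) + ((1 / \<gamma> k) *\<^sub>R (x (k - 1) - x k)
        - gradient f (x (k - 1)) - adjoint A (y k)) \<bullet> (z - x k) \<le> G z"
    and y_in: "k \<ge> 0 \<Longrightarrow> y (k + 1) \<in> E"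
    and H_sub: "\<lbrakk>k \<ge> 0; v \<in> E\<rbrakk> \<Longrightarrow> H (y (k + 1)) + ((1 / (t\<^sup>2 * \<gamma> (k + 1))) *\<^sub>R (y k - y (k + 1))
        + A (x k) + (\<gamma> (k + 1) / \<gamma> k) *\<^sub>R A (x k - x (k - 1))) \<bullet> (v - y (k + 1)) \<le> H v"
    and gamma_pos: "k \<ge> -1 \<Longrightarrow> 0 < \<gamma> k"
    and eta_nonneg: "k \<ge> 0 \<Longrightarrow> 0 \<le> \<eta> k" and eta_le: "k \<ge> 0 \<Longrightarrow> \<eta> k \<le> \<eta>m"
    and eta_gamma: "k \<ge> 0 \<Longrightarrow> 2 * \<nu> * t * \<eta> k * \<gamma> k \<le> 1"
    and gamma_ge_iff: "\<lbrakk>k \<ge> 0; 0 < c\<rbrakk> \<Longrightarrow> c \<le> \<gamma> (k + 1) \<longleftrightarrow>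
        c \<le> \<gamma> k * sqrt (1 + \<gamma> k / \<gamma> (k - 1)) \<and> 2 * \<nu> * t * \<eta> (k + 1) * c \<le> 1 \<and>
        c\<^sup>2 * (2 * (1 + \<epsilon>) * (sqrt ((delta f x \<gamma> k)\<^sup>2
          + (t * \<eta> (k + 1) * \<gamma> k)\<^sup>2 * (1 - 4 * xi t \<gamma> \<eta> k * (1 + \<epsilon>)\<^sup>2)) + delta f x \<gamma> k))
        \<le> (\<gamma> k)\<^sup>2 * (1 - 4 * xi t \<gamma> \<eta> k * (1 + \<epsilon>)\<^sup>2)"
    and backtrack: "k \<ge> 0 \<Longrightarrow>
        norm (adjoint A (y (k + 1) - y k)) \<le> \<eta> (k + 1) * norm (y (k + 1) - y k)"
begin

section \<open>Real-valued gaps, Lyapunov function and saddle points\<close>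

abbreviation rho :: "int \<Rightarrow> real" where "rho k \<equiv> \<gamma> k / \<gamma> (k - 1)"
abbreviation kappa :: "int \<Rightarrow> real" where "kappa k \<equiv> 1 - 4 * xi t \<gamma> \<eta> k * (1 + \<epsilon>)\<^sup>2"

text \<open>This agrees with the extended-real gap from index 0 on, as \<open>x (-1)\<close> is an
  arbitrary point and may lie outside \<open>D\<close>. Likewise \<open>y 0\<close> may lie outside
  \<open>E\<close>, so \<open>Q\<close> is meaningful from index 1 on. For this reason the descent
  starts at \<open>k = 1\<close>.\<close>

definition P :: "'a \<Rightarrow> 'b \<Rightarrow> int \<Rightarrow> real" where
  "P xs ys k = f (x k) + G (x k) - (f xs + G xs) + (x k - xs) \<bullet> adjoint A ys"

definition Q :: "'a \<Rightarrow> 'b \<Rightarrow> int \<Rightarrow> real" where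
  "Q xs ys k = H (y k) - H ys + A xs \<bullet> (ys - y k)"

definition U :: "'a \<Rightarrow> 'b \<Rightarrow> int \<Rightarrow> real" where
  "U xs ys k = 1 / 2 * (norm (x k - xs))\<^sup>2
     + (1 - 4 * xi t \<gamma> \<eta> k * (1 + \<epsilon>)) / 4 * (norm (x k - x (k - 1)))\<^sup>2
     + 1 / (2 * t\<^sup>2) * (norm (y k - ys))\<^sup>2 + \<gamma> k * (1 + rho k) * P xs ys (k - 1)"

text \<open>The variational form of a primal-dual solution: \<open>xs\<close> minimizes f + g plus a
  linear term given by \<open>ys\<close>, and \<open>ys\<close> minimizes the conjugate minus a
  linear term given by \<open>xs\<close>. It speaks of values only, which suits exchanging
  components between two solutions and forming convex combinations.\<close>

definition saddle :: "'a \<Rightarrow> 'b \<Rightarrow> bool" where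
  "saddle xs ys \<longleftrightarrow> xs \<in> D \<and> ys \<in> E \<and>
     (\<forall>z\<in>D. f xs + G xs \<le> f z + G z + (z - xs) \<bullet> adjoint A ys) \<and>
     (\<forall>z\<in>E. H ys \<le> H z + A xs \<bullet> (ys - z))"

lemma gradient_ineq: "f u + gradient f u \<bullet> (z - u) \<le> f z"
  by (intro convex_gradient_inequality f_convex differentiable_loc_lipschitz_gradient[OF f_lip])

lemma adjoint_inner: "adjoint A v \<bullet> u = A u \<bullet> v"
  using adjoint_works[OF A_linear, of u v] by (simp add: inner_commute)

lemma inner_adjoint: "u \<bullet> adjoint A v = A u \<bullet> v"
  using adjoint_works[OF A_linear, of u v] .

lemmas A_diff = linear_diff[OF A_linear]
lemmas adjoint_diff = linear_diff[OF adjoint_linear[OF A_linear]]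

section \<open>Local curvature estimates and bounds from the stepsize rule\<close>

lemma gradient_cocoercive_local:
  assumes "u \<in> cball 0 R" "z \<in> cball 0 R"
  obtains L where "L > 0" "(norm (gradient f u - gradient f z))\<^sup>2
    \<le> L * ((gradient f u - gradient f z) \<bullet> (u - z))"
proof -
  let ?V = "cball 0 R :: 'a set"
  have ball: "{z::'a. norm z \<le> diameter ?V} = cball 0 (diameter ?V)" by auto
  have "convex (?V + {z. norm z \<le> diameter ?V}) \<and> compact (?V + {z. norm z \<le> diameter ?V})"
    unfolding ball by (intro conjI convex_set_plus compact_set_plus) auto
  then obtain L where "L > 0" "L-lipschitz_on (?V + {z. norm z \<le> diameter ?V}) (gradient f)"
    using f_lip unfolding loc_lipschitz_gradient_def by blast
  then show thesis
    using gradient_cocoercive[OF f_convex differentiable_loc_lipschitz_gradient[OF f_lip], of ?V L u z] assms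
    by (intro that) auto
qed

text \<open>Clears the quotients in \<open>delta\<close>. The delicate case is a vanishing
  denominator of \<open>cc\<close>: cocoercivity then forces the two gradients to coincide, and both
  sides are 0.\<close>

lemma delta_norm:
  "delta f x \<gamma> k * (norm (x (k - 1) - x k))\<^sup>2
     = (\<gamma> k)\<^sup>2 * (norm (gradient f (x (k - 1)) - gradient f (x k)))\<^sup>2
       - \<gamma> k * ((gradient f (x (k - 1)) - gradient f (x k)) \<bullet> (x (k - 1) - x k))"
proof -
  define d where "d = gradient f (x (k - 1)) - gradient f (x k)"
  define w where "w = x (k - 1) - x k"
  define R where "R = max (norm (x (k - 1))) (norm (x k))"
  obtain L where L: "L > 0" "(norm d)\<^sup>2 \<le> L * (d \<bullet> w)"
    using gradient_cocoercive_local[of "x (k - 1)" R "x k"] unfolding d_def w_def R_def by auto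
  have e: "delta f x \<gamma> k = \<gamma> k * ((d \<bullet> w) / (norm w)\<^sup>2) * (\<gamma> k * ((norm d)\<^sup>2 / (d \<bullet> w)) - 1)"
    by (simp add: delta_def ell_def cc_def d_def w_def)
  show ?thesis
  proof (cases "d \<bullet> w = 0")
    case True
    then have "d = 0" using L by simp
    with True show ?thesis unfolding e d_def[symmetric] w_def[symmetric] by simp
  next
    case False
    then have "w \<noteq> 0" by auto
    with False show ?thesis unfolding e d_def[symmetric] w_def[symmetric]
      by (simp add: field_simps power2_eq_square)
  qed
qed

lemma xi_bound: "k \<ge> 0 \<Longrightarrow> 4 * xi t \<gamma> \<eta> k \<le> 1 / \<nu>\<^sup>2" and xi_nonneg: "0 \<le> xi t \<gamma> \<eta> k"
proof -
  show "0 \<le> xi t \<gamma> \<eta> k" by (simp add: xi_def)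
  assume k: "k \<ge> 0"
  have nu: "\<nu> > 0" using nu_gt eps_pos by simp
  have "(2 * \<nu> * t * \<eta> k * \<gamma> k)\<^sup>2 \<le> 1\<^sup>2"
    using eta_gamma[OF k] eta_nonneg[OF k] gamma_pos[of k] k nu t_pos by (intro power_mono) auto
  then show "4 * xi t \<gamma> \<eta> k \<le> 1 / \<nu>\<^sup>2"
    using nu by (simp add: xi_def field_simps power_mult_distrib)
qed

text \<open>The origin of the constant nu-bar: the cap on the stepsize bounds
  \<open>4 * xi t \<gamma> \<eta> k\<close> by \<open>1 / \<nu>\<^sup>2\<close>, and
  \<open>\<nu> > 1 + \<epsilon>\<close> makes what is left of 1 positive.\<close>

lemma kappa_ge:
  assumes "k \<ge> 0"
  shows "(\<nu>\<^sup>2 - (1 + \<epsilon>)\<^sup>2) / \<nu>\<^sup>2 \<le> kappa k"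
proof -
  have nu: "\<nu> > 0" using nu_gt eps_pos by simp
  have "4 * xi t \<gamma> \<eta> k * (1 + \<epsilon>)\<^sup>2 \<le> 1 / \<nu>\<^sup>2 * (1 + \<epsilon>)\<^sup>2"
    by (intro mult_right_mono xi_bound assms) simp
  then show ?thesis using nu by (simp add: field_simps)
qed

lemma nu_bar_pos: "0 < (\<nu>\<^sup>2 - (1 + \<epsilon>)\<^sup>2) / \<nu>\<^sup>2"
  using nu_gt eps_pos by (simp add: power_strict_mono)

lemma kappa_pos: "k \<ge> 0 \<Longrightarrow> 0 < kappa k"
  using kappa_ge nu_bar_pos by (rule less_le_trans[rotated])

lemma U_coeff_bounds:
  assumes "k \<ge> 0"
  shows "0 \<le> 1 - 4 * xi t \<gamma> \<eta> k * (1 + \<epsilon>)" "1 - 4 * xi t \<gamma> \<eta> k * (1 + \<epsilon>) \<le> 1"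
proof -
  have "xi t \<gamma> \<eta> k * (1 + \<epsilon>) \<le> xi t \<gamma> \<eta> k * (1 + \<epsilon>)\<^sup>2"
    using eps_pos xi_nonneg by (intro mult_left_mono) (auto simp: power2_eq_square)
  then show "0 \<le> 1 - 4 * xi t \<gamma> \<eta> k * (1 + \<epsilon>)" using kappa_pos[OF assms] by simp
  show "1 - 4 * xi t \<gamma> \<eta> k * (1 + \<epsilon>) \<le> 1" using xi_nonneg eps_pos by simp
qed

lemma gamma_growth: "k \<ge> 0 \<Longrightarrow> \<gamma> (k + 1) \<le> \<gamma> k * sqrt (1 + rho k)"
  using gamma_ge_iff[of k "\<gamma> (k + 1)"] gamma_pos[of "k + 1"] by simp

lemma rho_pos: "k \<ge> 0 \<Longrightarrow> 0 < rho k"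
  using gamma_pos[of k] gamma_pos[of "k - 1"] by simp

lemma rho_growth:
  assumes "k \<ge> 0"
  shows "(rho (k + 1))\<^sup>2 \<le> 1 + rho k"
proof -
  have "rho (k + 1) \<le> sqrt (1 + rho k)"
    using gamma_growth[OF assms] gamma_pos[of k] assms by (simp add: field_simps)
  then have "(rho (k + 1))\<^sup>2 \<le> (sqrt (1 + rho k))\<^sup>2"
    using rho_pos[of "k + 1"] assms by (intro power_mono) auto
  also have "\<dots> = 1 + rho k" using rho_pos[OF assms] by simp
  finally show ?thesis .
qed

text \<open>For positive \<open>a\<close> the positive root \<open>(R - d) / a\<close> of
  \<open>a * q\<^sup>2 + 2 * d * q = \<kappa>\<close> equals \<open>\<kappa> / (R + d)\<close>; the
  third entry of the stepsize bounds \<open>q\<close> in this second form.\<close>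

lemma decrease_coeff_ge:
  assumes "k \<ge> 0"
  shows "\<epsilon> / (4 * (1 + \<epsilon>)) \<le> decrease_coeff f t \<epsilon> x \<gamma> \<eta> k"
proof -
  define \<kappa> where "\<kappa> = kappa k"
  define d where "d = delta f x \<gamma> k"
  define a where "a = (t * \<eta> (k + 1) * \<gamma> k)\<^sup>2"
  define R where "R = sqrt (d\<^sup>2 + a * \<kappa>)"
  define s where "s = (rho (k + 1))\<^sup>2"
  define q where "q = 2 * (1 + \<epsilon>) * s"
  have pos: "0 < \<gamma> k" "0 < \<gamma> (k + 1)" "0 < \<kappa>" "0 < 1 + \<epsilon>"
    using gamma_pos assms kappa_pos eps_pos by (auto simp: \<kappa>_def)
  have "0 \<le> q" using pos by (simp add: q_def s_def)
  have R2: "R\<^sup>2 = d\<^sup>2 + a * \<kappa>" using pos by (simp add: R_def a_def)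
  have dR: "\<bar>d\<bar> \<le> R" unfolding R_def using pos by (intro real_le_rsqrt) (simp add: a_def)
  have "(\<gamma> (k + 1))\<^sup>2 * (2 * (1 + \<epsilon>) * (R + d)) \<le> (\<gamma> k)\<^sup>2 * \<kappa>"
    using gamma_ge_iff[OF assms pos(2)] by (simp add: R_def d_def a_def \<kappa>_def)
  then have qR: "q * (R + d) \<le> \<kappa>"
    using pos by (simp add: q_def s_def field_simps)
  \<comment> \<open>Multiplying by \<open>\<kappa>\<close> and using
    \<open>a * \<kappa> = (R - d) * (R + d)\<close> avoids dividing by \<open>a\<close>, which
    vanishes together with the norm estimate.\<close>
  have "\<kappa> * (a * q\<^sup>2 + 2 * d * q) = (R - d) * q * (q * (R + d)) + 2 * d * q * \<kappa>"
    using R2 by algebra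
  also have "\<dots> \<le> (R - d) * q * \<kappa> + 2 * d * q * \<kappa>"
    using dR \<open>0 \<le> q\<close> qR by (intro add_right_mono mult_left_mono) auto
  also have "\<dots> = \<kappa> * (q * (R + d))" by algebra
  also have "\<dots> \<le> \<kappa> * \<kappa>" using qR pos by (intro mult_left_mono) auto
  finally have "a * q\<^sup>2 + 2 * d * q \<le> \<kappa>" using pos by simp
  moreover have "xi t \<gamma> \<eta> (k + 1) = a * s"
    using pos by (simp add: xi_def a_def s_def field_simps)
  ultimately have "4 * (1 + \<epsilon>) * s * (d + xi t \<gamma> \<eta> (k + 1) * (1 + \<epsilon>)) \<le> \<kappa>"
    unfolding q_def by (simp add: power2_eq_square algebra_simps)
  moreover have "decrease_coeff f t \<epsilon> x \<gamma> \<eta> k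
      = (1 - 4 * xi t \<gamma> \<eta> k * (1 + \<epsilon>) - 4 * s * (d + xi t \<gamma> \<eta> (k + 1) * (1 + \<epsilon>))) / 4"
    by (simp add: decrease_coeff_def s_def d_def)
  then have "4 * (1 + \<epsilon>) * decrease_coeff f t \<epsilon> x \<gamma> \<eta> k
      = (1 + \<epsilon>) * (1 - 4 * xi t \<gamma> \<eta> k * (1 + \<epsilon>))
        - 4 * (1 + \<epsilon>) * s * (d + xi t \<gamma> \<eta> (k + 1) * (1 + \<epsilon>))" by algebra
  ultimately have "(1 + \<epsilon>) * (1 - 4 * xi t \<gamma> \<eta> k * (1 + \<epsilon>)) - \<kappa>
      \<le> 4 * (1 + \<epsilon>) * decrease_coeff f t \<epsilon> x \<gamma> \<eta> k" by linarith
  \<comment> \<open>\<open>kappa\<close> carries the square of \<open>1 + \<epsilon>\<close> where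
    the coefficient carries \<open>1 + \<epsilon>\<close> itself. After scaling by
    \<open>1 + \<epsilon>\<close> the terms with \<open>xi\<close> cancel and exactly
    \<open>\<epsilon>\<close> remains.\<close>
  also have "(1 + \<epsilon>) * (1 - 4 * xi t \<gamma> \<eta> k * (1 + \<epsilon>)) - \<kappa> = \<epsilon>"
    unfolding \<kappa>_def by (simp add: power2_eq_square algebra_simps)
  finally show ?thesis using pos by (simp add: field_simps)
qed

text \<open>Five inequalities are added: optimality of \<open>x (k + 1)\<close> tested at
  \<open>xs\<close>, the tangent of \<open>f\<close> at \<open>x k\<close>, optimality of
  \<open>x k\<close> tested at \<open>x (k + 1)\<close> and, with the extra weight
  \<open>rho (k + 1)\<close>, at \<open>x (k - 1)\<close>, and optimality of
  \<open>y (k + 1)\<close> tested at \<open>ys\<close>. Testing the older point \<open>x k\<close>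
  brings in the known gradient difference between \<open>x (k - 1)\<close> and \<open>x k\<close>.
  The dual extrapolation uses the same ratio, so the only bilinear terms left involve
  \<open>y (k + 1) - y k\<close>.\<close>

lemma U_descent:
  assumes k: "k \<ge> 1" and xs: "xs \<in> D" and ys: "ys \<in> E"
  shows "U xs ys (k + 1) \<le> U xs ys k
      - \<epsilon> / (2 * t\<^sup>2 * (1 + \<epsilon>)) * (norm (y (k + 1) - y k))\<^sup>2
      - decrease_coeff f t \<epsilon> x \<gamma> \<eta> k * (norm (x k - x (k - 1)))\<^sup>2
      - \<gamma> k * (1 + rho k - (rho (k + 1))\<^sup>2) * P xs ys (k - 1)
      - \<gamma> (k + 1) * Q xs ys (k + 1)"
proof -
  define g0 g1 r where "g0 = \<gamma> k" and "g1 = \<gamma> (k + 1)" and "r = g1 / g0"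
  define a b c where "a = x (k - 1)" and "b = x k" and "c = x (k + 1)"
  define u w where "u = y k" and "w = y (k + 1)"
  define d where "d = gradient f a - gradient f b"
  define m where "m = xi t \<gamma> \<eta> (k + 1) * (1 + \<epsilon>)"
  have pos: "0 < g0" "0 < g1" "0 < r" "0 < 1 + \<epsilon>" "0 < t\<^sup>2"
    using gamma_pos k eps_pos t_pos by (auto simp: g0_def g1_def r_def)
  have r0: "r * g0 = g1" using pos by (simp add: r_def)
  have three: "(p - q) \<bullet> (z - q) = ((norm (p - q))\<^sup>2 + (norm (z - q))\<^sup>2 - (norm (p - z))\<^sup>2) / 2"
    for p q z :: "'c::real_inner"
    by (simp add: power2_norm_eq_inner inner_diff_left inner_diff_right inner_commute)
  have inner3: "(s *\<^sub>R p - q - v) \<bullet> z = s * (p \<bullet> z) - q \<bullet> z - v \<bullet> z" for s and p q v z :: 'a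
    by (simp add: inner_diff_left)
  have S1: "g1 * (G c - G xs) + (norm (c - xs))\<^sup>2 / 2 + (norm (b - c))\<^sup>2 / 2
      \<le> (norm (b - xs))\<^sup>2 / 2 + g1 * (gradient f b \<bullet> (xs - c)) + g1 * (adjoint A w \<bullet> (xs - c))"
  proof -
    have "G c + ((1 / g1) *\<^sub>R (b - c) - gradient f b - adjoint A w) \<bullet> (xs - c) \<le> G xs"
      using G_sub[of "k + 1" xs] k xs by (simp add: a_def b_def c_def g1_def w_def)
    then have "g1 * (G c - G xs)
        \<le> - ((b - c) \<bullet> (xs - c)) + g1 * (gradient f b \<bullet> (xs - c)) + g1 * (adjoint A w \<bullet> (xs - c))"
      using pos unfolding inner3 by (simp add: field_simps)
    then show ?thesis unfolding three by (simp add: norm_minus_commute field_simps)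
  qed
  have S2: "g1 * (f b - f xs) \<le> - g1 * (gradient f b \<bullet> (xs - b))"
    using mult_left_mono[OF gradient_ineq[of b xs], of g1] pos by (simp add: algebra_simps)
  have sub0: "G b + ((1 / g0) *\<^sub>R (a - b) - gradient f a - adjoint A u) \<bullet> (z - b) \<le> G z" if "z \<in> D" for z
    using G_sub[of k z] k that by (simp add: a_def b_def g0_def u_def)
  have S3: "g1 * (G b - G c) \<le> r * (((a - b) - g0 *\<^sub>R d) \<bullet> (b - c)) - g1 * (gradient f b \<bullet> (b - c))
      - g1 * (adjoint A u \<bullet> (b - c))"
  proof -
    have "c \<in> D" using x_in[of "k + 1"] k by (simp add: c_def)
    from sub0[OF this]
    have "G b - G c \<le> ((1 / g0) *\<^sub>R (a - b) - gradient f a - adjoint A u) \<bullet> (b - c)"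
      by (simp add: inner_diff_right)
    then have "g1 * (G b - G c) \<le> g1 * (((1 / g0) *\<^sub>R (a - b) - gradient f a - adjoint A u) \<bullet> (b - c))"
      using pos by simp
    also have "\<dots> = r * (((a - b) - g0 *\<^sub>R d) \<bullet> (b - c)) - g1 * (gradient f b \<bullet> (b - c))
      - g1 * (adjoint A u \<bullet> (b - c))"
      using pos unfolding inner3 inner_diff_left[of "a - b"] inner_scaleR_left r_def
      by (simp add: d_def inner_diff_left[of "gradient f a"] field_simps)
    finally show ?thesis .
  qed
  \<comment> \<open>The weight \<open>r * g1\<close> multiplies a difference of successive primal
    gaps. This yields the factor \<open>1 + r\<close> on the new gap and, as
    \<open>r * g1 = r\<^sup>2 * g0\<close>, the squared step ratio on the old one.\<close>
  have S4: "r * g1 * (f b + G b - f a - G a)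
      \<le> - r\<^sup>2 * ((norm (a - b))\<^sup>2 - g0 * (d \<bullet> (a - b))) + r * g1 * (adjoint A u \<bullet> (a - b))"
  proof -
    have "a \<in> D" using x_in[of "k - 1"] k by (simp add: a_def)
    from sub0[OF this] gradient_ineq[of b a]
    have "f b + G b - f a - G a \<le> - (((1 / g0) *\<^sub>R (a - b) - gradient f a - adjoint A u) \<bullet> (a - b))
        - gradient f b \<bullet> (a - b)" by linarith
    then have "f b + G b - f a - G a \<le> - (((1 / g0) *\<^sub>R (a - b) - d - adjoint A u) \<bullet> (a - b))"
      unfolding inner3 by (simp add: d_def inner_diff_left[of "gradient f a"])
    then have "r * g1 * (f b + G b - f a - G a)
        \<le> r * g1 * (- (((1 / g0) *\<^sub>R (a - b) - d - adjoint A u) \<bullet> (a - b)))"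
      using pos by (intro mult_left_mono) auto
    also have "\<dots> = - r\<^sup>2 * ((norm (a - b))\<^sup>2 - g0 * (d \<bullet> (a - b))) + r * g1 * (adjoint A u \<bullet> (a - b))"
      using pos unfolding inner3 power2_norm_eq_inner r_def
      by (simp add: field_simps power2_eq_square)
    finally show ?thesis .
  qed
  have S5: "g1 * (H w - H ys) \<le> ((norm (u - ys))\<^sup>2 - (norm (w - ys))\<^sup>2 - (norm (w - u))\<^sup>2) / (2 * t\<^sup>2)
      + g1 * ((A b + r *\<^sub>R A (b - a)) \<bullet> (w - ys))"
  proof -
    have "H w + ((1 / (t\<^sup>2 * g1)) *\<^sub>R (u - w) + A b + r *\<^sub>R A (b - a)) \<bullet> (ys - w) \<le> H ys"
      using H_sub[of k ys] k ys by (simp add: a_def b_def g0_def g1_def u_def w_def r_def)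
    moreover have "(s *\<^sub>R p + q + v) \<bullet> (z - z') = s * (p \<bullet> (z - z')) - (q + v) \<bullet> (z' - z)" for s and p q v z z' :: 'b
      by (simp add: inner_add_left inner_diff_right algebra_simps)
    ultimately have "H w - H ys \<le> - (1 / (t\<^sup>2 * g1)) * ((u - w) \<bullet> (ys - w)) + (A b + r *\<^sub>R A (b - a)) \<bullet> (w - ys)"
      by simp
    then have "g1 * (H w - H ys)
        \<le> g1 * (- (1 / (t\<^sup>2 * g1)) * ((u - w) \<bullet> (ys - w)) + (A b + r *\<^sub>R A (b - a)) \<bullet> (w - ys))"
      using pos by simp
    also have "\<dots> = - ((u - w) \<bullet> (ys - w)) / t\<^sup>2 + g1 * ((A b + r *\<^sub>R A (b - a)) \<bullet> (w - ys))"
      using pos by (simp add: field_simps)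
    finally show ?thesis unfolding three
      by (simp add: norm_minus_commute diff_divide_distrib add_divide_distrib)
  qed
  have young: "p * q \<le> s * p\<^sup>2 + q\<^sup>2 / (4 * s)" if "s > 0" for p q s :: real
  proof -
    have "0 \<le> (2 * s * p - q)\<^sup>2" by simp
    then show ?thesis using that by (simp add: field_simps power2_eq_square)
  qed
  \<comment> \<open>Young's inequality with parameter 1 spends half of the available
    \<open>(norm (b - c))\<^sup>2 / 2\<close>. In the expanded square the term
    \<open>(norm (a - b))\<^sup>2\<close> cancels against \<open>S4\<close>; by
    \<open>delta_norm\<close> the rest is \<open>r\<^sup>2 * delta f x \<gamma> k\<close> times the
    squared increment.\<close>
  have S6: "r * (((a - b) - g0 *\<^sub>R d) \<bullet> (b - c)) \<le> (norm (b - c))\<^sup>2 / 4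
      + r\<^sup>2 * ((norm (a - b))\<^sup>2 - 2 * g0 * (d \<bullet> (a - b)) + g0\<^sup>2 * (norm d)\<^sup>2)"
  proof -
    have "r * (((a - b) - g0 *\<^sub>R d) \<bullet> (b - c)) \<le> r * (norm ((a - b) - g0 *\<^sub>R d) * norm (b - c))"
      using pos by (intro mult_left_mono norm_cauchy_schwarz) auto
    also have "\<dots> = (r * norm ((a - b) - g0 *\<^sub>R d)) * norm (b - c)" by simp
    also have "\<dots> \<le> (r * norm ((a - b) - g0 *\<^sub>R d))\<^sup>2 + (norm (b - c))\<^sup>2 / 4"
      using young[of 1] by simp
    also have "(r * norm ((a - b) - g0 *\<^sub>R d))\<^sup>2
        = r\<^sup>2 * ((norm (a - b))\<^sup>2 - 2 * g0 * (d \<bullet> (a - b)) + g0\<^sup>2 * (norm d)\<^sup>2)"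
      unfolding power_mult_distrib power2_norm_eq_inner inner_diff_left[of "a - b" "g0 *\<^sub>R d"]
        inner_diff_right[of _ "a - b" "g0 *\<^sub>R d"] inner_scaleR_left inner_scaleR_right
      by (simp add: inner_commute power2_eq_square algebra_simps)
    finally show ?thesis by simp
  qed
  have cross: "g1 * \<bar>adjoint A (w - u) \<bullet> z\<bar> \<le> (norm (w - u))\<^sup>2 / (4 * t\<^sup>2 * (1 + \<epsilon>)) + m * (norm z)\<^sup>2" for z
  proof -
    define e where "e = \<eta> (k + 1)"
    have "g1 * \<bar>adjoint A (w - u) \<bullet> z\<bar> \<le> g1 * (norm (adjoint A (w - u)) * norm z)"
      using pos by (intro mult_left_mono Cauchy_Schwarz_ineq2) auto
    also have "\<dots> \<le> g1 * ((e * norm (w - u)) * norm z)"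
      using backtrack[of k] k pos unfolding e_def u_def w_def by (intro mult_left_mono mult_right_mono) auto
    also have "\<dots> = (g1 * e * norm z) * norm (w - u)" by simp
    also have "\<dots> \<le> t\<^sup>2 * (1 + \<epsilon>) * (g1 * e * norm z)\<^sup>2 + (norm (w - u))\<^sup>2 / (4 * (t\<^sup>2 * (1 + \<epsilon>)))"
      using pos by (intro young) auto
    also have "t\<^sup>2 * (1 + \<epsilon>) * (g1 * e * norm z)\<^sup>2 = m * (norm z)\<^sup>2"
      unfolding m_def xi_def e_def g1_def by algebra
    finally show ?thesis by (simp add: mult.assoc)
  qed
  have S7: "g1 * (adjoint A (w - u) \<bullet> (b - c)) \<le> (norm (w - u))\<^sup>2 / (4 * t\<^sup>2 * (1 + \<epsilon>)) + m * (norm (b - c))\<^sup>2"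
    by (rule order_trans[OF mult_left_mono cross]) (use pos in auto)
  have S8: "- (g1 * r * (adjoint A (w - u) \<bullet> (a - b)))
      \<le> (norm (w - u))\<^sup>2 / (4 * t\<^sup>2 * (1 + \<epsilon>)) + m * r\<^sup>2 * (norm (a - b))\<^sup>2"
  proof -
    have "- (g1 * r * (adjoint A (w - u) \<bullet> (a - b))) = g1 * (adjoint A (w - u) \<bullet> (r *\<^sub>R (b - a)))"
      by (simp add: inner_diff_right algebra_simps)
    also have "\<dots> \<le> (norm (w - u))\<^sup>2 / (4 * t\<^sup>2 * (1 + \<epsilon>)) + m * (norm (r *\<^sub>R (b - a)))\<^sup>2"
      by (rule order_trans[OF mult_left_mono cross]) (use pos in auto)
    finally show ?thesis by (simp add: power_mult_distrib norm_minus_commute mult.assoc)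
  qed
  \<comment> \<open>\<open>S7\<close> and \<open>S8\<close> both draw on the dual increment. With
    the Young parameter \<open>t\<^sup>2 * (1 + \<epsilon>)\<close> they together use the fraction
    \<open>1 / (1 + \<epsilon>)\<close> of it and leave \<open>\<epsilon> / (1 + \<epsilon>)\<close>
    as decrease.\<close>
  have eps_split: "(norm (w - u))\<^sup>2 / (4 * t\<^sup>2 * (1 + \<epsilon>)) + (norm (w - u))\<^sup>2 / (4 * t\<^sup>2 * (1 + \<epsilon>))
      = (norm (w - u))\<^sup>2 / (2 * t\<^sup>2) - \<epsilon> / (2 * t\<^sup>2 * (1 + \<epsilon>)) * (norm (w - u))\<^sup>2"
  proof -
    have "n / (4 * T * e) + n / (4 * T * e) = n / (2 * T) - (e - 1) / (2 * T * e) * n"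
      if "e > 0" "T > 0" for n T e :: real
      using that by (simp add: field_simps)
    from this[OF pos(4,5)] show ?thesis by simp
  qed
  have delta: "delta f x \<gamma> k * (norm (a - b))\<^sup>2 = g0\<^sup>2 * (norm d)\<^sup>2 - g0 * (d \<bullet> (a - b))"
    using delta_norm[of k] by (simp add: a_def b_def d_def g0_def)
  have bilinear: "adjoint A ys \<bullet> (b - xs) - r * (adjoint A ys \<bullet> (a - b)) + A xs \<bullet> (ys - w)
      + adjoint A w \<bullet> (xs - c) - adjoint A u \<bullet> (b - c) + r * (adjoint A u \<bullet> (a - b))
      + (A b + r *\<^sub>R A (b - a)) \<bullet> (w - ys)
      = adjoint A (w - u) \<bullet> (b - c) - r * (adjoint A (w - u) \<bullet> (a - b))"
    unfolding adjoint_inner A_diff inner_add_left inner_diff_left inner_diff_right inner_scaleR_left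
    by (simp add: algebra_simps)
  have grad: "gradient f b \<bullet> (xs - c) = gradient f b \<bullet> (xs - b) + gradient f b \<bullet> (b - c)"
    by (simp add: inner_diff_right)
  define p0 p1 q1 where "p0 = P xs ys (k - 1)" and "p1 = P xs ys k" and "q1 = Q xs ys (k + 1)"
  have p1: "p1 = f b + G b - f xs - G xs + adjoint A ys \<bullet> (b - xs)"
    by (simp add: p1_def P_def b_def inner_commute)
  have p01: "p1 - p0 = f b + G b - f a - G a - adjoint A ys \<bullet> (a - b)"
    by (simp add: p1_def p0_def P_def a_def b_def inner_commute[of _ "adjoint A ys"] inner_diff_right)
  have q1: "q1 = H w - H ys + A xs \<bullet> (ys - w)" by (simp add: q1_def Q_def w_def)
  have main: "(norm (c - xs))\<^sup>2 / 2 + (norm (b - c))\<^sup>2 / 4 - m * (norm (b - c))\<^sup>2 + (norm (w - ys))\<^sup>2 / (2 * t\<^sup>2)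
      + g1 * p1 + r * g1 * (p1 - p0) + g1 * q1
      \<le> (norm (b - xs))\<^sup>2 / 2 + (norm (u - ys))\<^sup>2 / (2 * t\<^sup>2) - \<epsilon> / (2 * t\<^sup>2 * (1 + \<epsilon>)) * (norm (w - u))\<^sup>2
      + r\<^sup>2 * (delta f x \<gamma> k * (norm (a - b))\<^sup>2) + m * r\<^sup>2 * (norm (a - b))\<^sup>2"
  proof -
    have "g1 * (adjoint A ys \<bullet> (b - xs)) - r * g1 * (adjoint A ys \<bullet> (a - b)) + g1 * (A xs \<bullet> (ys - w))
      + g1 * (adjoint A w \<bullet> (xs - c)) - g1 * (adjoint A u \<bullet> (b - c)) + r * g1 * (adjoint A u \<bullet> (a - b))
      + g1 * ((A b + r *\<^sub>R A (b - a)) \<bullet> (w - ys))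
      = g1 * (adjoint A (w - u) \<bullet> (b - c)) - g1 * r * (adjoint A (w - u) \<bullet> (a - b))"
      using arg_cong[OF bilinear, of "\<lambda>z. g1 * z"] by (simp only: distrib_left right_diff_distrib mult_ac)
    with S1[unfolded grad] S2 S3 S4 S5 S6 S7 S8 eps_split show ?thesis
      unfolding p01 unfolding p1 q1 delta distrib_left right_diff_distrib diff_divide_distrib
      by (simp only: distrib_left right_diff_distrib diff_divide_distrib mult_minus_left mult_minus_right mult_ac)
  qed
  have 1: "U xs ys (k + 1) = (norm (c - xs))\<^sup>2 / 2 + (norm (b - c))\<^sup>2 / 4 - m * (norm (b - c))\<^sup>2
      + (norm (w - ys))\<^sup>2 / (2 * t\<^sup>2) + g1 * (1 + r) * p1"
    by (simp add: U_def c_def b_def w_def m_def g1_def g0_def r_def p1_def norm_minus_commute field_simps)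
  have 2: "U xs ys k = (norm (b - xs))\<^sup>2 / 2 + (1 - 4 * xi t \<gamma> \<eta> k * (1 + \<epsilon>)) / 4 * (norm (a - b))\<^sup>2
      + (norm (u - ys))\<^sup>2 / (2 * t\<^sup>2) + g0 * (1 + rho k) * p0"
    by (simp add: U_def a_def b_def u_def g0_def p0_def norm_minus_commute)
  have 3: "decrease_coeff f t \<epsilon> x \<gamma> \<eta> k * (norm (x k - x (k - 1)))\<^sup>2
      = (1 - 4 * xi t \<gamma> \<eta> k * (1 + \<epsilon>)) / 4 * (norm (a - b))\<^sup>2
        - r\<^sup>2 * (delta f x \<gamma> k * (norm (a - b))\<^sup>2) - m * r\<^sup>2 * (norm (a - b))\<^sup>2"
  proof -
    have "norm (x k - x (k - 1)) = norm (a - b)" by (simp add: a_def b_def norm_minus_commute)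
    then show ?thesis
      unfolding decrease_coeff_def g1_def[symmetric] g0_def[symmetric] r_def[symmetric]
      by (simp add: m_def field_simps)
  qed
  have 4: "\<gamma> k * (1 + rho k - (rho (k + 1))\<^sup>2) * p0 = g0 * (1 + rho k) * p0 - r * g1 * p0"
  proof -
    have "rho (k + 1) = r" by (simp add: r_def g0_def g1_def)
    moreover have "g0 * (1 + z - r\<^sup>2) * p0 = g0 * (1 + z) * p0 - r * g1 * p0" for z
      unfolding r0[symmetric] by (simp add: power2_eq_square algebra_simps)
    ultimately show ?thesis by (simp add: g0_def)
  qed
  show ?thesis
    unfolding p0_def[symmetric] q1_def[symmetric] 1 2 3 4
    unfolding g1_def[symmetric] u_def[symmetric] w_def[symmetric]
    using main by (simp add: algebra_simps)
qed

section \<open>Lower bound for the stepsizes\<close>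

lemma delta_le:
  assumes "L > 0" "k \<ge> 0" "0 < delta f x \<gamma> k"
    and coco: "(norm (gradient f (x (k - 1)) - gradient f (x k)))\<^sup>2
      \<le> L * ((gradient f (x (k - 1)) - gradient f (x k)) \<bullet> (x (k - 1) - x k))"
  shows "1 \<le> \<gamma> k * L" "delta f x \<gamma> k \<le> \<gamma> k * L * (\<gamma> k * L - 1)"
proof -
  define d where "d = gradient f (x (k - 1)) - gradient f (x k)"
  define w where "w = x (k - 1) - x k"
  define l c where "l = ell f x k" and "c = cc f x k"
  have g: "0 < \<gamma> k" using gamma_pos assms by simp
  have l: "l = (d \<bullet> w) / (norm w)\<^sup>2" and c: "c = (norm d)\<^sup>2 / (d \<bullet> w)"
    by (simp_all add: l_def c_def ell_def cc_def d_def w_def)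
  have dl: "delta f x \<gamma> k = \<gamma> k * l * (\<gamma> k * c - 1)" by (simp add: delta_def l_def c_def)
  have coco: "(norm d)\<^sup>2 \<le> L * (d \<bullet> w)" using coco by (simp add: d_def w_def)
  have dw: "0 \<le> d \<bullet> w" using order_trans[OF _ coco, of 0] \<open>L > 0\<close> by (simp add: zero_le_mult_iff)
  then have "0 \<le> l" by (simp add: l)
  then have "0 \<le> \<gamma> k * l" using g by simp
  \<comment> \<open>A positive \<open>delta\<close> forces \<open>\<gamma> k * c > 1\<close>.
    Cocoercivity bounds \<open>c\<close> by \<open>L\<close>, so the stepsize is at least
    \<open>1 / L\<close>; together with Cauchy-Schwarz it bounds \<open>l\<close> by
    \<open>L\<close> as well.\<close>
  with assms(3) have "0 < \<gamma> k * l" "0 < \<gamma> k * c - 1" unfolding dl by (auto simp: zero_less_mult_iff)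
  then have "0 < l" using g by (simp add: zero_less_mult_iff)
  then have dw: "0 < d \<bullet> w" "w \<noteq> 0" using dw by (auto simp: l zero_less_divide_iff)
  have cL: "c \<le> L" using coco dw by (simp add: c field_simps)
  have "(d \<bullet> w)\<^sup>2 \<le> (norm d)\<^sup>2 * (norm w)\<^sup>2"
    using Cauchy_Schwarz_ineq[of d w] by (simp add: power2_norm_eq_inner)
  also have "\<dots> \<le> L * (d \<bullet> w) * (norm w)\<^sup>2" using coco by (rule mult_right_mono) simp
  finally have "d \<bullet> w \<le> L * (norm w)\<^sup>2" using dw by (simp add: power2_eq_square)
  then have lL: "l \<le> L" using dw by (simp add: l field_simps)
  have gcL: "\<gamma> k * c \<le> \<gamma> k * L" using g cL by simp
  with \<open>0 < \<gamma> k * c - 1\<close> show "1 \<le> \<gamma> k * L" by simp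
  have "(\<gamma> k * l) * (\<gamma> k * c - 1) \<le> (\<gamma> k * L) * (\<gamma> k * L - 1)"
    using gcL \<open>0 < \<gamma> k * c - 1\<close> g lL \<open>L > 0\<close> \<open>0 < l\<close> by (intro mult_mono) auto
  then show "delta f x \<gamma> k \<le> \<gamma> k * L * (\<gamma> k * L - 1)" by (simp add: dl)
qed

text \<open>By induction: a number \<open>c\<close> below \<open>\<gamma> k\<close> passes the three
  tests that characterize the numbers below \<open>\<gamma> (k + 1)\<close>. The conditions on
  \<open>c\<close> are the entries of \<open>gamma_hat\<close> with denominators cleared.\<close>

lemma gamma_lower_bound:
  assumes V: "bounded V" "convex V" "\<And>k. k \<ge> -1 \<Longrightarrow> x k \<in> V"
    and L: "L > 0" "L-lipschitz_on (V + {z. norm z \<le> diameter V}) (gradient f)"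
    and nb: "nb = (\<nu>\<^sup>2 - (1 + \<epsilon>)\<^sup>2) / \<nu>\<^sup>2"
    and c: "0 < c" "c \<le> \<gamma> 0" "c\<^sup>2 * (2 * (1 + \<epsilon>) * t * \<eta>m * L) \<le> sqrt nb"
      "4 * (1 + \<epsilon>) * L\<^sup>2 * c\<^sup>2 \<le> nb" "2 * \<nu> * t * \<eta>m * c \<le> 1"
      "c * (2 * (1 + \<epsilon>) * t * \<eta>m) \<le> sqrt nb"
    and "k \<ge> 0"
  shows "c \<le> \<gamma> k"
  using \<open>k \<ge> 0\<close>
proof (induction k rule: int_ge_induct)
  case base
  then show ?case using c by simp
next
  case (step k)
  define g \<kappa> d e where "g = \<gamma> k" and "\<kappa> = kappa k" and "d = delta f x \<gamma> k" and "e = \<eta> (k + 1)"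
  have pos: "0 < g" "0 < \<kappa>" "0 < 1 + \<epsilon>" "0 < t" "0 \<le> e" "e \<le> \<eta>m" "0 < \<nu>"
    using gamma_pos[of k] kappa_pos[of k] step eps_pos t_pos nu_gt eta_nonneg[of "k + 1"] eta_le[of "k + 1"]
    by (auto simp: g_def \<kappa>_def e_def)
  have cg: "c \<le> g" using step by (simp add: g_def)
  have nbk: "nb \<le> \<kappa>" using kappa_ge step by (simp add: nb \<kappa>_def)
  have snb: "sqrt nb \<le> sqrt \<kappa>" using nbk by simp
  have sk: "sqrt \<kappa> * sqrt \<kappa> = \<kappa>" "0 < sqrt \<kappa>" using pos by simp_all
  define m where "m = t * e * g * sqrt \<kappa>"
  have m0: "0 \<le> m" using pos by (simp add: m_def)
  have m2: "(t * e * g)\<^sup>2 * \<kappa> = m\<^sup>2" using pos by (simp add: m_def power_mult_distrib)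
  \<comment> \<open>Hence \<open>sqrt (d\<^sup>2 + m\<^sup>2) + d\<close> is at most
    \<open>m\<close> for nonpositive \<open>d\<close> and at most \<open>2 * d + m\<close>
    otherwise. Only a positive \<open>d\<close> has to be estimated by the Lipschitz
    modulus.\<close>
  have R: "sqrt (d\<^sup>2 + m\<^sup>2) \<le> \<bar>d\<bar> + m"
    using m0 by (intro real_le_lsqrt) (auto simp: power2_eq_square algebra_simps)
  have 1: "c \<le> g * sqrt (1 + rho k)"
  proof -
    have "g * 1 \<le> g * sqrt (1 + rho k)" using pos rho_pos[of k] step by (intro mult_left_mono) auto
    then show ?thesis using cg by simp
  qed
  have "2 * \<nu> * t * e * c \<le> 2 * \<nu> * t * \<eta>m * c"
    using pos c by (intro mult_right_mono mult_left_mono) auto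
  then have 2: "2 * \<nu> * t * e * c \<le> 1" using c by simp
  have "c\<^sup>2 * (2 * (1 + \<epsilon>) * (sqrt (d\<^sup>2 + m\<^sup>2) + d)) \<le> g\<^sup>2 * \<kappa>"
  proof (cases "d \<le> 0")
    case True
    then have "sqrt (d\<^sup>2 + m\<^sup>2) + d \<le> m" using R by simp
    then have "c\<^sup>2 * (2 * (1 + \<epsilon>) * (sqrt (d\<^sup>2 + m\<^sup>2) + d)) \<le> c\<^sup>2 * (2 * (1 + \<epsilon>) * m)"
      using pos by (intro mult_left_mono) auto
    also have "\<dots> = (c * (2 * (1 + \<epsilon>) * t * e)) * (c * (g * sqrt \<kappa>))"
      by (simp add: m_def power2_eq_square)
    also have "\<dots> \<le> sqrt \<kappa> * (g * (g * sqrt \<kappa>))"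
    proof (rule mult_mono)
      have "c * (2 * (1 + \<epsilon>) * t * e) \<le> c * (2 * (1 + \<epsilon>) * t * \<eta>m)"
        using pos c by (intro mult_left_mono) auto
      then show "c * (2 * (1 + \<epsilon>) * t * e) \<le> sqrt \<kappa>" using c snb by linarith
      show "c * (g * sqrt \<kappa>) \<le> g * (g * sqrt \<kappa>)" using cg pos by (intro mult_right_mono) auto
    qed (use pos c in auto)
    also have "\<dots> = g\<^sup>2 * \<kappa>" using sk by (simp add: power2_eq_square)
    finally show ?thesis .
  next
    case False
    have "(norm (gradient f (x (k - 1)) - gradient f (x k)))\<^sup>2
      \<le> L * ((gradient f (x (k - 1)) - gradient f (x k)) \<bullet> (x (k - 1) - x k))"
      using V step by (intro gradient_cocoercive[OF f_convex differentiable_loc_lipschitz_gradient[OF f_lip] V(1,2) L]) auto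
    then have gL: "1 \<le> g * L" "d \<le> g * L * (g * L - 1)"
      using delta_le[of L k] L step False by (auto simp: d_def g_def)
    have "sqrt (d\<^sup>2 + m\<^sup>2) + d \<le> 2 * (g * L * (g * L - 1)) + m" using R False gL by simp
    then have "c\<^sup>2 * (2 * (1 + \<epsilon>) * (sqrt (d\<^sup>2 + m\<^sup>2) + d))
        \<le> c\<^sup>2 * (2 * (1 + \<epsilon>) * (2 * (g * L * (g * L - 1)) + m))"
      using pos by (intro mult_left_mono) auto
    \<comment> \<open>The regrouping anticipates \<open>g\<^sup>2 = g * (g - 1 / L) + g / L\<close>:
      each summand is charged to one condition on \<open>c\<close>, and \<open>delta_le\<close>
      provides \<open>1 / L \<le> g\<close>.\<close>
    also have "\<dots> = (4 * (1 + \<epsilon>) * L\<^sup>2 * c\<^sup>2) * (g * (g - 1 / L)) + (c\<^sup>2 * (2 * (1 + \<epsilon>) * t * e * L)) * (g * sqrt \<kappa> / L)"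
      using L by (simp add: m_def field_simps power2_eq_square)
    also have "\<dots> \<le> \<kappa> * (g * (g - 1 / L)) + sqrt \<kappa> * (g * sqrt \<kappa> / L)"
    proof (rule add_mono; rule mult_right_mono)
      show "4 * (1 + \<epsilon>) * L\<^sup>2 * c\<^sup>2 \<le> \<kappa>" using c nbk by simp
      show "0 \<le> g * (g - 1 / L)" using gL L pos by (simp add: field_simps)
      have "c\<^sup>2 * (2 * (1 + \<epsilon>) * t * e * L) \<le> c\<^sup>2 * (2 * (1 + \<epsilon>) * t * \<eta>m * L)"
        using pos c L by (intro mult_left_mono mult_right_mono) auto
      then show "c\<^sup>2 * (2 * (1 + \<epsilon>) * t * e * L) \<le> sqrt \<kappa>" using c(3) snb by linarith
    qed (use pos L in auto)
    also have "sqrt \<kappa> * (g * sqrt \<kappa> / L) = \<kappa> * (g / L)" using sk(1) by (simp add: field_simps)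
    also have "\<kappa> * (g * (g - 1 / L)) + \<kappa> * (g / L) = g\<^sup>2 * \<kappa>"
      by (simp add: algebra_simps power2_eq_square)
    finally show ?thesis .
  qed
  with 1 2 show ?case
    using gamma_ge_iff[of k c] step c(1)
    by (simp add: m2[symmetric] g_def d_def e_def \<kappa>_def)
qed

section \<open>Nonnegative gaps and boundedness of the iterates\<close>

lemma P_nonneg: "\<lbrakk>saddle xs ys; k \<ge> 0\<rbrakk> \<Longrightarrow> 0 \<le> P xs ys k"
  using x_in[of k] by (force simp: saddle_def P_def)

lemma Q_nonneg: "\<lbrakk>saddle xs ys; k \<ge> 1\<rbrakk> \<Longrightarrow> 0 \<le> Q xs ys k"
  using y_in[of "k - 1"] by (force simp: saddle_def Q_def)

lemma U_ge:
  assumes "saddle xs ys" "k \<ge> 1"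
  shows "1 / 2 * (norm (x k - xs))\<^sup>2 + 1 / (2 * t\<^sup>2) * (norm (y k - ys))\<^sup>2
     + \<gamma> k * (1 + rho k) * P xs ys (k - 1) \<le> U xs ys k"
    and "0 \<le> \<gamma> k * (1 + rho k) * P xs ys (k - 1)"
proof -
  show "1 / 2 * (norm (x k - xs))\<^sup>2 + 1 / (2 * t\<^sup>2) * (norm (y k - ys))\<^sup>2
     + \<gamma> k * (1 + rho k) * P xs ys (k - 1) \<le> U xs ys k"
    using U_coeff_bounds[of k] assms unfolding U_def by simp
  show "0 \<le> \<gamma> k * (1 + rho k) * P xs ys (k - 1)"
    using P_nonneg[of xs ys "k - 1"] gamma_pos[of k] rho_pos[of k] assms by simp
qed

lemma U_nonneg:
  assumes "saddle xs ys" "k \<ge> 1"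
  shows "0 \<le> U xs ys k"
proof -
  have "0 \<le> 1 / 2 * (norm (x k - xs))\<^sup>2 + 1 / (2 * t\<^sup>2) * (norm (y k - ys))\<^sup>2" by simp
  then show ?thesis using U_ge[OF assms] by linarith
qed

lemma U_telescope:
  assumes s: "saddle xs ys" and "k \<ge> 1"
  shows "0 \<le> \<epsilon> / (2 * t\<^sup>2 * (1 + \<epsilon>)) * (norm (y (k + 1) - y k))\<^sup>2"
    and "0 \<le> \<epsilon> / (4 * (1 + \<epsilon>)) * (norm (x k - x (k - 1)))\<^sup>2"
    and "0 \<le> \<gamma> k * (1 + rho k - (rho (k + 1))\<^sup>2) * P xs ys (k - 1)"
    and "0 \<le> \<gamma> (k + 1) * Q xs ys (k + 1)"
    and "\<epsilon> / (2 * t\<^sup>2 * (1 + \<epsilon>)) * (norm (y (k + 1) - y k))\<^sup>2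
      + \<epsilon> / (4 * (1 + \<epsilon>)) * (norm (x k - x (k - 1)))\<^sup>2
      + \<gamma> k * (1 + rho k - (rho (k + 1))\<^sup>2) * P xs ys (k - 1)
      + \<gamma> (k + 1) * Q xs ys (k + 1) \<le> U xs ys k - U xs ys (k + 1)"
proof -
  show "0 \<le> \<epsilon> / (2 * t\<^sup>2 * (1 + \<epsilon>)) * (norm (y (k + 1) - y k))\<^sup>2"
    and "0 \<le> \<epsilon> / (4 * (1 + \<epsilon>)) * (norm (x k - x (k - 1)))\<^sup>2"
    using eps_pos by auto
  show "0 \<le> \<gamma> k * (1 + rho k - (rho (k + 1))\<^sup>2) * P xs ys (k - 1)"
    using gamma_pos[of k] rho_growth[of k] P_nonneg[OF s, of "k - 1"] \<open>k \<ge> 1\<close> by simp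
  show "0 \<le> \<gamma> (k + 1) * Q xs ys (k + 1)"
    using gamma_pos[of "k + 1"] Q_nonneg[OF s, of "k + 1"] \<open>k \<ge> 1\<close> by simp
  have "\<epsilon> / (4 * (1 + \<epsilon>)) * (norm (x k - x (k - 1)))\<^sup>2
      \<le> decrease_coeff f t \<epsilon> x \<gamma> \<eta> k * (norm (x k - x (k - 1)))\<^sup>2"
    using \<open>k \<ge> 1\<close> by (intro mult_right_mono decrease_coeff_ge) auto
  then show "\<epsilon> / (2 * t\<^sup>2 * (1 + \<epsilon>)) * (norm (y (k + 1) - y k))\<^sup>2
      + \<epsilon> / (4 * (1 + \<epsilon>)) * (norm (x k - x (k - 1)))\<^sup>2
      + \<gamma> k * (1 + rho k - (rho (k + 1))\<^sup>2) * P xs ys (k - 1)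
      + \<gamma> (k + 1) * Q xs ys (k + 1) \<le> U xs ys k - U xs ys (k + 1)"
    using U_descent[OF \<open>k \<ge> 1\<close>, of xs ys] s by (simp add: saddle_def)
qed

lemma U_decseq: "saddle xs ys \<Longrightarrow> k \<ge> 1 \<Longrightarrow> U xs ys (k + 1) \<le> U xs ys k"
  using U_telescope[of xs ys k] by linarith

lemma U_le_U1:
  assumes "saddle xs ys" "k \<ge> 1"
  shows "U xs ys k \<le> U xs ys 1"
  using \<open>k \<ge> 1\<close>
proof (induction k rule: int_ge_induct)
  case (step k)
  then show ?case using U_decseq[OF assms(1), of k] by simp
qed simp

lemma bounded_iterates:
  assumes "saddle xs ys"
  obtains R where "\<And>k. k \<ge> -1 \<Longrightarrow> norm (x k) \<le> R" "\<And>k. k \<ge> 0 \<Longrightarrow> norm (y k) \<le> R"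
proof -
  define B where "B = sqrt (2 * U xs ys 1) + sqrt (2 * t\<^sup>2 * U xs ys 1)"
  have U0: "0 \<le> U xs ys 1" using U_nonneg[OF assms, of 1] by simp
  have *: "norm (x k - xs) \<le> B \<and> norm (y k - ys) \<le> B" if "k \<ge> 1" for k
  proof -
    have le: "1 / 2 * (norm (x k - xs))\<^sup>2 + 1 / (2 * t\<^sup>2) * (norm (y k - ys))\<^sup>2 \<le> U xs ys 1"
      using U_ge[OF assms that] U_le_U1[OF assms that] by linarith
    have nn: "0 \<le> 1 / 2 * (norm (x k - xs))\<^sup>2" "0 \<le> 1 / (2 * t\<^sup>2) * (norm (y k - ys))\<^sup>2" by simp_all
    have "(norm (x k - xs))\<^sup>2 \<le> 2 * U xs ys 1" using le nn by linarith
    then have "norm (x k - xs) \<le> sqrt (2 * U xs ys 1)" by (rule real_le_rsqrt)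
    moreover have "1 / (2 * t\<^sup>2) * (norm (y k - ys))\<^sup>2 \<le> U xs ys 1" using le nn by linarith
    then have "(norm (y k - ys))\<^sup>2 \<le> 2 * t\<^sup>2 * U xs ys 1" using t_pos by (simp add: field_simps)
    then have "norm (y k - ys) \<le> sqrt (2 * t\<^sup>2 * U xs ys 1)" by (rule real_le_rsqrt)
    ultimately show ?thesis using U0 unfolding B_def by (smt (verit) real_sqrt_ge_zero mult_nonneg_nonneg zero_le_power2)
  qed
  \<comment> \<open>The Lyapunov bound begins at index 1, so the starting values enter the maximum
    separately.\<close>
  define R where "R = Max {B + norm xs, B + norm ys, norm (x (-1)), norm (x 0), norm (y 0)}"
  have R: "B + norm xs \<le> R" "B + norm ys \<le> R" "norm (x (-1)) \<le> R" "norm (x 0) \<le> R" "norm (y 0) \<le> R"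
    by (simp_all add: R_def)
  show thesis
  proof
    fix k :: int
    assume "k \<ge> -1"
    then consider "k = -1" | "k = 0" | "k \<ge> 1" by linarith
    then show "norm (x k) \<le> R"
    proof cases
      case 3
      have "norm (x k) \<le> norm xs + norm (x k - xs)" by (rule norm_triangle_sub)
      then show ?thesis using *[OF 3] R by linarith
    qed (use R in auto)
  next
    fix k :: int
    assume "k \<ge> 0"
    then consider "k = 0" | "k \<ge> 1" by linarith
    then show "norm (y k) \<le> R"
    proof cases
      case 2
      have "norm (y k) \<le> norm ys + norm (y k - ys)" by (rule norm_triangle_sub)
      then show ?thesis using *[OF 2] R by linarith
    qed (use R in auto)
  qed
qed

lemma gamma_bounded_below:
  assumes "saddle xs ys"
  obtains c where "c > 0" "\<And>k. k \<ge> 0 \<Longrightarrow> c \<le> \<gamma> k"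
proof -
  obtain R where R: "\<And>k. k \<ge> -1 \<Longrightarrow> norm (x k) \<le> R" using bounded_iterates[OF assms] by blast
  let ?V = "cball 0 R :: 'a set"
  have ball: "{z::'a. norm z \<le> diameter ?V} = cball 0 (diameter ?V)" by auto
  have "convex (?V + {z. norm z \<le> diameter ?V}) \<and> compact (?V + {z. norm z \<le> diameter ?V})"
    unfolding ball by (intro conjI convex_set_plus compact_set_plus) auto
  then obtain L where L: "L > 0" "L-lipschitz_on (?V + {z. norm z \<le> diameter ?V}) (gradient f)"
    using f_lip unfolding loc_lipschitz_gradient_def by blast
  define nb where "nb = (\<nu>\<^sup>2 - (1 + \<epsilon>)\<^sup>2) / \<nu>\<^sup>2"
  \<comment> \<open>Summing the denominators lets the single quotient \<open>nb / Z\<close> serve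
    all tests: \<open>c \<le> 1\<close> gives \<open>c\<^sup>2 \<le> c\<close>, and
    \<open>nb \<le> 1\<close> gives \<open>nb \<le> sqrt nb\<close>. Some positive bound is enough
    for the limit arguments; the explicit one is treated separately.\<close>
  define Z where "Z = 2 * (1 + \<epsilon>) * t * \<eta>m * L + 4 * (1 + \<epsilon>) * L\<^sup>2 + 2 * \<nu> * t * \<eta>m + 2 * (1 + \<epsilon>) * t * \<eta>m + 1"
  define c where "c = min (\<gamma> 0) (min 1 (nb / Z))"
  have nb: "0 < nb" using nu_bar_pos by (simp add: nb_def)
  have nb1: "nb \<le> 1" using nu_gt eps_pos by (simp add: nb_def field_simps)
  have "nb\<^sup>2 \<le> nb" using nb nb1 by (simp add: power2_eq_square)
  then have snb: "nb \<le> sqrt nb" by (rule real_le_rsqrt)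
  have "0 \<le> \<eta>m" using eta_nonneg[of 0] eta_le[of 0] by simp
  then have nn: "0 \<le> 2 * (1 + \<epsilon>) * t * \<eta>m * L" "0 \<le> 4 * (1 + \<epsilon>) * L\<^sup>2" "0 \<le> 2 * \<nu> * t * \<eta>m"
      "0 \<le> 2 * (1 + \<epsilon>) * t * \<eta>m"
    using nu_gt eps_pos t_pos L by auto
  then have Z: "0 < Z" unfolding Z_def by linarith
  have c: "0 < c" "c \<le> \<gamma> 0" "c \<le> 1" "c \<le> nb / Z" using gamma_pos[of 0] nb Z by (simp_all add: c_def)
  have cZ: "c * Z \<le> nb" using c Z by (simp add: field_simps)
  have c2: "c\<^sup>2 \<le> c" using c by (simp add: power2_eq_square)
  have le: "c * W \<le> nb" if "0 \<le> W" "W \<le> Z" for W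
    using order_trans[OF mult_left_mono[OF that(2)] cZ] c by simp
  have le2: "c\<^sup>2 * W \<le> nb" if "0 \<le> W" "W \<le> Z" for W
    using order_trans[OF mult_right_mono[OF c2 that(1)] le[OF that]] .
  show thesis
  proof (rule that[OF c(1)])
    fix k :: int
    assume "k \<ge> 0"
    then show "c \<le> \<gamma> k"
    proof (rule gamma_lower_bound[where V = ?V and L = L and nb = nb, rotated -1])
      show "c\<^sup>2 * (2 * (1 + \<epsilon>) * t * \<eta>m * L) \<le> sqrt nb"
        by (rule order_trans[OF le2 snb]) (use nn in \<open>auto simp: Z_def\<close>)
      show "4 * (1 + \<epsilon>) * L\<^sup>2 * c\<^sup>2 \<le> nb"
        using le2[of "4 * (1 + \<epsilon>) * L\<^sup>2"] nn by (simp add: Z_def mult.commute)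
      show "2 * \<nu> * t * \<eta>m * c \<le> 1"
        using le[of "2 * \<nu> * t * \<eta>m"] nn nb1 by (simp add: Z_def mult.commute)
      show "c * (2 * (1 + \<epsilon>) * t * \<eta>m) \<le> sqrt nb"
        by (rule order_trans[OF le snb]) (use nn in \<open>auto simp: Z_def\<close>)
    qed (use R L c in \<open>auto simp: nb_def\<close>)
  qed
qed

end

section \<open>Convergence\<close>

lemma summable_decrement:
  fixes a u :: "nat \<Rightarrow> real"
  assumes "\<And>n. 0 \<le> a n" "\<And>n. 0 \<le> u n" "\<And>n. a n \<le> u n - u (Suc n)"
  shows "summable a"
proof (rule summableI_nonneg_bounded[where x = "u 0"])
  fix n
  have "sum a {..<n} \<le> (\<Sum>i<n. u i - u (Suc i))" by (rule sum_mono) (rule assms)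
  also have "\<dots> = u 0 - u n" by (rule sum_lessThan_telescope')
  finally show "sum a {..<n} \<le> u 0" using assms(2)[of n] by simp
qed (rule assms)

lemma subseq_tendsto_zeroE:
  fixes a :: "nat \<Rightarrow> real"
  assumes "\<And>c N. c > 0 \<Longrightarrow> \<exists>n\<ge>N. \<bar>a n\<bar> < c"
  obtains r where "strict_mono r" "(\<lambda>n. a (r n)) \<longlonglongrightarrow> 0"
proof -
  have "\<forall>N m. \<exists>n\<ge>N. \<bar>a n\<bar> < inverse (real (Suc m))" using assms by simp
  then obtain w where w: "\<And>N m. N \<le> w N m" "\<And>N m. \<bar>a (w N m)\<bar> < inverse (real (Suc m))" by metis
  \<comment> \<open>Each step asks for an index beyond the previous one that meets the next
    tolerance.\<close>
  define r where "r = rec_nat (w 0 0) (\<lambda>n p. w (Suc p) (Suc n))"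
  have r: "r 0 = w 0 0" "\<And>n. r (Suc n) = w (Suc (r n)) (Suc n)" by (simp_all add: r_def)
  have "strict_mono r" unfolding strict_mono_Suc_iff r(2) using w(1) Suc_le_lessD by blast
  moreover have "\<bar>a (r n)\<bar> < inverse (real (Suc n))" for n
    by (cases n) (use w(2) r in \<open>metis+\<close>)
  then have "(\<lambda>n. a (r n)) \<longlonglongrightarrow> 0"
    by (intro Lim_null_comparison[OF _ LIMSEQ_inverse_real_of_nat] always_eventually allI)
      (auto intro: less_imp_le)
  ultimately show thesis by (rule that)
qed

lemma tendsto_if_unique_subseq_limit:
  fixes z :: "nat \<Rightarrow> 'a::heine_borel"
  assumes "bounded (range z)"
    and "\<And>r l'. strict_mono r \<Longrightarrow> (\<lambda>n. z (r n)) \<longlonglongrightarrow> l' \<Longrightarrow> l' = l"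
  shows "z \<longlonglongrightarrow> l"
proof (rule ccontr)
  assume "\<not> z \<longlonglongrightarrow> l"
  then obtain e where e: "e > 0" "\<And>N. \<exists>n\<ge>N. e \<le> dist (z n) l"
    unfolding lim_sequentially by (meson not_less)
  then have "infinite {n. e \<le> dist (z n) l}" by (simp add: infinite_nat_iff_unbounded_le)
  then obtain r :: "nat \<Rightarrow> nat" where r: "strict_mono r" "\<And>n. e \<le> dist (z (r n)) l"
    using infinite_enumerate by blast
  have "bounded (range (z \<circ> r))" using assms(1) by (rule bounded_subset) auto
  then obtain l' r' where r': "strict_mono r'" "((z \<circ> r) \<circ> r') \<longlonglongrightarrow> l'"
    using bounded_imp_convergent_subsequence by blast
  have lim: "(\<lambda>n. z ((r \<circ> r') n)) \<longlonglongrightarrow> l'" using r'(2) by (simp add: o_def)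
  then have "l' = l" using assms(2) strict_mono_o[OF r(1) r'(1)] by blast
  then have "(\<lambda>n. dist (z ((r \<circ> r') n)) l) \<longlonglongrightarrow> dist l l"
    using lim by (intro tendsto_intros) simp
  then have "(\<lambda>n. dist (z ((r \<circ> r') n)) l) \<longlonglongrightarrow> 0" by simp
  then have "e \<le> 0" by (rule LIMSEQ_le_const) (use r(2) in auto)
  with e show False by simp
qed

context adaptive_primal_dual
begin

section \<open>Summable losses and convergence of the Lyapunov values\<close>

lemma bounded_linear_A: "bounded_linear A"
  using A_linear by (simp add: linear_conv_bounded_linear)

lemma bounded_linear_adjoint: "bounded_linear (adjoint A)"
  using adjoint_linear[OF A_linear] by (simp add: linear_conv_bounded_linear)

lemmas tendsto_A = bounded_linear.tendsto[OF bounded_linear_A]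
lemmas tendsto_adjoint = bounded_linear.tendsto[OF bounded_linear_adjoint]

text \<open>Every loss in the descent is nonnegative and bounded by the decrement of
  \<open>U\<close>, hence summable. For the gap loss summability itself is kept, because it will be
  weighed against the slacks.\<close>

lemma increments_tendsto:
  assumes s: "saddle xs ys"
  shows "(\<lambda>n. x (int n) - x (int n - 1)) \<longlonglongrightarrow> 0"
    and "(\<lambda>n. y (int n + 1) - y (int n)) \<longlonglongrightarrow> 0"
    and "(\<lambda>n. \<gamma> (int n) * Q xs ys (int n)) \<longlonglongrightarrow> 0"
    and "summable (\<lambda>n. \<gamma> (int n + 1) * (1 + rho (int n + 1) - (rho (int n + 1 + 1))\<^sup>2) * P xs ys (int n))"
proof -
  have sm: "summable a" if "\<And>n. 0 \<le> a n" "\<And>n. a n \<le> U xs ys (int n + 1) - U xs ys (int n + 1 + 1)" for a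
  proof (rule summable_decrement[of a "\<lambda>n. U xs ys (int n + 1)"])
    show "0 \<le> U xs ys (int n + 1)" for n by (rule U_nonneg[OF s]) simp
    show "a n \<le> U xs ys (int n + 1) - U xs ys (int (Suc n) + 1)" for n
      using that(2)[of n] by (simp add: add_ac)
  qed (rule that)
  have k1: "int n + 1 \<ge> 1" for n by simp
  define a1 where "a1 n = \<epsilon> / (2 * t\<^sup>2 * (1 + \<epsilon>)) * (norm (y (int n + 1 + 1) - y (int n + 1)))\<^sup>2" for n
  define a2 where "a2 n = \<epsilon> / (4 * (1 + \<epsilon>)) * (norm (x (int n + 1) - x (int n + 1 - 1)))\<^sup>2" for n
  define a3 where "a3 n = \<gamma> (int n + 1) * (1 + rho (int n + 1) - (rho (int n + 1 + 1))\<^sup>2)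
      * P xs ys (int n + 1 - 1)" for n
  define a4 where "a4 n = \<gamma> (int n + 1 + 1) * Q xs ys (int n + 1 + 1)" for n
  have all: "0 \<le> a1 n \<and> 0 \<le> a2 n \<and> 0 \<le> a3 n \<and> 0 \<le> a4 n \<and>
      a1 n + a2 n + a3 n + a4 n \<le> U xs ys (int n + 1) - U xs ys (int n + 1 + 1)" for n
    unfolding a1_def a2_def a3_def a4_def by (intro conjI U_telescope[OF s k1])
  have sums: "summable a1" "summable a2" "summable a3" "summable a4"
  proof (rule_tac [!] sm)
    fix n
    show "0 \<le> a1 n" "0 \<le> a2 n" "0 \<le> a3 n" "0 \<le> a4 n" using all[of n] by auto
    show "a1 n \<le> U xs ys (int n + 1) - U xs ys (int n + 1 + 1)"
      "a2 n \<le> U xs ys (int n + 1) - U xs ys (int n + 1 + 1)"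
      "a3 n \<le> U xs ys (int n + 1) - U xs ys (int n + 1 + 1)"
      "a4 n \<le> U xs ys (int n + 1) - U xs ys (int n + 1 + 1)" using all[of n] by linarith+
  qed
  have norm0: "v \<longlonglongrightarrow> 0" if "summable (\<lambda>n. c * (norm (v (Suc n)))\<^sup>2)" "c > 0"
    for c :: real and v :: "nat \<Rightarrow> 'c::real_normed_vector"
  proof -
    have "(\<lambda>n. (1 / c) * (c * (norm (v (Suc n)))\<^sup>2)) \<longlonglongrightarrow> (1 / c) * 0"
      using summable_LIMSEQ_zero[OF that(1)] by (intro tendsto_intros)
    then have "(\<lambda>n. (norm (v (Suc n)))\<^sup>2) \<longlonglongrightarrow> 0" using that(2) by simp
    then have "(\<lambda>n. norm (v (Suc n))) \<longlonglongrightarrow> 0" by (simp add: power_tendsto_0_iff)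
    then have "(\<lambda>n. v (Suc n)) \<longlonglongrightarrow> 0" by (simp add: tendsto_norm_zero_iff)
    then show ?thesis by (rule LIMSEQ_imp_Suc)
  qed
  have p: "0 < \<epsilon> / (4 * (1 + \<epsilon>))" "0 < \<epsilon> / (2 * t\<^sup>2 * (1 + \<epsilon>))" using eps_pos t_pos by simp_all
  show "(\<lambda>n. x (int n) - x (int n - 1)) \<longlonglongrightarrow> 0"
    by (rule norm0[OF _ p(1)]) (use sums(2) in \<open>simp add: a2_def[abs_def] add_ac\<close>)
  show "(\<lambda>n. y (int n + 1) - y (int n)) \<longlonglongrightarrow> 0"
    by (rule norm0[OF _ p(2)]) (use sums(1) in \<open>simp add: a1_def[abs_def] add_ac\<close>)
  \<comment> \<open>The loss with number \<open>n\<close> involves \<open>Q\<close> two indices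
    later, so the limit is shifted back twice.\<close>
  have "(\<lambda>n. \<gamma> (int (Suc (Suc n))) * Q xs ys (int (Suc (Suc n)))) \<longlonglongrightarrow> 0"
    using summable_LIMSEQ_zero[OF sums(4)] by (simp add: a4_def[abs_def] add_ac)
  then show "(\<lambda>n. \<gamma> (int n) * Q xs ys (int n)) \<longlonglongrightarrow> 0"
    by (intro LIMSEQ_imp_Suc[of "\<lambda>n. \<gamma> (int n) * Q xs ys (int n)"]
        LIMSEQ_imp_Suc[of "\<lambda>n. \<gamma> (int (Suc n)) * Q xs ys (int (Suc n))"])
  show "summable (\<lambda>n. \<gamma> (int n + 1) * (1 + rho (int n + 1) - (rho (int n + 1 + 1))\<^sup>2) * P xs ys (int n))"
    using sums(3) by (simp add: a3_def[abs_def])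
qed

lemma Q_tendsto_zero:
  assumes s: "saddle xs ys"
  shows "(\<lambda>n. Q xs ys (int n)) \<longlonglongrightarrow> 0"
proof -
  obtain c where c: "c > 0" "\<And>k. k \<ge> 0 \<Longrightarrow> c \<le> \<gamma> k" using gamma_bounded_below[OF s] by blast
  show ?thesis
  proof (rule tendsto_0_le[where K = "1 / c"])
    show "(\<lambda>n. \<gamma> (int n) * Q xs ys (int n)) \<longlonglongrightarrow> 0" by (rule increments_tendsto[OF s])
    show "\<forall>\<^sub>F n in sequentially. norm (Q xs ys (int n)) \<le> norm (\<gamma> (int n) * Q xs ys (int n)) * (1 / c)"
    proof (intro always_eventually allI)
      fix n
      have "norm (Q xs ys (int n)) * c \<le> norm (Q xs ys (int n)) * \<gamma> (int n)"
        by (intro mult_left_mono c) auto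
      then show "norm (Q xs ys (int n)) \<le> norm (\<gamma> (int n) * Q xs ys (int n)) * (1 / c)"
        using c(1) gamma_pos[of "int n"] by (simp add: abs_mult field_simps)
    qed
  qed
qed

text \<open>\<open>U\<close> without its primal increment term, which vanishes in the limit. From
  index 1 on the remaining terms are nonnegative at a saddle point, so \<open>V\<close> tending to 0
  forces both distances to 0.\<close>

definition V :: "'a \<Rightarrow> 'b \<Rightarrow> int \<Rightarrow> real" where
  "V xs ys k = 1 / 2 * (norm (x k - xs))\<^sup>2 + 1 / (2 * t\<^sup>2) * (norm (y k - ys))\<^sup>2
     + \<gamma> k * (1 + rho k) * P xs ys (k - 1)"

lemma V_convergent:
  assumes s: "saddle xs ys"
  shows "convergent (\<lambda>n. V xs ys (int n))"
proof -
  let ?u = "\<lambda>n. U xs ys (int (Suc n))"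
  have "decseq ?u"
    using U_decseq[OF s, of "int (Suc n)" for n] by (intro decseq_SucI) (auto simp: add_ac)
  moreover have "0 \<le> ?u n" for n by (rule U_nonneg[OF s]) simp
  ultimately obtain l where l: "?u \<longlonglongrightarrow> l" using decseq_convergent[of ?u 0] by blast
  let ?w = "\<lambda>n. (1 - 4 * xi t \<gamma> \<eta> (int n) * (1 + \<epsilon>)) / 4 * (norm (x (int n) - x (int n - 1)))\<^sup>2"
  have "?w \<longlonglongrightarrow> 0"
  proof (rule tendsto_0_le[where K = 1])
    have "(\<lambda>n. norm (x (int n) - x (int n - 1)) ^ 2) \<longlonglongrightarrow> 0 ^ 2"
      using increments_tendsto(1)[OF s] by (intro tendsto_power tendsto_norm_zero)
    then show "(\<lambda>n. norm (x (int n) - x (int n - 1)) ^ 2) \<longlonglongrightarrow> 0" by simp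
    show "\<forall>\<^sub>F n in sequentially. norm (?w n) \<le> norm (norm (x (int n) - x (int n - 1)) ^ 2) * 1"
    proof (intro always_eventually allI)
      fix n
      define q where "q = 1 - 4 * xi t \<gamma> \<eta> (int n) * (1 + \<epsilon>)"
      have "0 \<le> q" "q \<le> 1" using U_coeff_bounds[of "int n"] by (simp_all add: q_def)
      then have "q / 4 * (norm (x (int n) - x (int n - 1)))\<^sup>2 \<le> 1 * (norm (x (int n) - x (int n - 1)))\<^sup>2"
        by (intro mult_right_mono) auto
      then show "norm (?w n) \<le> norm (norm (x (int n) - x (int n - 1)) ^ 2) * 1"
        using \<open>0 \<le> q\<close> by (simp add: abs_mult flip: q_def)
    qed
  qed
  then have "(\<lambda>n. ?u n - ?w (Suc n)) \<longlonglongrightarrow> l - 0" by (intro tendsto_diff l LIMSEQ_Suc)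
  moreover have "?u n - ?w (Suc n) = V xs ys (int (Suc n))" for n by (simp add: U_def V_def)
  ultimately have "(\<lambda>n. V xs ys (int (Suc n))) \<longlonglongrightarrow> l" by simp
  then have "(\<lambda>n. V xs ys (int n)) \<longlonglongrightarrow> l" by (rule LIMSEQ_imp_Suc)
  then show ?thesis by (rule convergentI)
qed

text \<open>Adding the four saddle inequalities of the two points gives an equality, so each is tight.\<close>

lemma saddle_interchange:
  assumes "saddle x1 y1" "saddle x2 y2"
  shows "saddle x1 y2" "P x1 y2 k = P x2 y2 k"
proof -
  have in_: "x1 \<in> D" "x2 \<in> D" "y1 \<in> E" "y2 \<in> E" using assms by (auto simp: saddle_def)
  have 1: "f x1 + G x1 \<le> f x2 + G x2 + (A x2 \<bullet> y1 - A x1 \<bullet> y1)"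
    using assms(1) in_ by (auto simp: saddle_def inner_adjoint A_diff inner_diff_left)
  have 2: "f x2 + G x2 \<le> f x1 + G x1 + (A x1 \<bullet> y2 - A x2 \<bullet> y2)"
    using assms(2) in_ by (auto simp: saddle_def inner_adjoint A_diff inner_diff_left)
  have 3: "H y1 \<le> H y2 + (A x1 \<bullet> y1 - A x1 \<bullet> y2)"
    using assms(1) in_ by (auto simp: saddle_def inner_diff_right)
  have 4: "H y2 \<le> H y1 + (A x2 \<bullet> y2 - A x2 \<bullet> y1)"
    using assms(2) in_ by (auto simp: saddle_def inner_diff_right)
  have eq: "f x2 + G x2 = f x1 + G x1 + (A x1 \<bullet> y2 - A x2 \<bullet> y2)" using 1 2 3 4 by linarith
  have eq': "H y1 = H y2 + (A x1 \<bullet> y1 - A x1 \<bullet> y2)" using 1 2 3 4 by linarith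
  show "P x1 y2 k = P x2 y2 k"
    using eq by (simp add: P_def inner_adjoint A_diff inner_diff_left)
  show "saddle x1 y2"
    unfolding saddle_def
  proof (intro conjI ballI in_)
    fix z assume "z \<in> D"
    then have "f x2 + G x2 \<le> f z + G z + (A z \<bullet> y2 - A x2 \<bullet> y2)"
      using assms(2) by (auto simp: saddle_def inner_adjoint A_diff inner_diff_left)
    then show "f x1 + G x1 \<le> f z + G z + (z - x1) \<bullet> adjoint A y2"
      using eq by (simp add: inner_adjoint A_diff inner_diff_left)
  next
    fix z assume "z \<in> E"
    then have "H y1 \<le> H z + (A x1 \<bullet> y1 - A x1 \<bullet> z)"
      using assms(1) by (auto simp: saddle_def inner_diff_right)
    then show "H y2 \<le> H z + A x1 \<bullet> (y2 - z)" using eq' by (simp add: inner_diff_right)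
  qed
qed

text \<open>For fixed \<open>xs\<close> the first saddle condition is affine in \<open>ys\<close>
  and the second inherits convexity from \<open>H\<close>. Convexity guarantees a relative interior
  point, which serves later as reference.\<close>

lemma convex_dual_saddle: "convex {ys. saddle xs ys}"
  unfolding convex_alt
proof (intro ballI allI impI, elim conjE)
  fix y1 y2 and s :: real
  assume y: "y1 \<in> {ys. saddle xs ys}" "y2 \<in> {ys. saddle xs ys}" and s: "0 \<le> s" "s \<le> 1"
  let ?y = "(1 - s) *\<^sub>R y1 + s *\<^sub>R y2"
  have in_: "xs \<in> D" "y1 \<in> E" "y2 \<in> E" using y by (auto simp: saddle_def)
  have comb: "a \<le> (1 - s) * b + s * c" if "a \<le> b" "a \<le> c" for a b c :: real
  proof -
    have "(1 - s) * a + s * a \<le> (1 - s) * b + s * c" using that s by (intro add_mono mult_left_mono) auto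
    then show ?thesis by (simp add: algebra_simps)
  qed
  have "saddle xs ?y"
    unfolding saddle_def
  proof (intro conjI ballI in_)
    show "?y \<in> E" using H_convex in_ s by (auto simp: convex_on_def convex_alt)
    fix z assume "z \<in> D"
    then have "f xs + G xs - (f z + G z) \<le> A (z - xs) \<bullet> y1" "f xs + G xs - (f z + G z) \<le> A (z - xs) \<bullet> y2"
      using y by (auto simp: saddle_def inner_adjoint algebra_simps)
    from comb[OF this] show "f xs + G xs \<le> f z + G z + (z - xs) \<bullet> adjoint A ?y"
      by (simp add: inner_adjoint inner_add_right)
  next
    fix z assume "z \<in> E"
    then have "H y1 + (A xs \<bullet> z - A xs \<bullet> y1) \<le> H z" "H y2 + (A xs \<bullet> z - A xs \<bullet> y2) \<le> H z"
      using y by (auto simp: saddle_def inner_diff_right algebra_simps)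
    then have "- H z \<le> - (H y1 + (A xs \<bullet> z - A xs \<bullet> y1))" "- H z \<le> - (H y2 + (A xs \<bullet> z - A xs \<bullet> y2))"
      by simp_all
    from comb[OF this]
    have "(1 - s) * H y1 + s * H y2 \<le> H z + (A xs \<bullet> ?y - A xs \<bullet> z)"
      by (simp add: inner_add_right algebra_simps)
    moreover have "H ?y \<le> (1 - s) * H y1 + s * H y2" using convex_onD[OF H_convex s in_(2,3)] .
    ultimately show "H ?y \<le> H z + A xs \<bullet> (?y - z)" by (simp add: inner_diff_right)
  qed
  then show "?y \<in> {ys. saddle xs ys}" by simp
qed

section \<open>Limit points of the iterates\<close>

lemma rho_bounded: obtains B where "\<And>k. k \<ge> 0 \<Longrightarrow> rho k \<le> B"
proof
  fix k :: int
  assume "k \<ge> 0"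
  \<comment> \<open>The value 2 makes the bound invariant under \<open>rho_growth\<close>:
    \<open>1 + B \<le> 2 * B \<le> B\<^sup>2\<close> holds once \<open>B \<ge> 2\<close>.\<close>
  then show "rho k \<le> max 2 (rho 0)"
  proof (induction k rule: int_ge_induct)
    case (step k)
    define B where "B = max 2 (rho 0)"
    have "(rho (k + 1))\<^sup>2 \<le> 1 + B" using rho_growth[of k] step by (simp add: B_def)
    also have "\<dots> \<le> 2 * B" by (simp add: B_def)
    also have "\<dots> \<le> B\<^sup>2" unfolding power2_eq_square by (intro mult_right_mono) (auto simp: B_def)
    finally have "rho (k + 1) \<le> B" by (rule power2_le_imp_le) (simp add: B_def)
    then show ?case by (simp add: B_def)
  qed simp
qed

text \<open>Each optimality inequality is read as membership in a closed epigraph of the pair formed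
  by the iterate and an upper bound for the function value there. Passing to the limit yields
  membership in the effective domain and the limiting inequality at once.\<close>

lemma subsequence_limit:
  assumes s: "saddle xs ys" and r: "strict_mono r"
    and xl: "(\<lambda>n. x (int (r n))) \<longlonglongrightarrow> xl" and yl: "(\<lambda>n. y (int (r n))) \<longlonglongrightarrow> yl"
  shows "xl \<in> D" "yl \<in> E"
    and "z \<in> D \<Longrightarrow> G xl + (- gradient f xl - adjoint A yl) \<bullet> (z - xl) \<le> G z"
    and "v \<in> E \<Longrightarrow> H yl + A xl \<bullet> (v - yl) \<le> H v"
    and "saddle xl yl"
proof -
  obtain c where c: "c > 0" "\<And>k. k \<ge> 0 \<Longrightarrow> c \<le> \<gamma> k" using gamma_bounded_below[OF s] by blast
  obtain B where B: "\<And>k. k \<ge> 0 \<Longrightarrow> rho k \<le> B" using rho_bounded by blast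
  define k where "k n = int (r n)" for n
  have k0: "k n \<ge> 0" for n by (simp add: k_def)
  have dx: "(\<lambda>n. x (k n) - x (k n - 1)) \<longlonglongrightarrow> 0"
    using LIMSEQ_subseq_LIMSEQ[OF increments_tendsto(1)[OF s] r] by (simp add: o_def k_def)
  have dy: "(\<lambda>n. y (k n + 1) - y (k n)) \<longlonglongrightarrow> 0"
    using LIMSEQ_subseq_LIMSEQ[OF increments_tendsto(2)[OF s] r] by (simp add: o_def k_def)
  have x0: "(\<lambda>n. x (k n)) \<longlonglongrightarrow> xl" and y0: "(\<lambda>n. y (k n)) \<longlonglongrightarrow> yl" using xl yl by (simp_all add: k_def)
  \<comment> \<open>The optimality conditions mix the indices \<open>k - 1\<close>, \<open>k\<close>
    and \<open>k + 1\<close>; vanishing increments give all of them the same limit.\<close>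
  have x1: "(\<lambda>n. x (k n - 1)) \<longlonglongrightarrow> xl" using tendsto_diff[OF x0 dx] by simp
  have y1: "(\<lambda>n. y (k n + 1)) \<longlonglongrightarrow> yl" using tendsto_add[OF y0 dy] by simp
  have div: "(\<lambda>n. (1 / e n) *\<^sub>R w n) \<longlonglongrightarrow> 0" if "w \<longlonglongrightarrow> 0" "\<And>n. b \<le> e n" "b > 0"
    for w :: "nat \<Rightarrow> 'c::real_normed_vector" and e b
  proof (rule tendsto_0_le[OF that(1), where K = "1 / b"], intro always_eventually allI)
    fix n
    have "0 < e n" using that(2)[of n] that(3) by linarith
    then have "1 / e n \<le> 1 / b" using that(2)[of n] that(3) by (intro divide_left_mono) auto
    then have "norm (w n) * (1 / e n) \<le> norm (w n) * (1 / b)" by (rule mult_left_mono) simp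
    then show "norm ((1 / e n) *\<^sub>R w n) \<le> norm (w n) * (1 / b)" using \<open>0 < e n\<close> by simp
  qed
  have "(\<lambda>n. x (k n - 1) - x (k n)) \<longlonglongrightarrow> 0" using tendsto_minus[OF dx] by simp
  then have gx: "(\<lambda>n. (1 / \<gamma> (k n)) *\<^sub>R (x (k n - 1) - x (k n))) \<longlonglongrightarrow> 0"
    using c k0 by (intro div[OF _ _ c(1)]) auto
  have grad: "(\<lambda>n. gradient f (x (k n - 1))) \<longlonglongrightarrow> gradient f xl"
    by (rule isCont_tendsto_compose[OF isCont_gradient[OF f_lip] x1])
  have cl: "xl \<in> D \<and> G xl \<le> G z - (0 - gradient f xl - adjoint A yl) \<bullet> (z - xl)" if "z \<in> D" for z
  proof -
    let ?r = "\<lambda>n. G z - ((1 / \<gamma> (k n)) *\<^sub>R (x (k n - 1) - x (k n)) - gradient f (x (k n - 1))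
        - adjoint A (y (k n))) \<bullet> (z - x (k n))"
    have m: "(\<lambda>n. (x (k n), ?r n)) \<longlonglongrightarrow> (xl, G z - (0 - gradient f xl - adjoint A yl) \<bullet> (z - xl))"
      by (intro tendsto_intros x0 gx grad tendsto_adjoint[OF y0])
    have "(x (k n), ?r n) \<in> {(z, r). z \<in> D \<and> G z \<le> r}" for n
      using x_in[OF k0] G_sub[OF k0 \<open>z \<in> D\<close>, of n] by (simp add: algebra_simps)
    from closed_sequentially[OF G_closed this m] have "(xl, G z - (0 - gradient f xl - adjoint A yl) \<bullet> (z - xl)) \<in> {(z, r). z \<in> D \<and> G z \<le> r}"
      .
    then show ?thesis by simp
  qed
  have "(\<lambda>n. y (k n) - y (k n + 1)) \<longlonglongrightarrow> 0" using tendsto_minus[OF dy] by simp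
  then have gy: "(\<lambda>n. (1 / (t\<^sup>2 * \<gamma> (k n + 1))) *\<^sub>R (y (k n) - y (k n + 1))) \<longlonglongrightarrow> 0"
  proof (rule div)
    show "0 < t\<^sup>2 * c" using c t_pos by simp
    show "t\<^sup>2 * c \<le> t\<^sup>2 * \<gamma> (k n + 1)" for n using c(2)[of "k n + 1"] k0[of n] by (intro mult_left_mono) auto
  qed
  \<comment> \<open>The extrapolation term vanishes because the step ratios are bounded, even if the
    stepsizes are not.\<close>
  have Adx: "(\<lambda>n. (\<gamma> (k n + 1) / \<gamma> (k n)) *\<^sub>R A (x (k n) - x (k n - 1))) \<longlonglongrightarrow> 0"
  proof (rule tendsto_0_le[where K = B], use tendsto_A[OF dx] linear_0[OF A_linear] in simp, intro always_eventually allI)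
    fix n
    have "\<bar>\<gamma> (k n + 1) / \<gamma> (k n)\<bar> \<le> B"
      using B[of "k n + 1"] gamma_pos[of "k n"] gamma_pos[of "k n + 1"] k0[of n] by simp
    then have "norm (A (x (k n) - x (k n - 1))) * \<bar>\<gamma> (k n + 1) / \<gamma> (k n)\<bar> \<le> norm (A (x (k n) - x (k n - 1))) * B"
      by (rule mult_left_mono) simp
    then show "norm ((\<gamma> (k n + 1) / \<gamma> (k n)) *\<^sub>R A (x (k n) - x (k n - 1))) \<le> norm (A (x (k n) - x (k n - 1))) * B"
      by (simp add: mult.commute)
  qed
  have cl': "yl \<in> E \<and> H yl \<le> H v - (0 + A xl + 0) \<bullet> (v - yl)" if "v \<in> E" for v
  proof -
    let ?r = "\<lambda>n. H v - ((1 / (t\<^sup>2 * \<gamma> (k n + 1))) *\<^sub>R (y (k n) - y (k n + 1)) + A (x (k n))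
        + (\<gamma> (k n + 1) / \<gamma> (k n)) *\<^sub>R A (x (k n) - x (k n - 1))) \<bullet> (v - y (k n + 1))"
    have m: "(\<lambda>n. (y (k n + 1), ?r n)) \<longlonglongrightarrow> (yl, H v - (0 + A xl + 0) \<bullet> (v - yl))"
      by (intro tendsto_intros y1 gy Adx tendsto_A[OF x0])
    have "(y (k n + 1), ?r n) \<in> {(z, r). z \<in> E \<and> H z \<le> r}" for n
      using y_in[OF k0] H_sub[OF k0 \<open>v \<in> E\<close>, of n] by (simp add: algebra_simps)
    from closed_sequentially[OF H_closed this m] have "(yl, H v - (0 + A xl + 0) \<bullet> (v - yl)) \<in> {(z, r). z \<in> E \<and> H z \<le> r}"
      .
    then show ?thesis by simp
  qed
  show xD: "xl \<in> D" and yE: "yl \<in> E" using cl[of xs] cl'[of ys] s by (auto simp: saddle_def)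
  show G: "G xl + (- gradient f xl - adjoint A yl) \<bullet> (z - xl) \<le> G z" if "z \<in> D" for z
    using cl[OF that] by simp
  show H: "H yl + A xl \<bullet> (v - yl) \<le> H v" if "v \<in> E" for v using cl'[OF that] by simp
  show "saddle xl yl"
    unfolding saddle_def
  proof (intro conjI ballI xD yE)
    fix z assume "z \<in> D"
    from G[OF this] gradient_ineq[of xl z]
    show "f xl + G xl \<le> f z + G z + (z - xl) \<bullet> adjoint A yl"
      by (simp add: inner_diff_left inner_commute[of _ "adjoint A yl"])
  next
    fix v assume "v \<in> E"
    from H[OF this] show "H yl \<le> H v + A xl \<bullet> (yl - v)" by (simp add: inner_diff_right)
  qed
qed

text \<open>The number \<open>n\<close> stands for iteration \<open>n + 1\<close>, so that 0 is the
  first iteration of the descent. Division by \<open>1 + rho\<close> turns the gap loss into the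
  slack times the weighted gap in \<open>U\<close>.\<close>

definition slack :: "nat \<Rightarrow> real" where
  "slack n = 1 - (rho (int n + 1 + 1))\<^sup>2 / (1 + rho (int n + 1))"

lemma slack_nonneg: "0 \<le> slack n"
  and slack_mult: "(1 + rho (int n + 1)) * slack n = 1 + rho (int n + 1) - (rho (int n + 1 + 1))\<^sup>2"
proof -
  have r: "0 < rho (int n + 1)" by (rule rho_pos) simp
  have "(rho (int n + 1 + 1))\<^sup>2 \<le> 1 + rho (int n + 1)" by (rule rho_growth) simp
  then show "0 \<le> slack n" unfolding slack_def using r by (simp add: divide_le_eq_1 add_pos_pos del: add_diff_cancel_right')
  have "(1 + z) * (1 - w / (1 + z)) = 1 + z - w" if "0 < z" for z w :: real
    using that by (simp add: field_simps)
  then show "(1 + rho (int n + 1)) * slack n = 1 + rho (int n + 1) - (rho (int n + 1 + 1))\<^sup>2"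
    unfolding slack_def using r by blast
qed

text \<open>
  Vanishing slack means that \<open>rho (k + 1) = sqrt (1 + rho k)\<close> asymptotically, and this recursion
  is attracted by the golden ratio.
\<close>

lemma gamma_geometric:
  assumes "slack \<longlonglongrightarrow> 0"
  obtains K where "\<And>n. (11/10) ^ n * \<gamma> (int K) \<le> \<gamma> (int (K + n))"
proof -
  \<comment> \<open>With slack below 1/4, the square of the next ratio is at least 3/4 of
    \<open>1 + rho\<close>. As \<open>rho\<close> is positive and 0.64 is below 0.75, the next ratio
    is at least 4/5; since 1.21 is below 0.75 * 1.8 = 1.35, the one after it is at least
    11/10.\<close>
  have "\<forall>\<^sub>F n in sequentially. slack n < 1/4" using assms by (rule order_tendstoD) simp
  then obtain N where N: "\<And>n. n \<ge> N \<Longrightarrow> slack n < 1/4" unfolding eventually_sequentially by blast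
  have step: "3/4 * (1 + rho (int n + 1)) \<le> (rho (int n + 1 + 1))\<^sup>2" if "n \<ge> N" for n
  proof -
    have r: "0 < rho (int n + 1)" by (rule rho_pos) simp
    have "(1 + rho (int n + 1)) * slack n \<le> (1 + rho (int n + 1)) * (1/4)"
      using N[OF that] r by (intro mult_left_mono) (auto intro: add_nonneg_nonneg)
    moreover have "1 + a - b \<le> (1 + a) * (1/4) \<Longrightarrow> 3/4 * (1 + a) \<le> b" for a b :: real
      by (simp add: field_simps)
    ultimately show ?thesis unfolding slack_mult by blast
  qed
  have r1: "4/5 \<le> rho (int n + 1 + 1)" if "n \<ge> N" for n
  proof (rule power2_le_imp_le)
    have "0 < rho (int n + 1)" by (rule rho_pos) simp
    moreover have "(4/5)\<^sup>2 \<le> 3/4 * (1 + a)" if "0 < a" for a :: real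
      using that by (simp add: power2_eq_square field_simps)
    ultimately show "(4/5)\<^sup>2 \<le> (rho (int n + 1 + 1))\<^sup>2"
      using step[OF that] order_trans by blast
    show "0 \<le> rho (int n + 1 + 1)" using rho_pos[of "int n + 1 + 1"] by simp
  qed
  have r2: "11/10 \<le> rho (int n + 1 + 1 + 1)" if "n \<ge> N" for n
  proof (rule power2_le_imp_le)
    have "3/4 * (1 + rho (int n + 1 + 1)) \<le> (rho (int n + 1 + 1 + 1))\<^sup>2"
      using step[of "Suc n"] that by (simp add: add_ac)
    moreover have "(11/10)\<^sup>2 \<le> 3/4 * (1 + a)" if "4/5 \<le> a" for a :: real
      using that by (simp add: power2_eq_square field_simps)
    ultimately show "(11/10)\<^sup>2 \<le> (rho (int n + 1 + 1 + 1))\<^sup>2"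
      using r1[OF that] order_trans by blast
    show "0 \<le> rho (int n + 1 + 1 + 1)" using rho_pos[of "int n + 1 + 1 + 1"] by simp
  qed
  show thesis
  proof (rule that[of "N + 2"])
    fix n
    show "(11/10) ^ n * \<gamma> (int (N + 2)) \<le> \<gamma> (int (N + 2 + n))"
    proof (induction n)
      case (Suc n)
      have g: "0 < \<gamma> (int (N + 2 + n))" by (rule gamma_pos) simp
      have "11/10 \<le> \<gamma> (int (N + 2 + Suc n)) / \<gamma> (int (N + 2 + n))"
        using r2[of "N + n"] by (simp add: add_ac)
      then have "11/10 * \<gamma> (int (N + 2 + n)) \<le> \<gamma> (int (N + 2 + Suc n))"
        using g by (simp add: field_simps)
      with Suc show ?case by simp
    qed simp
  qed
qed

text \<open>By \<open>eta_gamma\<close>, geometric growth of the stepsizes becomes geometric decay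
  of \<open>\<eta>\<close>. As the dual iterates are bounded, the acceptance test then dominates the
  increments of \<open>adjoint A (y k)\<close> by a convergent geometric series.\<close>

lemma adjoint_dual_convergent:
  assumes s: "saddle xs ys" and "slack \<longlonglongrightarrow> 0"
  shows "convergent (\<lambda>n. adjoint A (y (int n)))"
proof -
  obtain K where K: "\<And>n. (11/10) ^ n * \<gamma> (int K) \<le> \<gamma> (int (K + n))"
    using gamma_geometric[OF assms(2)] by blast
  obtain R where R: "\<And>k. k \<ge> 0 \<Longrightarrow> norm (y k) \<le> R" using bounded_iterates[OF s] by blast
  have nt: "0 < 2 * \<nu> * t" using nu_gt eps_pos t_pos by simp
  have gK: "0 < \<gamma> (int K)" by (rule gamma_pos) simp
  have R0: "0 \<le> R" using R[of 0] norm_ge_zero[of "y 0"] by linarith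
  define C where "C = 1 / (2 * \<nu> * t * \<gamma> (int K)) * (2 * R)"
  have C0: "0 \<le> C" using nu_gt eps_pos t_pos gK R0 by (simp add: C_def)
  define w where "w n = adjoint A (y (int (K + n)))" for n
  have eta: "\<eta> (int (K + n)) \<le> 1 / (2 * \<nu> * t * \<gamma> (int K)) * (10/11) ^ n" for n
  proof -
    have e0: "0 \<le> \<eta> (int (K + n))" by (rule eta_nonneg) simp
    have "\<eta> (int (K + n)) * (2 * \<nu> * t * ((11/10) ^ n * \<gamma> (int K)))
        \<le> \<eta> (int (K + n)) * (2 * \<nu> * t * \<gamma> (int (K + n)))"
      using K[of n] nt e0 by (intro mult_left_mono) auto
    also have "\<dots> \<le> 1" using eta_gamma[of "int (K + n)"] by (simp add: mult_ac)
    finally have "\<eta> (int (K + n)) \<le> 1 / (2 * \<nu> * t * ((11/10) ^ n * \<gamma> (int K)))"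
      using nt gK by (subst pos_le_divide_eq) auto
    also have "\<dots> = 1 / (2 * \<nu> * t * \<gamma> (int K)) * (10/11) ^ n"
      by (simp add: power_divide field_simps)
    finally show ?thesis .
  qed
  have "norm (w (Suc n) - w n) \<le> C * (10/11) ^ n" for n
  proof -
    have k: "int (K + Suc n) = int (K + n) + 1" by simp
    have "norm (y (int (K + n) + 1) - y (int (K + n))) \<le> R + R"
      by (rule norm_triangle_le_diff) (intro add_mono R; simp)
    then have "norm (w (Suc n) - w n) \<le> \<eta> (int (K + Suc n)) * (2 * R)"
      using backtrack[of "int (K + n)"] eta_nonneg[of "int (K + Suc n)"]
      unfolding w_def k adjoint_diff[symmetric]
      by (intro order_trans[OF backtrack mult_left_mono]) auto
    also have "\<dots> \<le> 1 / (2 * \<nu> * t * \<gamma> (int K)) * (10/11) ^ Suc n * (2 * R)"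
      using R0 by (intro mult_right_mono eta) auto
    also have "\<dots> = (C * (10/11) ^ n) * (10/11)" by (simp add: C_def)
    also have "\<dots> \<le> (C * (10/11) ^ n) * 1" using C0 by (intro mult_left_mono) auto
    finally show ?thesis by simp
  qed
  moreover have "summable (\<lambda>n. C * (10/11) ^ n)" by (intro summable_mult summable_geometric) simp
  ultimately have "summable (\<lambda>n. w (Suc n) - w n)"
    by (rule summable_comparison_test'[where N = 0, rotated])
  then have "(\<lambda>n. \<Sum>i<n. w (Suc i) - w i) \<longlonglongrightarrow> (\<Sum>n. w (Suc n) - w n)" by (rule summable_LIMSEQ)
  then have "(\<lambda>n. w n - w 0 + w 0) \<longlonglongrightarrow> (\<Sum>n. w (Suc n) - w n) + w 0"
    unfolding sum_lessThan_telescope by (intro tendsto_add tendsto_const)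
  then have "w \<longlonglongrightarrow> (\<Sum>n. w (Suc n) - w n) + w 0" by simp
  then have "(\<lambda>n. adjoint A (y (int (n + K)))) \<longlonglongrightarrow> (\<Sum>n. w (Suc n) - w n) + w 0"
    by (simp add: w_def[abs_def] add.commute)
  then have "(\<lambda>n. adjoint A (y (int n))) \<longlonglongrightarrow> (\<Sum>n. w (Suc n) - w n) + w 0" by (rule LIMSEQ_offset)
  then show ?thesis by (rule convergentI)
qed

text \<open>If the weighted gap stayed above \<open>c\<close>, the gap loss would be at least
  \<open>c\<close> times the slack, and its summability would carry over to the slacks.\<close>

lemma weighted_gap_small:
  assumes s: "saddle xs ys" and ns: "\<not> summable slack" and "c > 0"
  shows "\<exists>n\<ge>N. \<gamma> (int n) * (1 + rho (int n)) * P xs ys (int n - 1) < c"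
proof (rule ccontr)
  assume "\<not> ?thesis"
  then have ge: "c \<le> \<gamma> (int n) * (1 + rho (int n)) * P xs ys (int n - 1)" if "n \<ge> N" for n
    using that by (meson not_less)
  define b where "b n = \<gamma> (int n + 1) * (1 + rho (int n + 1) - (rho (int n + 1 + 1))\<^sup>2) * P xs ys (int n)" for n
  have "summable (\<lambda>n. 1 / c * b n)"
    using increments_tendsto(4)[OF s] by (intro summable_mult) (simp add: b_def)
  moreover have "norm (slack n) \<le> 1 / c * b n" if "n \<ge> N" for n
  proof -
    have "c * slack n \<le> (\<gamma> (int n + 1) * (1 + rho (int n + 1)) * P xs ys (int n)) * slack n"
      using ge[of "Suc n"] that by (intro mult_right_mono slack_nonneg) (simp add: add_ac)
    also have "\<dots> = \<gamma> (int n + 1) * ((1 + rho (int n + 1)) * slack n) * P xs ys (int n)" by simp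
    also have "\<dots> = b n" unfolding slack_mult b_def ..
    finally show ?thesis using \<open>c > 0\<close> slack_nonneg[of n] by (simp add: field_simps)
  qed
  ultimately have "summable slack" by (rule summable_comparison_test'[where N = N])
  with ns show False by simp
qed

text \<open>With summable slacks the weighted gap is merely bounded, by \<open>U xs ys 1\<close>,
  but its weight grows geometrically. Otherwise the weighted gap itself is small at arbitrarily late
  indices, and its weight is bounded below.\<close>

lemma P_small:
  assumes s: "saddle xs ys" and "c > 0"
  shows "\<exists>n\<ge>N. P xs ys (int n) < c"
proof (cases "summable slack")
  case True
  then obtain K where K: "\<And>n. (11/10) ^ n * \<gamma> (int K) \<le> \<gamma> (int (K + n))"
    using gamma_geometric[OF summable_LIMSEQ_zero] by blast
  have gK: "0 < \<gamma> (int K)" by (rule gamma_pos) simp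
  obtain n where n: "U xs ys 1 / (c * \<gamma> (int K)) < (11/10) ^ n"
    using real_arch_pow[of "11/10"] by auto
  define m where "m = Suc n + N"
  define g p where "g = \<gamma> (int (K + m))" and "p = P xs ys (int (K + m) - 1)"
  have "U xs ys 1 < c * ((11/10) ^ n * \<gamma> (int K))" using n gK \<open>c > 0\<close> by (simp add: field_simps)
  also have "\<dots> \<le> c * ((11/10) ^ m * \<gamma> (int K))"
    using gK \<open>c > 0\<close> by (intro mult_left_mono mult_right_mono power_increasing) (auto simp: m_def)
  also have "\<dots> \<le> c * g" using K[of m] \<open>c > 0\<close> by (simp add: g_def)
  finally have big: "U xs ys 1 < c * g" .
  have k: "int (K + m) \<ge> 1" by (simp add: m_def)
  have p0: "0 \<le> p" unfolding p_def using k by (intro P_nonneg[OF s]) simp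
  have g0: "0 < g" unfolding g_def by (rule gamma_pos) simp
  have r0: "0 < rho (int (K + m))" using k by (intro rho_pos) simp
  have nn: "0 \<le> 1 / 2 * (norm (x (int (K + m)) - xs))\<^sup>2 + 1 / (2 * t\<^sup>2) * (norm (y (int (K + m)) - ys))\<^sup>2" by simp
  have "g * 1 * p \<le> g * (1 + rho (int (K + m))) * p"
    using g0 p0 r0 by (intro mult_right_mono mult_left_mono) auto
  also have "\<dots> \<le> U xs ys 1" using U_ge[OF s k] U_le_U1[OF s k] nn unfolding g_def p_def by linarith
  finally have "g * p < g * c" using big by (simp add: mult.commute)
  then have "p < c" using g0 by simp
  then show ?thesis
    by (intro exI[of _ "K + n + N"]) (auto simp: p_def m_def add_ac)
next
  case False
  obtain b where b: "b > 0" "\<And>k. k \<ge> 0 \<Longrightarrow> b \<le> \<gamma> k" using gamma_bounded_below[OF s] by blast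
  have "b * c > 0" using b \<open>c > 0\<close> by simp
  from weighted_gap_small[OF s False this, of "Suc N"] obtain n where
    n: "n \<ge> Suc N" "\<gamma> (int n) * (1 + rho (int n)) * P xs ys (int n - 1) < b * c" by blast
  have p0: "0 \<le> P xs ys (int n - 1)" using n by (intro P_nonneg[OF s]) simp
  have "b * 1 * P xs ys (int n - 1) \<le> \<gamma> (int n) * (1 + rho (int n)) * P xs ys (int n - 1)"
    using p0 b rho_pos[of "int n"] gamma_pos[of "int n"] by (intro mult_right_mono mult_mono) auto
  with n have "b * P xs ys (int n - 1) < b * c" by linarith
  then have "P xs ys (int (n - 1)) < c" using b n by (simp add: of_nat_diff)
  then show ?thesis using n by (intro exI[of _ "n - 1"]) simp
qed

section \<open>Convergence of the whole sequence\<close>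

lemma bounded_range_iterates:
  assumes "saddle xs ys"
  shows "bounded (range (\<lambda>n. (x (int n), y (int n))))"
proof -
  obtain R where R: "\<And>k. k \<ge> -1 \<Longrightarrow> norm (x k) \<le> R" "\<And>k. k \<ge> 0 \<Longrightarrow> norm (y k) \<le> R"
    using bounded_iterates[OF assms] by blast
  have "range (\<lambda>n. (x (int n), y (int n))) \<subseteq> cball 0 R \<times> cball 0 R" using R by auto
  then show ?thesis by (rule bounded_subset[rotated]) (intro bounded_Times bounded_cball)
qed

lemma convergent_subsequence:
  fixes r :: "nat \<Rightarrow> nat"
  assumes "saddle xs ys"
  obtains q xl yl where "strict_mono q" "(\<lambda>n. x (int (r (q n)))) \<longlonglongrightarrow> xl" "(\<lambda>n. y (int (r (q n)))) \<longlonglongrightarrow> yl"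
proof -
  have "bounded (range ((\<lambda>n. (x (int n), y (int n))) \<circ> r))"
    using bounded_range_iterates[OF assms] by (rule bounded_subset) auto
  then obtain l q where "strict_mono q" "((\<lambda>n. (x (int n), y (int n))) \<circ> r \<circ> q) \<longlonglongrightarrow> l"
    using bounded_imp_convergent_subsequence by blast
  then have q: "strict_mono q" "(\<lambda>n. (x (int (r (q n))), y (int (r (q n))))) \<longlonglongrightarrow> l" by (simp_all add: o_def)
  show thesis
    using that[OF q(1)] tendsto_fst[OF q(2)] tendsto_snd[OF q(2)] by simp
qed

text \<open>\<open>V\<close> converges along the full sequence, so one vanishing subsequence fixes
  its limit as 0.\<close>

lemma convergent_of_V_subseq:
  assumes s: "saddle xl yl" and r: "strict_mono r"
    and V: "(\<lambda>n. V xl yl (int (r n))) \<longlonglongrightarrow> 0"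
  shows "(\<lambda>n. x (int n)) \<longlonglongrightarrow> xl" "(\<lambda>n. y (int n)) \<longlonglongrightarrow> yl"
proof -
  obtain l where l: "(\<lambda>n. V xl yl (int n)) \<longlonglongrightarrow> l" using V_convergent[OF s] by (auto simp: convergent_def)
  have "l = 0" using LIMSEQ_unique[OF LIMSEQ_subseq_LIMSEQ[OF l r]] V by (simp add: o_def)
  then have V0: "(\<lambda>n. V xl yl (int (Suc n))) \<longlonglongrightarrow> 0" using LIMSEQ_Suc[OF l] by simp
  have ge: "1 / 2 * (norm (x (int (Suc n)) - xl))\<^sup>2 \<le> V xl yl (int (Suc n))"
      "1 / (2 * t\<^sup>2) * (norm (y (int (Suc n)) - yl))\<^sup>2 \<le> V xl yl (int (Suc n))" for n
  proof -
    have "0 \<le> \<gamma> (int (Suc n)) * (1 + rho (int (Suc n))) * P xl yl (int (Suc n) - 1)"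
      by (rule U_ge(2)[OF s]) simp
    moreover have "0 \<le> 1 / 2 * (norm (x (int (Suc n)) - xl))\<^sup>2" "0 \<le> 1 / (2 * t\<^sup>2) * (norm (y (int (Suc n)) - yl))\<^sup>2"
      by simp_all
    ultimately show "1 / 2 * (norm (x (int (Suc n)) - xl))\<^sup>2 \<le> V xl yl (int (Suc n))"
      "1 / (2 * t\<^sup>2) * (norm (y (int (Suc n)) - yl))\<^sup>2 \<le> V xl yl (int (Suc n))"
      unfolding V_def by linarith+
  qed
  have sq: "(\<lambda>n. v (Suc n)) \<longlonglongrightarrow> 0" if "\<And>n. c * (norm (v (Suc n)))\<^sup>2 \<le> V xl yl (int (Suc n))" "c > 0"
    for c :: real and v :: "nat \<Rightarrow> 'c::real_normed_vector"
  proof -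
    have "(\<lambda>n. (norm (v (Suc n)))\<^sup>2) \<longlonglongrightarrow> 0"
    proof (rule tendsto_0_le[OF V0, where K = "1 / c"], intro always_eventually allI)
      fix n
      show "norm ((norm (v (Suc n)))\<^sup>2) \<le> norm (V xl yl (int (Suc n))) * (1 / c)"
        using that(1)[of n] \<open>c > 0\<close> by (simp add: field_simps)
    qed
    then have "(\<lambda>n. norm (v (Suc n))) \<longlonglongrightarrow> 0" by (simp add: power_tendsto_0_iff)
    then show ?thesis by (simp add: tendsto_norm_zero_iff)
  qed
  have "(\<lambda>n. x (int (Suc n)) - xl) \<longlonglongrightarrow> 0" by (rule sq[of "1 / 2" "\<lambda>n. x (int n) - xl"]) (use ge in auto)
  then show "(\<lambda>n. x (int n)) \<longlonglongrightarrow> xl"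
    by (rule LIMSEQ_imp_Suc[OF LIM_zero_cancel])
  have "(\<lambda>n. y (int (Suc n)) - yl) \<longlonglongrightarrow> 0"
    by (rule sq[of "1 / (2 * t\<^sup>2)" "\<lambda>n. y (int n) - yl"]) (use ge t_pos in auto)
  then show "(\<lambda>n. y (int n)) \<longlonglongrightarrow> yl"
    by (rule LIMSEQ_imp_Suc[OF LIM_zero_cancel])
qed

text \<open>
  \<open>P xs ys\<close> is affine in \<open>ys\<close> and nonnegative on the set of dual saddle points, so smallness at a
  relative interior point of that set spreads to all of it.
\<close>

lemma converges_if_slack_not_summable:
  assumes s: "saddle xs ys" and ns: "\<not> summable slack"
  obtains xl yl where "saddle xl yl" "(\<lambda>n. x (int n)) \<longlonglongrightarrow> xl" "(\<lambda>n. y (int n)) \<longlonglongrightarrow> yl"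
proof -
  let ?Y = "{yy. saddle xs yy}"
  have ne: "?Y \<noteq> {}" using s by blast
  then have "rel_interior ?Y \<noteq> {}" using rel_interior_eq_empty[OF convex_dual_saddle] by blast
  then obtain y0 where y0: "y0 \<in> rel_interior ?Y" by blast
  then have s0: "saddle xs y0" using rel_interior_subset by blast
  define M where "M n = \<gamma> (int n) * (1 + rho (int n))" for n
  define a where "a n = M (Suc n) * P xs y0 (int n)" for n
  have M0: "0 \<le> M (Suc n)" for n
    using gamma_pos[of "int (Suc n)"] rho_pos[of "int (Suc n)"] by (simp add: M_def)
  have a0: "0 \<le> a n" for n using M0 P_nonneg[OF s0] by (simp add: a_def)
  have "\<exists>n\<ge>N. \<bar>a n\<bar> < c" if c: "c > 0" for c N
  proof -
    obtain n where n: "n \<ge> Suc N" "M n * P xs y0 (int n - 1) < c"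
      using weighted_gap_small[OF s0 ns c, of "Suc N"] by (auto simp: M_def)
    then show ?thesis using a0[of "n - 1"]
      by (intro exI[of _ "n - 1"]) (auto simp: a_def of_nat_diff)
  qed
  then obtain r where r: "strict_mono r" "(\<lambda>n. a (r n)) \<longlonglongrightarrow> 0" using subseq_tendsto_zeroE by blast
  obtain q xl yl where q: "strict_mono q" "(\<lambda>n. x (int (Suc (r (q n))))) \<longlonglongrightarrow> xl"
      "(\<lambda>n. y (int (Suc (r (q n))))) \<longlonglongrightarrow> yl"
    using convergent_subsequence[OF s, of "\<lambda>n. Suc (r n)"] by blast
  define p where "p n = Suc (r (q n))" for n
  have p: "strict_mono p" using r(1) q(1) by (simp add: p_def strict_mono_def)
  have lim: "(\<lambda>n. x (int (p n))) \<longlonglongrightarrow> xl" "(\<lambda>n. y (int (p n))) \<longlonglongrightarrow> yl" using q by (simp_all add: p_def)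
  have sl: "saddle xl yl" by (rule subsequence_limit(5)[OF s p lim])
  \<comment> \<open>Exchanging the primal component does not alter the gap, so the limit pair and
    the reference pair are compared through their dual components alone.\<close>
  have syl: "saddle xs yl" and Pl: "P xl yl k = P xs yl k" for k
    using saddle_interchange[OF s sl] by auto
  \<comment> \<open>The segment from \<open>yl\<close> to \<open>y0\<close> can be prolonged beyond
    \<open>y0\<close> inside the set. Since the gap is nonnegative at the prolonged point and affine
    in between, its value at \<open>yl\<close> is at most \<open>e / (e - 1)\<close> times its value
    at \<open>y0\<close>.\<close>
  obtain e where e: "e > 1" "(1 - e) *\<^sub>R yl + e *\<^sub>R y0 \<in> ?Y"
    using y0 syl convex_rel_interior_iff[OF convex_dual_saddle ne] by blast
  have Ple: "P xs yl k \<le> e / (e - 1) * P xs y0 k" if "k \<ge> 0" for k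
  proof -
    have "0 \<le> P xs ((1 - e) *\<^sub>R yl + e *\<^sub>R y0) k" using e P_nonneg that by simp
    also have "\<dots> = (1 - e) * P xs yl k + e * P xs y0 k"
      by (simp add: P_def inner_adjoint inner_add_right algebra_simps)
    finally show ?thesis using e(1) by (simp add: field_simps)
  qed
  have "(\<lambda>n. a (r (q n))) \<longlonglongrightarrow> 0" using LIMSEQ_subseq_LIMSEQ[OF r(2) q(1)] by (simp add: o_def)
  then have "(\<lambda>n. M (p n) * P xl yl (int (p n) - 1)) \<longlonglongrightarrow> 0"
  proof (rule tendsto_0_le[where K = "e / (e - 1)"], intro always_eventually allI)
    fix n
    let ?m = "r (q n)"
    have "M (Suc ?m) * P xl yl (int ?m) \<le> M (Suc ?m) * (e / (e - 1) * P xs y0 (int ?m))"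
      unfolding Pl using M0 by (intro mult_left_mono Ple) auto
    moreover have "0 \<le> M (Suc ?m) * P xl yl (int ?m)" using M0 P_nonneg[OF sl] by simp
    ultimately show "norm (M (p n) * P xl yl (int (p n) - 1)) \<le> norm (a (r (q n))) * (e / (e - 1))"
      using a0[of ?m] by (simp add: p_def a_def mult_ac)
  qed
  then have "(\<lambda>n. 1 / 2 * (norm (x (int (p n)) - xl))\<^sup>2 + 1 / (2 * t\<^sup>2) * (norm (y (int (p n)) - yl))\<^sup>2
      + M (p n) * P xl yl (int (p n) - 1)) \<longlonglongrightarrow>
      1 / 2 * (norm (xl - xl))\<^sup>2 + 1 / (2 * t\<^sup>2) * (norm (yl - yl))\<^sup>2 + 0"
    by (intro tendsto_intros lim)
  then have "(\<lambda>n. V xl yl (int (p n))) \<longlonglongrightarrow> 0" by (simp add: V_def M_def)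
  from convergent_of_V_subseq[OF sl p this] sl show thesis using that by blast
qed

text \<open>
  Here the stepsizes may be unbounded, but all limit points share the same value of
  \<open>adjoint A\<close> in the dual component, so the unbounded terms of the Lyapunov functions cancel.
\<close>

lemma converges_if_slack_summable:
  assumes s: "saddle xs ys" and "summable slack"
  obtains xl yl where "saddle xl yl" "(\<lambda>n. x (int n)) \<longlonglongrightarrow> xl" "(\<lambda>n. y (int n)) \<longlonglongrightarrow> yl"
proof -
  let ?z = "\<lambda>n. (x (int n), y (int n))"
  obtain w where w: "(\<lambda>n. adjoint A (y (int n))) \<longlonglongrightarrow> w"
    using adjoint_dual_convergent[OF s summable_LIMSEQ_zero[OF assms(2)]] by (auto simp: convergent_def)
  have adj: "adjoint A b = w" if "strict_mono q" "(\<lambda>n. y (int (q n))) \<longlonglongrightarrow> b" for q b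
  proof -
    have "(\<lambda>n. adjoint A (y (int (q n)))) \<longlonglongrightarrow> w" using LIMSEQ_subseq_LIMSEQ[OF w that(1)] by (simp add: o_def)
    then show ?thesis using tendsto_adjoint[OF that(2)] LIMSEQ_unique by blast
  qed
  obtain q1 x1 y1 where q1: "strict_mono q1" "(\<lambda>n. x (int (q1 n))) \<longlonglongrightarrow> x1" "(\<lambda>n. y (int (q1 n))) \<longlonglongrightarrow> y1"
    using convergent_subsequence[OF s, of "\<lambda>n. n"] by blast
  have s1: "saddle x1 y1" by (rule subsequence_limit(5)[OF s q1])
  have "?z \<longlonglongrightarrow> (x1, y1)"
  proof (rule tendsto_if_unique_subseq_limit[OF bounded_range_iterates[OF s]])
    fix q2 :: "nat \<Rightarrow> nat" and l
    assume q: "strict_mono q2" "(\<lambda>n. ?z (q2 n)) \<longlonglongrightarrow> l"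
    define x2 y2 where "x2 = fst l" and "y2 = snd l"
    have l2: "(\<lambda>n. x (int (q2 n))) \<longlonglongrightarrow> x2" "(\<lambda>n. y (int (q2 n))) \<longlonglongrightarrow> y2"
      using tendsto_fst[OF q(2)] tendsto_snd[OF q(2)] by (simp_all add: x2_def y2_def)
    have s2: "saddle x2 y2" by (rule subsequence_limit(5)[OF s q(1) l2])
    have "adjoint A y1 = adjoint A y2" using adj[OF q1(1,3)] adj[OF q(1) l2(2)] by simp
    then have "P x1 y2 k = P x1 y1 k" for k by (simp add: P_def)
    then have P12: "P x1 y1 k = P x2 y2 k" for k using saddle_interchange(2)[OF s1 s2] by simp
    define W where "W n = V x1 y1 (int n) - V x2 y2 (int n)" for n
    obtain c where c: "W \<longlonglongrightarrow> c"
      using convergent_diff[OF V_convergent[OF s1] V_convergent[OF s2]] by (auto simp: convergent_def W_def[abs_def])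
    have We: "W n = 1 / 2 * (norm (x (int n) - x1))\<^sup>2 + 1 / (2 * t\<^sup>2) * (norm (y (int n) - y1))\<^sup>2
        - (1 / 2 * (norm (x (int n) - x2))\<^sup>2 + 1 / (2 * t\<^sup>2) * (norm (y (int n) - y2))\<^sup>2)" for n
      by (simp add: W_def V_def P12)
    have sub: "c = 1 / 2 * (norm (a - x1))\<^sup>2 + 1 / (2 * t\<^sup>2) * (norm (b - y1))\<^sup>2
        - (1 / 2 * (norm (a - x2))\<^sup>2 + 1 / (2 * t\<^sup>2) * (norm (b - y2))\<^sup>2)"
      if "strict_mono q" "(\<lambda>n. x (int (q n))) \<longlonglongrightarrow> a" "(\<lambda>n. y (int (q n))) \<longlonglongrightarrow> b" for q a b
    proof (rule LIMSEQ_unique)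
      show "(\<lambda>n. W (q n)) \<longlonglongrightarrow> c" using LIMSEQ_subseq_LIMSEQ[OF c that(1)] by (simp add: o_def)
      show "(\<lambda>n. W (q n)) \<longlonglongrightarrow> 1 / 2 * (norm (a - x1))\<^sup>2 + 1 / (2 * t\<^sup>2) * (norm (b - y1))\<^sup>2
        - (1 / 2 * (norm (a - x2))\<^sup>2 + 1 / (2 * t\<^sup>2) * (norm (b - y2))\<^sup>2)"
        unfolding We by (intro tendsto_intros that)
    qed
    \<comment> \<open>Along the two subsequences the same limit \<open>c\<close> equals minus and
      plus the weighted squared distance of the two limit points.\<close>
    have "1 / 2 * (norm (x1 - x2))\<^sup>2 + 1 / (2 * t\<^sup>2) * (norm (y1 - y2))\<^sup>2 = 0"
      using sub[OF q1] sub[OF q(1) l2] by (simp add: norm_minus_commute)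
    moreover have "0 \<le> 1 / 2 * (norm (x1 - x2))\<^sup>2" "0 \<le> 1 / (2 * t\<^sup>2) * (norm (y1 - y2))\<^sup>2" by simp_all
    ultimately have "1 / 2 * (norm (x1 - x2))\<^sup>2 = 0" "1 / (2 * t\<^sup>2) * (norm (y1 - y2))\<^sup>2 = 0" by linarith+
    then have "x1 = x2" "y1 = y2" using t_pos by simp_all
    then show "l = (x1, y1)" by (simp add: x2_def y2_def)
  qed
  from tendsto_fst[OF this] tendsto_snd[OF this] s1 show thesis using that by simp
qed

lemma iterates_converge:
  assumes s: "saddle xs ys"
  obtains xl yl where "saddle xl yl" "(\<lambda>n. x (int n)) \<longlonglongrightarrow> xl" "(\<lambda>n. y (int n)) \<longlonglongrightarrow> yl"
  using converges_if_slack_not_summable[OF s] converges_if_slack_summable[OF s] by blast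

end

section \<open>The two algorithms\<close>

lemma norm_adjoint_le:
  fixes A :: "'a::euclidean_space \<Rightarrow> 'b::euclidean_space"
  assumes "linear A"
  shows "norm (adjoint A v) \<le> onorm A * norm v"
proof -
  have "norm (adjoint A v) * norm (adjoint A v) = A (adjoint A v) \<bullet> v"
    using adjoint_works[OF assms, of "adjoint A v" v] by (simp add: power2_norm_eq_inner flip: power2_eq_square)
  also have "\<dots> \<le> norm (A (adjoint A v)) * norm v" by (rule norm_cauchy_schwarz)
  also have "\<dots> \<le> (onorm A * norm (adjoint A v)) * norm v"
    using assms by (intro mult_right_mono onorm) (auto simp: linear_conv_bounded_linear)
  finally have "norm (adjoint A v) * norm (adjoint A v) \<le> (onorm A * norm v) * norm (adjoint A v)"
    by (simp add: mult_ac)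
  moreover have "0 \<le> onorm A * norm v"
    using assms by (intro mult_nonneg_nonneg onorm_pos_le) (auto simp: linear_conv_bounded_linear)
  ultimately show ?thesis by (cases "norm (adjoint A v) = 0") (auto simp: mult_le_cancel_right)
qed

text \<open>The common core of both algorithms: the backtracking loop is reduced to its accepted
  inequality and the bound \<open>\<eta>m\<close>. The primal update is indexed so that it includes
  the initial step that produces \<open>x 0\<close>.\<close>

definition adaptive_scheme ::
  "('a::euclidean_space \<Rightarrow> real) \<Rightarrow> ('a \<Rightarrow> ereal) \<Rightarrow> ('b::euclidean_space \<Rightarrow> ereal) \<Rightarrow> ('a \<Rightarrow> 'b)
    \<Rightarrow> real \<Rightarrow> real \<Rightarrow> real \<Rightarrow> real
    \<Rightarrow> (int \<Rightarrow> 'a) \<Rightarrow> (int \<Rightarrow> 'b) \<Rightarrow> (int \<Rightarrow> real) \<Rightarrow> (int \<Rightarrow> real) \<Rightarrow> bool" where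
  "adaptive_scheme f g h A t \<epsilon> \<nu> \<eta>m x y \<gamma> \<eta> \<longleftrightarrow>
     0 < \<gamma> (-1) \<and> \<gamma> (-1) \<le> \<gamma> 0 \<and> ereal (\<gamma> 0) \<le> 1 / ereal (2 * \<nu> * t * \<eta> 0) \<and>
     (\<forall>k\<ge>0. 0 \<le> \<eta> k \<and> \<eta> k \<le> \<eta>m) \<and>
     (\<forall>k\<ge>0. x k = prox (\<gamma> k) g (x (k - 1) - \<gamma> k *\<^sub>R gradient f (x (k - 1)) - \<gamma> k *\<^sub>R adjoint A (y k))) \<and>
     (\<forall>k\<ge>0. \<gamma> (k + 1) = stepsize f t \<epsilon> \<nu> x \<gamma> \<eta> k (\<eta> (k + 1)) \<and>
        y (k + 1) = dual_update h A t x y \<gamma> k (\<gamma> (k + 1)) \<and>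
        norm (adjoint A (y (k + 1) - y k)) \<le> \<eta> (k + 1) * norm (y (k + 1) - y k))"

lemma int_ge_0_cases: "(\<And>k. k \<ge> 0 \<Longrightarrow> Q (k + 1)) \<Longrightarrow> Q 0 \<Longrightarrow> k \<ge> 0 \<Longrightarrow> Q (k::int)"
  by (metis add.commute diff_add_cancel int_one_le_iff_zero_less le_diff_eq order_le_less add_0)

lemma adaPDM_scheme:
  assumes "linear A" "adaPDM f g h A t \<epsilon> \<nu> x y \<gamma> \<eta>"
  shows "adaptive_scheme f g h A t \<epsilon> \<nu> (onorm A) x y \<gamma> \<eta>"
proof -
  have "0 \<le> onorm A" using assms(1) by (intro onorm_pos_le) (simp add: linear_conv_bounded_linear)
  moreover have "x k = prox (\<gamma> k) g (x (k - 1) - \<gamma> k *\<^sub>R gradient f (x (k - 1)) - \<gamma> k *\<^sub>R adjoint A (y k))"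
    if "k \<ge> 0" for k
    using that by (rule int_ge_0_cases[rotated 2]) (use assms(2) in \<open>auto simp: adaPDM_def\<close>)
  ultimately show ?thesis
    using assms(2) norm_adjoint_le[OF assms(1)] by (simp add: adaptive_scheme_def adaPDM_def)
qed

text \<open>The last rejected candidate lies below a quotient that is at most
  \<open>onorm A\<close>, and the accepted value is \<open>r\<close> times as large. Without a
  rejection the bound on the previous estimate persists.\<close>

lemma adaPDM_plus_scheme:
  assumes "linear A" "r > 1" "adaPDM_plus r f g h A t \<epsilon> \<nu> x y \<gamma> \<eta>"
  shows "adaptive_scheme f g h A t \<epsilon> \<nu> (max (\<eta> 0) (r * onorm A)) x y \<gamma> \<eta>"
proof -
  let ?m = "max (\<eta> 0) (r * onorm A)"
  have on0: "0 \<le> onorm A" using assms(1) by (intro onorm_pos_le) (simp add: linear_conv_bounded_linear)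
  have step: "\<gamma> (k + 1) = stepsize f t \<epsilon> \<nu> x \<gamma> \<eta> k (\<eta> (k + 1))"
      "y (k + 1) = dual_update h A t x y \<gamma> k (\<gamma> (k + 1))"
      "\<exists>e j. 0 < e \<and> e \<le> \<eta> k \<and> \<eta> (k + 1) = r ^ j * e \<and>
           (\<forall>i<j. \<not> backtrack_ok f h A t \<epsilon> \<nu> x y \<gamma> \<eta> k (r ^ i * e)) \<and>
           backtrack_ok f h A t \<epsilon> \<nu> x y \<gamma> \<eta> k (\<eta> (k + 1))"
    if "k \<ge> 0" for k
    using assms(3) that by (auto simp: adaPDM_plus_def)
  have xk: "x k = prox (\<gamma> k) g (x (k - 1) - \<gamma> k *\<^sub>R gradient f (x (k - 1)) - \<gamma> k *\<^sub>R adjoint A (y k))"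
    if "k \<ge> 0" for k
    using that by (rule int_ge_0_cases[rotated 2]) (use assms(3) in \<open>auto simp: adaPDM_plus_def\<close>)
  have eta: "0 < \<eta> k \<and> \<eta> k \<le> ?m" if "k \<ge> 0" for k
    using that
  proof (induction k rule: int_ge_induct)
    case base
    then show ?case using assms(3) by (simp add: adaPDM_plus_def)
  next
    case (step k)
    obtain e j where e: "0 < e" "e \<le> \<eta> k" "\<eta> (k + 1) = r ^ j * e"
        "\<And>i. i < j \<Longrightarrow> \<not> backtrack_ok f h A t \<epsilon> \<nu> x y \<gamma> \<eta> k (r ^ i * e)"
      using \<open>\<And>k. k \<ge> 0 \<Longrightarrow> \<exists>e j. _ k e j\<close>[OF step(1)] by blast
    have "0 < \<eta> (k + 1)" using e assms(2) by simp
    moreover have "\<eta> (k + 1) \<le> ?m"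
    proof (cases j)
      case 0
      then show ?thesis using e step by simp
    next
      case (Suc i)
      define d where "d = dual_update h A t x y \<gamma> k (stepsize f t \<epsilon> \<nu> x \<gamma> \<eta> k (r ^ i * e)) - y k"
      have "r ^ i * e < norm (adjoint A d) / norm d"
        using e(4)[of i] Suc by (simp add: backtrack_ok_def Let_def d_def)
      also have "\<dots> \<le> onorm A"
        using norm_adjoint_le[OF assms(1), of d] on0 by (cases "d = 0") (auto simp: field_simps)
      finally have "r * (r ^ i * e) \<le> r * onorm A" using assms(2) by simp
      then show ?thesis using e(3) Suc by simp
    qed
    ultimately show ?case by simp
  qed
  have "norm (adjoint A (y (k + 1) - y k)) \<le> \<eta> (k + 1) * norm (y (k + 1) - y k)" if "k \<ge> 0" for k
  proof -
    have "backtrack_ok f h A t \<epsilon> \<nu> x y \<gamma> \<eta> k (\<eta> (k + 1))" using step(3)[OF that] by blast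
    then have "norm (adjoint A (y (k + 1) - y k)) / norm (y (k + 1) - y k) \<le> \<eta> (k + 1)"
      unfolding backtrack_ok_def Let_def step(1)[OF that, symmetric] step(2)[OF that, symmetric] .
    \<comment> \<open>If the dual iterate does not move, the quotient is 0 / 0 = 0 and both sides of
      the claim are 0.\<close>
    then show ?thesis
      using norm_adjoint_le[OF assms(1), of "y (k + 1) - y k"]
      by (cases "y (k + 1) = y k") (auto simp: divide_le_eq)
  qed
  then show ?thesis
    using assms(3) xk eta step by (auto simp: adaptive_scheme_def adaPDM_plus_def intro: less_imp_le)
qed

text \<open>The facts depend on each other: positivity and the cap at \<open>k\<close> make the
  numerator \<open>1 - 4 * xi t \<gamma> \<eta> k * (1 + \<epsilon>)\<^sup>2\<close> positive, and
  only then do \<open>stepsize_pos\<close> and \<open>stepsize_ge_iff\<close> apply to the next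
  stepsize. The induction precedes the locale, whose assumptions it supplies.\<close>

lemma adaptive_scheme_gamma:
  assumes "adaptive_scheme f g h A t \<epsilon> \<nu> \<eta>m x y \<gamma> \<eta>" "t > 0" "\<epsilon> > 0" "\<nu> > 1 + \<epsilon>" "k \<ge> 0"
  shows "0 < \<gamma> (k - 1) \<and> 0 < \<gamma> k \<and> 2 * \<nu> * t * \<eta> k * \<gamma> k \<le> 1"
    and "0 < 1 - 4 * xi t \<gamma> \<eta> k * (1 + \<epsilon>)\<^sup>2"
proof -
  note S = assms(1)[unfolded adaptive_scheme_def]
  have eta: "0 \<le> \<eta> k" if "k \<ge> 0" for k using S that by blast
  have nu: "0 < \<nu>" using assms by simp
  have \<kappa>: "0 < 1 - 4 * xi t \<gamma> \<eta> k * (1 + \<epsilon>)\<^sup>2"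
    if "k \<ge> 0" "0 < \<gamma> k" "2 * \<nu> * t * \<eta> k * \<gamma> k \<le> 1" for k
  proof (cases "xi t \<gamma> \<eta> k = 0")
    case False
    have "(2 * \<nu> * t * \<eta> k * \<gamma> k)\<^sup>2 \<le> 1\<^sup>2"
      using that eta[of k] nu assms by (intro power_mono) auto
    then have "4 * xi t \<gamma> \<eta> k * \<nu>\<^sup>2 \<le> 1" by (simp add: xi_def power_mult_distrib mult_ac)
    moreover have "0 < xi t \<gamma> \<eta> k" using False by (simp add: xi_def)
    then have "4 * xi t \<gamma> \<eta> k * (1 + \<epsilon>)\<^sup>2 < 4 * xi t \<gamma> \<eta> k * \<nu>\<^sup>2"
      using assms by (intro mult_strict_left_mono power_strict_mono) auto
    ultimately show ?thesis by simp
  qed simp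
  have main: "0 < \<gamma> (k - 1) \<and> 0 < \<gamma> k \<and> 2 * \<nu> * t * \<eta> k * \<gamma> k \<le> 1" if "k \<ge> 0" for k
    using that
  proof (induction k rule: int_ge_induct)
    case base
    have "0 < \<gamma> 0" using S by linarith
    moreover have "2 * \<nu> * t * \<eta> 0 * \<gamma> 0 \<le> 1"
      using S \<open>0 < \<gamma> 0\<close> nu assms eta[of 0] by (subst ereal_le_one_divide[symmetric]) auto
    ultimately show ?case using S by simp
  next
    case (step k)
    then have pos: "0 < \<gamma> k" "0 < \<gamma> (k - 1)" and kap: "0 < 1 - 4 * xi t \<gamma> \<eta> k * (1 + \<epsilon>)\<^sup>2"
      using \<kappa> by auto
    have e0: "0 \<le> \<eta> (k + 1)" using eta step by simp
    have st: "\<gamma> (k + 1) = stepsize f t \<epsilon> \<nu> x \<gamma> \<eta> k (\<eta> (k + 1))" using S step by blast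
    have g1: "0 < \<gamma> (k + 1)"
      unfolding st by (rule stepsize_pos) (use pos kap e0 nu assms in auto)
    have "2 * \<nu> * t * \<eta> (k + 1) * \<gamma> (k + 1) \<le> 1"
      using stepsize_ge_iff[where f = f and x = x, OF pos(1) less_imp_le[OF nu] less_imp_le[OF assms(2)] e0 less_imp_le[OF assms(3)] g1 refl kap refl]
        st by simp
    then show ?case using pos g1 by simp
  qed
  show "0 < \<gamma> (k - 1) \<and> 0 < \<gamma> k \<and> 2 * \<nu> * t * \<eta> k * \<gamma> k \<le> 1" using main assms(5) .
  show "0 < 1 - 4 * xi t \<gamma> \<eta> k * (1 + \<epsilon>)\<^sup>2" using \<kappa> main assms(5) by blast
qed

lemma adaptive_scheme_locale:
  fixes f :: "'a::euclidean_space \<Rightarrow> real" and h :: "'b::euclidean_space \<Rightarrow> ereal"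
  assumes f: "convex_on UNIV f" "loc_lipschitz_gradient f"
    and g: "proper_fun g" "convex_fun g" "lsc_fun g"
    and h: "proper_fun h" "convex_fun h" "lsc_fun h"
    and A: "linear A" and par: "t > 0" "\<epsilon> > 0" "\<nu> > 1 + \<epsilon>"
    and S: "adaptive_scheme f g h A t \<epsilon> \<nu> \<eta>m x y \<gamma> \<eta>"
  shows "adaptive_primal_dual f (edom g) (\<lambda>z. real_of_ereal (g z)) (edom (conjugate h))
    (\<lambda>z. real_of_ereal (conjugate h z)) A t \<epsilon> \<nu> \<eta>m x y \<gamma> \<eta>"
proof (rule adaptive_primal_dual.intro)
  note S' = S[unfolded adaptive_scheme_def]
  note gam = adaptive_scheme_gamma[OF S par]
  have gc: "closed {(z, r::real). g z \<le> ereal r}" by (rule closed_epigraph_lsc) (rule g)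
  have hc: "closed {(z, r::real). h z \<le> ereal r}" by (rule closed_epigraph_lsc) (rule h)
  have hp: "proper_fun (conjugate h)" by (rule proper_fun_conjugate[OF h(1,2) hc])
  \<comment> \<open>\<open>real_of_ereal\<close> sends infinity to 0, so membership in the domain
    must accompany the real inequality for the two epigraphs to agree.\<close>
  have epi: "{(z, r::real). z \<in> edom u \<and> real_of_ereal (u z) \<le> r} = {(z, r). u z \<le> ereal r}"
    if "proper_fun u" for u :: "'c \<Rightarrow> ereal"
  proof -
    have "z \<in> edom u \<and> real_of_ereal (u z) \<le> r \<longleftrightarrow> u z \<le> ereal r" for z and r :: real
      using that by (cases "u z") (auto simp: proper_fun_def edom_def)
    then show ?thesis by simp
  qed
  show "closed {(z, r::real). z \<in> edom g \<and> real_of_ereal (g z) \<le> r}" unfolding epi[OF g(1)] by (rule gc)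
  show "closed {(z, r::real). z \<in> edom (conjugate h) \<and> real_of_ereal (conjugate h z) \<le> r}"
    unfolding epi[OF hp] by (rule closed_epigraph_conjugate)
  show "convex_on (edom (conjugate h)) (\<lambda>z. real_of_ereal (conjugate h z))"
    by (rule proper_convex_on[OF hp convex_fun_conjugate])
  show "x k \<in> edom g" if k: "k \<ge> 0" for k
    using prox_subgradient(1)[OF g(1,2) gc] gam(1)[OF k] S' k by blast
  show "real_of_ereal (g (x k)) + ((1 / \<gamma> k) *\<^sub>R (x (k - 1) - x k) - gradient f (x (k - 1)) - adjoint A (y k)) \<bullet> (z - x k)
      \<le> real_of_ereal (g z)" if k: "k \<ge> 0" and z: "z \<in> edom g" for k z
  proof -
    have p: "x k = prox (\<gamma> k) g (x (k - 1) - \<gamma> k *\<^sub>R gradient f (x (k - 1)) - \<gamma> k *\<^sub>R adjoint A (y k))"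
      using S' k by blast
    have "0 < \<gamma> k" using gam(1)[OF k] by simp
    have "(1 / \<gamma> k) *\<^sub>R (x (k - 1) - \<gamma> k *\<^sub>R gradient f (x (k - 1)) - \<gamma> k *\<^sub>R adjoint A (y k) - x k)
        = (1 / \<gamma> k) *\<^sub>R (x (k - 1) - x k) - gradient f (x (k - 1)) - adjoint A (y k)"
      using \<open>0 < \<gamma> k\<close> by (simp add: scaleR_diff_right)
    with prox_subgradient(2)[OF g(1,2) gc \<open>0 < \<gamma> k\<close> p z] show ?thesis by simp
  qed
  have yp: "y (k + 1) = prox (t\<^sup>2 * \<gamma> (k + 1)) (conjugate h) (y k + (t\<^sup>2 * \<gamma> (k + 1)) *\<^sub>R
      ((1 + \<gamma> (k + 1) / \<gamma> k) *\<^sub>R A (x k) - (\<gamma> (k + 1) / \<gamma> k) *\<^sub>R A (x (k - 1))))" if "k \<ge> 0" for k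
    using S' that unfolding dual_update_def by blast
  have sig: "0 < t\<^sup>2 * \<gamma> (k + 1)" if "k \<ge> 0" for k
    using gam(1)[of "k + 1"] that par(1) by simp
  note prox_y = prox_subgradient[OF hp convex_fun_conjugate closed_epigraph_conjugate sig yp]
  show "y (k + 1) \<in> edom (conjugate h)" if k: "k \<ge> 0" for k by (rule prox_y(1)[OF k k])
  show "real_of_ereal (conjugate h (y (k + 1))) + ((1 / (t\<^sup>2 * \<gamma> (k + 1))) *\<^sub>R (y k - y (k + 1))
        + A (x k) + (\<gamma> (k + 1) / \<gamma> k) *\<^sub>R A (x k - x (k - 1))) \<bullet> (v - y (k + 1)) \<le> real_of_ereal (conjugate h v)"
    if k: "k \<ge> 0" and v: "v \<in> edom (conjugate h)" for k v
  proof -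
    have "(1 / s) *\<^sub>R (a + s *\<^sub>R ((1 + q) *\<^sub>R b - q *\<^sub>R c) - d) = (1 / s) *\<^sub>R (a - d) + b + q *\<^sub>R (b - c)"
      if "0 < s" for s q and a b c d :: 'b
      using that by (simp add: algebra_simps)
    from this[OF sig[OF k]] prox_y(2)[OF k k v] show ?thesis by (simp add: linear_diff[OF A])
  qed
  show "0 < \<gamma> k" if "k \<ge> -1" for k using gam(1)[of "k + 1"] that by simp
  show "0 \<le> \<eta> k" "\<eta> k \<le> \<eta>m" if "k \<ge> 0" for k using S' that by auto
  show "2 * \<nu> * t * \<eta> k * \<gamma> k \<le> 1" if "k \<ge> 0" for k using gam(1)[OF that] by simp
  show "norm (adjoint A (y (k + 1) - y k)) \<le> \<eta> (k + 1) * norm (y (k + 1) - y k)" if "k \<ge> 0" for k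
    using S' that by blast
  show "c \<le> \<gamma> (k + 1) \<longleftrightarrow>
        c \<le> \<gamma> k * sqrt (1 + \<gamma> k / \<gamma> (k - 1)) \<and> 2 * \<nu> * t * \<eta> (k + 1) * c \<le> 1 \<and>
        c\<^sup>2 * (2 * (1 + \<epsilon>) * (sqrt ((delta f x \<gamma> k)\<^sup>2
          + (t * \<eta> (k + 1) * \<gamma> k)\<^sup>2 * (1 - 4 * xi t \<gamma> \<eta> k * (1 + \<epsilon>)\<^sup>2)) + delta f x \<gamma> k))
        \<le> (\<gamma> k)\<^sup>2 * (1 - 4 * xi t \<gamma> \<eta> k * (1 + \<epsilon>)\<^sup>2)"
    if k: "k \<ge> 0" and c: "0 < c" for k c
  proof -
    have st: "\<gamma> (k + 1) = stepsize f t \<epsilon> \<nu> x \<gamma> \<eta> k (\<eta> (k + 1))" using S' k by blast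
    have "0 < \<gamma> k" using gam(1)[OF k] by simp
    moreover have "0 \<le> \<eta> (k + 1)" using S' k by simp
    ultimately show ?thesis
      unfolding st using par c gam(2)[OF k] by (intro stepsize_ge_iff) auto
  qed
qed (use f A par in auto)

section \<open>The explicit lower bound \<open>gamma_hat\<close>\<close>

lemma ereal_le_divide:
  assumes "0 < a" "0 \<le> b"
  shows "ereal c \<le> ereal a / ereal b \<longleftrightarrow> c * b \<le> a" and "0 < ereal a / ereal b"
  using assms by (cases "b = 0"; simp add: field_simps)+

text \<open>Each entry becomes the denominator-free condition required by
  \<open>gamma_lower_bound\<close>. For \<open>\<eta>m = 0\<close> several entries are infinite, but
  \<open>\<gamma>0\<close> keeps the minimum finite.\<close>

lemma gamma_hat_bounds:
  fixes t \<epsilon> \<nu> \<gamma>0 \<eta>m L :: real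
  assumes "t > 0" "\<epsilon> > 0" "\<nu> > 1 + \<epsilon>" "\<gamma>0 > 0" "\<eta>m \<ge> 0" "L > 0"
  defines "nb \<equiv> (\<nu>\<^sup>2 - (1 + \<epsilon>)\<^sup>2) / \<nu>\<^sup>2"
  obtains c where "gamma_hat t \<epsilon> \<nu> \<gamma>0 \<eta>m L = ereal c" "0 < c" "c \<le> \<gamma>0"
    "c\<^sup>2 * (2 * (1 + \<epsilon>) * t * \<eta>m * L) \<le> sqrt nb" "4 * (1 + \<epsilon>) * L\<^sup>2 * c\<^sup>2 \<le> nb"
    "2 * \<nu> * t * \<eta>m * c \<le> 1" "c * (2 * (1 + \<epsilon>) * t * \<eta>m) \<le> sqrt nb"
proof -
  have nb: "0 < nb" using assms(2,3) unfolding nb_def by (intro divide_pos_pos) (auto simp: power_strict_mono)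
  let ?w = "2 * (1 + \<epsilon>) * t * \<eta>m * L"
  define e2 e3 e4 e5
    where "e2 = ereal (root 4 nb) / ereal (sqrt ?w)"
      and "e3 = ereal (sqrt nb) / ereal (2 * sqrt (1 + \<epsilon>) * L)"
      and "e4 = 1 / ereal (2 * \<nu> * t * \<eta>m)"
      and "e5 = ereal (sqrt nb) / ereal (2 * (1 + \<epsilon>) * t * \<eta>m)"
  have w: "0 \<le> ?w" using assms(1,2,5,6) by simp
  have r4: "0 < root 4 nb" "(root 4 nb)\<^sup>2 = sqrt nb"
  proof -
    have "root 4 nb = sqrt (sqrt nb)" using real_root_mult_exp[of 2 2 nb] by (simp add: sqrt_def)
    then show "0 < root 4 nb" "(root 4 nb)\<^sup>2 = sqrt nb" using nb by simp_all
  qed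
  have gh: "gamma_hat t \<epsilon> \<nu> \<gamma>0 \<eta>m L = Min {ereal \<gamma>0, e2, e3, e4, e5}"
    unfolding gamma_hat_def Let_def nb_def e2_def e3_def e4_def e5_def ..
  have b: "0 \<le> sqrt ?w" "0 \<le> 2 * sqrt (1 + \<epsilon>) * L" "0 \<le> 2 * \<nu> * t * \<eta>m" "0 \<le> 2 * (1 + \<epsilon>) * t * \<eta>m"
    using assms(1-3,5,6) w by auto
  have snb: "0 < sqrt nb" using nb by simp
  have epos: "0 < e2" "0 < e3" "0 < e4" "0 < e5"
    unfolding e2_def e3_def e4_def e5_def one_ereal_def
    by (rule ereal_le_divide(2)[OF r4(1) b(1)] ereal_le_divide(2)[OF snb b(2)]
      ereal_le_divide(2)[OF zero_less_one b(3)] ereal_le_divide(2)[OF snb b(4)])+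
  have pos: "0 < gamma_hat t \<epsilon> \<nu> \<gamma>0 \<eta>m L"
    unfolding gh using epos assms(4) by simp
  have le: "gamma_hat t \<epsilon> \<nu> \<gamma>0 \<eta>m L \<le> ereal \<gamma>0" "gamma_hat t \<epsilon> \<nu> \<gamma>0 \<eta>m L \<le> e2"
    "gamma_hat t \<epsilon> \<nu> \<gamma>0 \<eta>m L \<le> e3" "gamma_hat t \<epsilon> \<nu> \<gamma>0 \<eta>m L \<le> e4" "gamma_hat t \<epsilon> \<nu> \<gamma>0 \<eta>m L \<le> e5"
    unfolding gh by (rule Min_le; simp)+
  obtain c where c: "gamma_hat t \<epsilon> \<nu> \<gamma>0 \<eta>m L = ereal c"
    using pos le(1) by (cases "gamma_hat t \<epsilon> \<nu> \<gamma>0 \<eta>m L") auto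
  have c0: "0 < c" using pos by (simp add: c)
  have "c * sqrt ?w \<le> root 4 nb" using le(2) ereal_le_divide(1)[OF r4(1) b(1)] unfolding c e2_def by blast
  then have "(c * sqrt ?w)\<^sup>2 \<le> (root 4 nb)\<^sup>2" using c0 b by (intro power_mono) auto
  then have 2: "c\<^sup>2 * ?w \<le> sqrt nb" using r4 w by (simp only: power_mult_distrib real_sqrt_pow2)
  have "c * (2 * sqrt (1 + \<epsilon>) * L) \<le> sqrt nb" using le(3) ereal_le_divide(1)[OF snb b(2)] unfolding c e3_def by blast
  then have "(c * (2 * sqrt (1 + \<epsilon>) * L))\<^sup>2 \<le> (sqrt nb)\<^sup>2" using c0 b by (intro power_mono) auto
  then have 3: "4 * (1 + \<epsilon>) * L\<^sup>2 * c\<^sup>2 \<le> nb"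
    using assms(2) nb by (simp add: power_mult_distrib mult_ac)
  have 4: "2 * \<nu> * t * \<eta>m * c \<le> 1" using le(4) ereal_le_one_divide[OF b(3) c0] unfolding c e4_def by blast
  have 5: "c * (2 * (1 + \<epsilon>) * t * \<eta>m) \<le> sqrt nb"
    using le(5) ereal_le_divide(1)[OF snb b(4)] unfolding c e5_def by blast
  show thesis using that[OF c c0 _ 2 3 4 5] le(1) by (simp add: c)
qed

theorem theorem3p4:
  fixes f :: "real ^ 'n \<Rightarrow> real"
    and g :: "real ^ 'n \<Rightarrow> ereal"
    and h :: "real ^ 'm \<Rightarrow> ereal"
    and A :: "real ^ 'n \<Rightarrow> real ^ 'm"
    and t \<epsilon> \<nu> r \<eta>max :: real
    and x :: "int \<Rightarrow> real ^ 'n" and y :: "int \<Rightarrow> real ^ 'm"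
    and \<gamma> \<eta> :: "int \<Rightarrow> real"
    and xs :: "real ^ 'n" and ys :: "real ^ 'm"
  defines "P \<equiv> primal_gap f g A x xs ys"
    and "Q \<equiv> dual_gap h A y xs ys"
    and "U \<equiv> lyapunov f g A t \<epsilon> x y \<gamma> \<eta> xs ys"
    and "\<rho> \<equiv> \<lambda>k. \<gamma> k / \<gamma> (k - 1)"
  assumes "convex_on UNIV f" and "loc_lipschitz_gradient f"
    and "proper_fun g" and "convex_fun g" and "lsc_fun g"
    and "proper_fun h" and "convex_fun h" and "lsc_fun h"
    and "linear A"
    and "\<exists>z. \<forall>w. ereal (f z) + g z + h (A z) \<le> ereal (f w) + g w + h (A w)"
    and "\<exists>z \<in> rel_interior (edom g). A z \<in> rel_interior (edom h)"
    and "t > 0" and "\<epsilon> > 0" and "\<nu> > 1 + \<epsilon>"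
    and "(adaPDM f g h A t \<epsilon> \<nu> x y \<gamma> \<eta> \<and> \<eta>max = onorm A) \<or>
         (r > 1 \<and> adaPDM_plus r f g h A t \<epsilon> \<nu> x y \<gamma> \<eta> \<and> \<eta>max = max (\<eta> 0) (r * onorm A))"
    and "primal_dual_solution f g h A xs ys"
  shows
    "(\<forall>k\<ge>1.
        U (k + 1) \<le> U k
           - ereal (\<epsilon> / (2 * t\<^sup>2 * (1 + \<epsilon>)) * (norm (y (k + 1) - y k))\<^sup>2)
           - ereal (decrease_coeff f t \<epsilon> x \<gamma> \<eta> k * (norm (x k - x (k - 1)))\<^sup>2)
           - ereal (\<gamma> k * (1 + \<rho> k - (\<rho> (k + 1))\<^sup>2)) * P (k - 1)
           - ereal (\<gamma> (k + 1)) * Q (k + 1) \<and>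
        decrease_coeff f t \<epsilon> x \<gamma> \<eta> k \<ge> \<epsilon> / (4 * (1 + \<epsilon>)) \<and>
        1 + \<rho> k - (\<rho> (k + 1))\<^sup>2 \<ge> 0)
     \<and> (bounded (range (\<lambda>k::nat. (x (int k), y (int k)))) \<and>
        (\<forall>V L. compact V \<and> convex V \<and> (\<forall>k\<ge>-1. x k \<in> V) \<and>
               L > 0 \<and> L-lipschitz_on (V + {z. norm z \<le> diameter V}) (gradient f) \<longrightarrow>
               0 < gamma_hat t \<epsilon> \<nu> (\<gamma> 0) \<eta>max L \<and>
               (\<forall>k\<ge>1. gamma_hat t \<epsilon> \<nu> (\<gamma> 0) \<eta>max L \<le> ereal (\<gamma> k))))
     \<and> (liminf (\<lambda>k. P (int k)) = 0 \<and> (\<lambda>k. Q (int k)) \<longlonglongrightarrow> 0)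
     \<and> (\<exists>xl yl. primal_dual_solution f g h A xl yl \<and>
          (\<lambda>k. (x (int k), y (int k))) \<longlonglongrightarrow> (xl, yl))"
proof -
  have scheme: "adaptive_scheme f g h A t \<epsilon> \<nu> \<eta>max x y \<gamma> \<eta>"
    using assms(19)
  proof (elim disjE conjE)
    assume "adaPDM f g h A t \<epsilon> \<nu> x y \<gamma> \<eta>" "\<eta>max = onorm A"
    then show ?thesis using adaPDM_scheme[OF assms(13)] by simp
  next
    assume "r > 1" "adaPDM_plus r f g h A t \<epsilon> \<nu> x y \<gamma> \<eta>" "\<eta>max = max (\<eta> 0) (r * onorm A)"
    then show ?thesis using adaPDM_plus_scheme[OF assms(13)] by simp
  qed
  define G where "G z = real_of_ereal (g z)" for z
  define H where "H z = real_of_ereal (conjugate h z)" for z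
  have hc: "closed {(z, s::real). h z \<le> ereal s}" by (rule closed_epigraph_lsc[OF assms(12)])
  have hp: "proper_fun (conjugate h)" by (rule proper_fun_conjugate[OF assms(10,11) hc])
  interpret pd: adaptive_primal_dual f "edom g" G "edom (conjugate h)" H A t \<epsilon> \<nu> \<eta>max x y \<gamma> \<eta>
    unfolding G_def[abs_def] H_def[abs_def]
    by (rule adaptive_scheme_locale) (use assms scheme in auto)
  have G: "g z = ereal (G z)" if "z \<in> edom g" for z
    using proper_fun_real[OF assms(7) that] by (simp add: G_def)
  have H: "conjugate h z = ereal (H z)" if "z \<in> edom (conjugate h)" for z
    using proper_fun_real[OF hp that] by (simp add: H_def)
  have sub_g: "- gradient f xs - adjoint A ys \<in> subdifferential g xs"
    and sub_h: "A xs \<in> subdifferential (conjugate h) ys"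
  proof -
    obtain v w where v: "v \<in> subdifferential (conjugate h) ys" "0 = - A xs + v"
      and w: "w \<in> subdifferential g xs" "0 = adjoint A ys + gradient f xs + w"
      using assms(20) unfolding primal_dual_solution_def by blast
    have "v = A xs" "w = - gradient f xs - adjoint A ys"
      using v(2) w(2) by (simp_all add: eq_neg_iff_add_eq_0 algebra_simps)
    then show "- gradient f xs - adjoint A ys \<in> subdifferential g xs"
      "A xs \<in> subdifferential (conjugate h) ys" using v w by auto
  qed
  have xsD: "xs \<in> edom g" by (rule subdifferential_proper(1)[OF assms(7) sub_g])
  have ysE: "ys \<in> edom (conjugate h)" by (rule subdifferential_proper(1)[OF hp sub_h])
  have sad: "pd.saddle xs ys"
    unfolding pd.saddle_def
  proof (intro conjI ballI xsD ysE)
    fix z assume "z \<in> edom g"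
    from subdifferential_proper(2)[OF assms(7) sub_g this] pd.gradient_ineq[of xs z]
    show "f xs + G xs \<le> f z + G z + (z - xs) \<bullet> adjoint A ys"
      by (simp add: G_def inner_diff_left inner_commute[of _ "adjoint A ys"])
  next
    fix z assume "z \<in> edom (conjugate h)"
    from subdifferential_proper(2)[OF hp sub_h this]
    show "H ys \<le> H z + A xs \<bullet> (ys - z)" by (simp add: H_def inner_diff_right)
  qed
  let ?P = "pd.P xs ys" and ?Q = "pd.Q xs ys" and ?U = "pd.U xs ys"
  have Pe: "primal_gap f g A x xs ys k = ereal (?P k)" if "k \<ge> 0" for k
    using G[OF pd.x_in[OF that]] G[OF xsD] by (simp add: primal_gap_def pd.P_def)
  have Qe: "dual_gap h A y xs ys k = ereal (?Q k)" if "k \<ge> 1" for k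
    using H[OF pd.y_in[of "k - 1"]] H[OF ysE] that by (simp add: dual_gap_def pd.Q_def)
  have Ue: "lyapunov f g A t \<epsilon> x y \<gamma> \<eta> xs ys k = ereal (?U k)" if "k \<ge> 1" for k
    using Pe[of "k - 1"] that by (simp add: lyapunov_def pd.U_def)
  have step: "lyapunov f g A t \<epsilon> x y \<gamma> \<eta> xs ys (k + 1) \<le> lyapunov f g A t \<epsilon> x y \<gamma> \<eta> xs ys k
           - ereal (\<epsilon> / (2 * t\<^sup>2 * (1 + \<epsilon>)) * (norm (y (k + 1) - y k))\<^sup>2)
           - ereal (decrease_coeff f t \<epsilon> x \<gamma> \<eta> k * (norm (x k - x (k - 1)))\<^sup>2)
           - ereal (\<gamma> k * (1 + \<rho> k - (\<rho> (k + 1))\<^sup>2)) * primal_gap f g A x xs ys (k - 1)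
           - ereal (\<gamma> (k + 1)) * dual_gap h A y xs ys (k + 1)" if "k \<ge> 1" for k
  proof -
    have "k \<ge> 0" "k - 1 \<ge> 0" "k + 1 \<ge> 1" using that by simp_all
    show ?thesis
      unfolding Ue[OF that] Ue[OF \<open>k + 1 \<ge> 1\<close>] Pe[OF \<open>k - 1 \<ge> 0\<close>] Qe[OF \<open>k + 1 \<ge> 1\<close>] \<rho>_def
      using pd.U_descent[OF that xsD ysE] by simp
  qed
  have part1: "\<forall>k\<ge>1. U (k + 1) \<le> U k
           - ereal (\<epsilon> / (2 * t\<^sup>2 * (1 + \<epsilon>)) * (norm (y (k + 1) - y k))\<^sup>2)
           - ereal (decrease_coeff f t \<epsilon> x \<gamma> \<eta> k * (norm (x k - x (k - 1)))\<^sup>2)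
           - ereal (\<gamma> k * (1 + \<rho> k - (\<rho> (k + 1))\<^sup>2)) * P (k - 1)
           - ereal (\<gamma> (k + 1)) * Q (k + 1) \<and>
        decrease_coeff f t \<epsilon> x \<gamma> \<eta> k \<ge> \<epsilon> / (4 * (1 + \<epsilon>)) \<and>
        1 + \<rho> k - (\<rho> (k + 1))\<^sup>2 \<ge> 0"
  proof (intro allI impI conjI)
    fix k :: int
    assume k: "k \<ge> 1"
    then show "\<epsilon> / (4 * (1 + \<epsilon>)) \<le> decrease_coeff f t \<epsilon> x \<gamma> \<eta> k" by (intro pd.decrease_coeff_ge) simp
    show "0 \<le> 1 + \<rho> k - (\<rho> (k + 1))\<^sup>2" using pd.rho_growth[of k] k by (simp add: \<rho>_def)
  qed (unfold P_def Q_def U_def, rule step)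
  have part2: "0 < gamma_hat t \<epsilon> \<nu> (\<gamma> 0) \<eta>max L \<and> (\<forall>k\<ge>1. gamma_hat t \<epsilon> \<nu> (\<gamma> 0) \<eta>max L \<le> ereal (\<gamma> k))"
    if V: "compact V" "convex V" "\<forall>k\<ge>-1. x k \<in> V"
      and L: "L > 0" "L-lipschitz_on (V + {z. norm z \<le> diameter V}) (gradient f)" for V L
  proof -
    have "\<eta>max \<ge> 0" using pd.eta_nonneg[of 0] pd.eta_le[of 0] by simp
    from gamma_hat_bounds[OF assms(16,17,18) pd.gamma_pos[of 0] this L(1)] obtain c where
      c: "gamma_hat t \<epsilon> \<nu> (\<gamma> 0) \<eta>max L = ereal c" "0 < c" "c \<le> \<gamma> 0"
        "c\<^sup>2 * (2 * (1 + \<epsilon>) * t * \<eta>max * L) \<le> sqrt ((\<nu>\<^sup>2 - (1 + \<epsilon>)\<^sup>2) / \<nu>\<^sup>2)"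
        "4 * (1 + \<epsilon>) * L\<^sup>2 * c\<^sup>2 \<le> (\<nu>\<^sup>2 - (1 + \<epsilon>)\<^sup>2) / \<nu>\<^sup>2"
        "2 * \<nu> * t * \<eta>max * c \<le> 1" "c * (2 * (1 + \<epsilon>) * t * \<eta>max) \<le> sqrt ((\<nu>\<^sup>2 - (1 + \<epsilon>)\<^sup>2) / \<nu>\<^sup>2)"
      by auto
    have "c \<le> \<gamma> k" if "k \<ge> 1" for k
      using pd.gamma_lower_bound[OF compact_imp_bounded[OF V(1)] V(2) _ L refl c(2-7), of k] V(3) that by simp
    then show ?thesis by (simp add: c)
  qed
  have part3: "liminf (\<lambda>k. P (int k)) = 0"
  proof (rule antisym)
    have P: "P (int k) = ereal (?P (int k))" for k unfolding P_def by (rule Pe) simp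
    show "0 \<le> liminf (\<lambda>k. P (int k))"
      by (rule Liminf_bounded) (simp add: P pd.P_nonneg[OF sad])
    show "liminf (\<lambda>k. P (int k)) \<le> 0"
    proof (rule ccontr)
      assume "\<not> ?thesis"
      then obtain c where c: "0 < ereal c" "ereal c < liminf (\<lambda>k. P (int k))"
        using ereal_dense2[of 0] by (auto simp: not_le)
      from less_LiminfD[OF c(2)] obtain N where "\<And>n. n \<ge> N \<Longrightarrow> c < ?P (int n)"
        by (auto simp: eventually_sequentially P)
      then show False using pd.P_small[OF sad, of c N] c(1) by force
    qed
  qed
  have part4: "(\<lambda>k. Q (int k)) \<longlonglongrightarrow> 0"
  proof (rule LIMSEQ_imp_Suc)
    \<comment> \<open>\<open>Q 0\<close> may be infinite, as \<open>y 0\<close> is arbitrary; the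
      real limit is therefore transferred from index 1 on.\<close>
    have "Q (int (Suc k)) = ereal (?Q (int (Suc k)))" for k unfolding Q_def by (rule Qe) simp
    then show "(\<lambda>k. Q (int (Suc k))) \<longlonglongrightarrow> 0"
      using LIMSEQ_Suc[OF pd.Q_tendsto_zero[OF sad]] by (simp add: zero_ereal_def)
  qed
  have part5: "\<exists>xl yl. primal_dual_solution f g h A xl yl \<and> (\<lambda>k. (x (int k), y (int k))) \<longlonglongrightarrow> (xl, yl)"
  proof -
    obtain xl yl where l: "(\<lambda>n. x (int n)) \<longlonglongrightarrow> xl" "(\<lambda>n. y (int n)) \<longlonglongrightarrow> yl"
      using pd.iterates_converge[OF sad] by blast
    \<comment> \<open>A saddle point minimizes with \<open>f\<close> and \<open>g\<close> taken
      together, whereas a primal-dual solution asks for a subgradient of \<open>g\<close> alone. The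
      limit lemma supplies it, with the whole sequence as its own subsequence.\<close>
    note lim = pd.subsequence_limit[OF sad strict_mono_id, unfolded id_apply, OF l]
    have "- gradient f xl - adjoint A yl \<in> subdifferential g xl"
      using lim(1,3) by (intro subdifferential_properI[OF assms(7)]) (auto simp: G_def)
    moreover have "A xl \<in> subdifferential (conjugate h) yl"
      using lim(2,4) by (intro subdifferential_properI[OF hp]) (auto simp: H_def)
    ultimately have "primal_dual_solution f g h A xl yl"
      unfolding primal_dual_solution_def by (auto intro!: image_eqI)
    with tendsto_Pair[OF l] show ?thesis by blast
  qed
  show ?thesis
    using part2 by (intro conjI part1 part3 part4 part5 pd.bounded_range_iterates[OF sad]) blast
qed

end
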